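(* Let $k>0$, $D$ and $n$ be as described in the context. For $d\in\mathbb{S}^1$ let $u^s(\cdot,d)$ be the solution of the direct scattering problem of the context with plane-wave incident field $u^i(x,d)=e^{\mathrm{i}kx\cdot d}$, and let $u^\infty(\hat x,d)$, $\hat x\in\mathbb{S}^1$, be its far-field pattern as defined in the context. Then $$u^\infty(\hat x,d)=u^\infty(-d,-\hat x)\qquad\text{for all }\hat x,d\in\mathbb{S}^1.$$
   Context: Setting. $D\subset\mathbb{R}^2$ is a bounded open set with $C^2$-smooth boundary $\partial D$ with unit outward normal $\nu$. $k>0$ is the wavenumber. The coefficient $n$ is a complex-valued function with $\mathrm{supp}(n-1)=D$ (so $n=1$ outside $D$), $n\in L^\infty(D)$, and there is a constant $c>0$ with $\mathrm{Im}(n(x))\ge c>0$ for a.e. $x\in D$. Direct scattering problem (for the incident field $u^i(x,d)=e^{\mathrm{i}kx\cdot d}$). Find $u^s\in H^2_{loc}(\mathbb{R}^2)$ such that: (1) $\Delta^2u^s-k^4n(x)u^s=-k^4(1-n(x))u^i$ in $\mathbb{R}^2$; (2) the total field $u=u^s+u^i$ satisfies $[\![u]\!]=[\![\partial_\nu u]\!]=[\![\Delta u]\!]=[\![\partial_\nu\Delta u]\!]=0$ on $\partial D$, where $[\![\phi]\!]:=\phi_+|_{\partial D}-\phi_-|_{\partial D}$ is the difference of the traces taken from $\mathbb{R}^2\setminus\overline{D}$ ($+$) and from $D$ ($-$); (3) (radiation condition) with $r=|x|$, $\lim_{r\to\infty}\sqrt r(\partial_ru^s-\mathrm{i}ku^s)=0$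 and $\lim_{r\to\infty}\sqrt r(\partial_r\Delta u^s-\mathrm{i}k\Delta u^s)=0$, uniformly in all directions $\hat x=x/|x|\in\mathbb{S}^1$. Under these assumptions this problem has a unique solution. Far-field pattern. In $\mathbb{R}^2\setminus\overline{D}$ the scattered field decomposes as $u^s=u_{\mathrm{pr}}+u_{\mathrm{ev}}$, where $(\Delta+k^2)u_{\mathrm{pr}}=0$ and $(\Delta-k^2)u_{\mathrm{ev}}=0$ in $\mathbb{R}^2\setminus\overline{D}$, with $u_{\mathrm{pr}}$ satisfying the Sommerfeld radiation condition $\lim_{r\to\infty}\sqrt r(\partial_ru_{\mathrm{pr}}-\mathrm{i}ku_{\mathrm{pr}})=0$ and $u_{\mathrm{ev}}$ decaying exponentially at infinity. The far-field pattern is $$u^\infty(\hat x,d)=\int_{\partial B_R}\Big(u_{\mathrm{pr}}(y,d)\,\partial_{\nu_y}e^{-\mathrm{i}k\hat x\cdot y}-\partial_{\nu_y}u_{\mathrm{pr}}(y,d)\,e^{-\mathrm{i}k\hat x\cdot y}\Big)ds(y),\qquad\hat x\in\mathbb{S}^1,$$ where $B_R$ is any disk centered at the origin of radius $R>0$ with $\overline{D}\subset B_R$, $\nu_y$ is its outward unit normal, and $u_{\mathrm{pr}}(\cdot,d)$ is the propagating part of $u^s(\cdot,d)$. Equivalently, $u^s(x,d)=\frac{e^{\mathrm{i}\pi/4}}{\sqrt{8\pi k}}\frac{e^{\mathrm{i}k|x|}}{\sqrt{|x|}}\{u^\infty(\hat x,d)+\mathcal{O}(1/|x|)\}$ as $|x|\to\infty$.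 *)

theory Defs
  imports "HOL-Analysis.Analysis"
begin

section \<open>Classical derivatives in the plane\<close>

definition pd :: "2 \<Rightarrow> (real^2 \<Rightarrow> 'b::real_normed_vector) \<Rightarrow> real^2 \<Rightarrow> 'b" where
  "pd i f x = frechet_derivative f (at x) (axis i 1)"

definition dir_deriv :: "real^2 \<Rightarrow> (real^2 \<Rightarrow> 'b::real_normed_vector) \<Rightarrow> real^2 \<Rightarrow> 'b" where
  "dir_deriv v f x = frechet_derivative f (at x) v"

definition lap :: "(real^2 \<Rightarrow> 'b::real_normed_vector) \<Rightarrow> real^2 \<Rightarrow> 'b" where
  "lap f x = (\<Sum>i\<in>UNIV. pd i (pd i f) x)"

text \<open>The class \<open>C\<^sup>m\<close>; only used for open sets.\<close>

fun Ck_on :: "nat \<Rightarrow> (real^2) set \<Rightarrow> (real^2 \<Rightarrow> 'b::real_normed_vector) \<Rightarrow> bool" where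
  "Ck_on 0 S f \<longleftrightarrow> continuous_on S f"
| "Ck_on (Suc m) S f \<longleftrightarrow> (\<forall>x\<in>S. f differentiable (at x)) \<and> (\<forall>i. Ck_on m S (pd i f))"

definition smooth_on :: "(real^2) set \<Rightarrow> (real^2 \<Rightarrow> 'b::real_normed_vector) \<Rightarrow> bool" where
  "smooth_on S f \<longleftrightarrow> (\<forall>m. Ck_on m S f)"

section \<open>Weak derivatives and Sobolev regularity\<close>

definition test_function :: "(real^2) set \<Rightarrow> (real^2 \<Rightarrow> complex) \<Rightarrow> bool" where
  "test_function U \<phi> \<longleftrightarrow>
     smooth_on UNIV \<phi> \<and> (\<exists>K. compact K \<and> K \<subseteq> U \<and> (\<forall>x. x \<notin> K \<longrightarrow> \<phi> x = 0))"

definition L1_loc :: "(real^2) set \<Rightarrow> (real^2 \<Rightarrow> complex) \<Rightarrow> bool" where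
  "L1_loc U f \<longleftrightarrow> (\<forall>K. compact K \<and> K \<subseteq> U \<longrightarrow> set_integrable lebesgue K f)"

definition L2_loc :: "(real^2 \<Rightarrow> complex) \<Rightarrow> bool" where
  "L2_loc f \<longleftrightarrow> f \<in> borel_measurable lebesgue \<and>
     (\<forall>K. compact K \<longrightarrow> set_integrable lebesgue K (\<lambda>x. (norm (f x))\<^sup>2))"

text \<open>\<open>g\<close> is the weak partial derivative of \<open>f\<close> in direction \<open>i\<close> in the open set \<open>U\<close>.\<close>

definition weak_pd :: "(real^2) set \<Rightarrow> 2 \<Rightarrow> (real^2 \<Rightarrow> complex) \<Rightarrow> (real^2 \<Rightarrow> complex) \<Rightarrow> bool" where
  "weak_pd U i f g \<longleftrightarrow> L1_loc U f \<and> L1_loc U g \<and>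
     (\<forall>\<phi>. test_function U \<phi> \<longrightarrow>
        (LINT x:U|lebesgue. f x * pd i \<phi> x) = - (LINT x:U|lebesgue. g x * \<phi> x))"

definition weak_lap :: "(real^2) set \<Rightarrow> (real^2 \<Rightarrow> complex) \<Rightarrow> (real^2 \<Rightarrow> complex) \<Rightarrow> bool" where
  "weak_lap U f w \<longleftrightarrow> L1_loc U f \<and> L1_loc U w \<and>
     (\<forall>\<phi>. test_function U \<phi> \<longrightarrow>
        (LINT x:U|lebesgue. f x * lap \<phi> x) = (LINT x:U|lebesgue. w x * \<phi> x))"

definition H2_loc :: "(real^2 \<Rightarrow> complex) \<Rightarrow> bool" where
  "H2_loc f \<longleftrightarrow> L2_loc f \<and>
     (\<exists>g h. (\<forall>i. L2_loc (g i) \<and> weak_pd UNIV i f (g i)) \<and>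
            (\<forall>i j. L2_loc (h i j) \<and> weak_pd UNIV j (g i) (h i j)))"

section \<open>Domains with \<open>C\<^sup>2\<close> boundary\<close>

definition C2_defining_function ::
  "(real^2) set \<Rightarrow> real^2 \<Rightarrow> real \<Rightarrow> (real^2 \<Rightarrow> real) \<Rightarrow> bool" where
  "C2_defining_function D x r \<rho> \<longleftrightarrow> r > 0 \<and> Ck_on 2 (ball x r) \<rho> \<and>
     D \<inter> ball x r = {y \<in> ball x r. \<rho> y < 0} \<and>
     (\<forall>y \<in> frontier D \<inter> ball x r. \<exists>i. pd i \<rho> y \<noteq> 0)"

definition C2_boundary :: "(real^2) set \<Rightarrow> bool" where
  "C2_boundary D \<longleftrightarrow> (\<forall>x \<in> frontier D. \<exists>r \<rho>. C2_defining_function D x r \<rho>)"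

text \<open>The quotient \<open>\<nabla>\<rho> / |\<nabla>\<rho>|\<close> does not depend on the local defining function, so the choice
  operator selects the outward unit normal.\<close>

definition outward_normal :: "(real^2) set \<Rightarrow> real^2 \<Rightarrow> real^2" where
  "outward_normal D x =
     (SOME v. \<exists>r \<rho>. C2_defining_function D x r \<rho> \<and>
        v = (let g = (\<chi> i. pd i \<rho> x) in g /\<^sub>R norm g))"

section \<open>Traces and jumps\<close>

text \<open>Null sets of the one-dimensional Hausdorff measure; on a \<open>C\<^sup>2\<close> curve these are the null sets
  of arc length.\<close>

definition H1_null :: "(real^2) set \<Rightarrow> bool" where
  "H1_null N \<longleftrightarrow> (\<forall>\<epsilon>>0. \<exists>A :: nat \<Rightarrow> (real^2) set.
     N \<subseteq> (\<Union>i. A i) \<and> (\<forall>i. bounded (A i)) \<and>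
     summable (\<lambda>i. diameter (A i)) \<and> (\<Sum>i. diameter (A i)) < \<epsilon>)"

text \<open>\<open>g\<close> is the value at the boundary point \<open>x\<close> of the trace of \<open>\<phi>\<close> taken from the open set \<open>S\<close>:
  the mean of \<open>|\<phi> - g|\<close> over \<open>B\<^sub>r(x) \<inter> S\<close> tends to 0. For Sobolev functions this holds with the
  usual trace at almost every boundary point. It depends on \<open>\<phi>\<close> only up to null sets.\<close>

definition has_trace_at ::
  "(real^2) set \<Rightarrow> (real^2 \<Rightarrow> complex) \<Rightarrow> real^2 \<Rightarrow> complex \<Rightarrow> bool" where
  "has_trace_at S \<phi> x g \<longleftrightarrow>
     (\<forall>\<^sub>F r in at_right 0. set_integrable lebesgue (ball x r \<inter> S) \<phi>) \<and>
     ((\<lambda>r. (LINT y:ball x r \<inter> S|lebesgue. norm (\<phi> y - g)) / measure lebesgue (ball x r \<inter> S))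
        \<longlongrightarrow> 0) (at_right 0)"

text \<open>The jump is the exterior trace minus the interior trace.\<close>

definition has_jump_at ::
  "(real^2) set \<Rightarrow> (real^2 \<Rightarrow> complex) \<Rightarrow> real^2 \<Rightarrow> complex \<Rightarrow> bool" where
  "has_jump_at D \<phi> x j \<longleftrightarrow>
     (\<exists>gp gm. has_trace_at (- closure D) \<phi> x gp \<and> has_trace_at D \<phi> x gm \<and> j = gp - gm)"

text \<open>\<open>[u] = [\<partial>\<^sub>\<nu>u] = [\<Delta>u] = [\<partial>\<^sub>\<nu>\<Delta>u] = 0\<close> a.e. on the boundary. The derivatives are weak
  derivatives in the two open sets \<open>D\<close> and \<open>- closure D\<close>, whose union is \<open>- frontier D\<close>: \<open>p\<close> is the
  gradient of \<open>u\<close>, \<open>w\<close> its Laplacian and \<open>q\<close> the gradient of \<open>w\<close>.\<close>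

definition no_jumps :: "(real^2) set \<Rightarrow> (real^2 \<Rightarrow> complex) \<Rightarrow> bool" where
  "no_jumps D u \<longleftrightarrow> (\<exists>p w q.
     (\<forall>i. weak_pd (- frontier D) i u (p i)) \<and>
     weak_lap (- frontier D) u w \<and>
     (\<forall>i. weak_pd (- frontier D) i w (q i)) \<and>
     (\<exists>N. H1_null N \<and> (\<forall>x \<in> frontier D - N.
        let \<nu> = outward_normal D x in
          has_jump_at D u x 0 \<and>
          has_jump_at D (\<lambda>y. \<Sum>i\<in>UNIV. of_real (\<nu> $ i) * p i y) x 0 \<and>
          has_jump_at D w x 0 \<and>
          has_jump_at D (\<lambda>y. \<Sum>i\<in>UNIV. of_real (\<nu> $ i) * q i y) x 0)))"

section \<open>The scattering problem\<close>

definition ess_support :: "(real^2 \<Rightarrow> complex) \<Rightarrow> (real^2) set" where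
  "ess_support f =
     {x. \<forall>U. open U \<and> x \<in> U \<longrightarrow> \<not> (AE y in lebesgue. y \<in> U \<longrightarrow> f y = 0)}"

text \<open>A support is closed, so \<open>supp (n - 1) = D\<close> is read as equality with the closure of \<open>D\<close>.\<close>

definition absorbing_index :: "(real^2) set \<Rightarrow> (real^2 \<Rightarrow> complex) \<Rightarrow> bool" where
  "absorbing_index D n \<longleftrightarrow>
     n \<in> borel_measurable lebesgue \<and>
     ess_support (\<lambda>x. n x - 1) = closure D \<and>
     (AE x in lebesgue. x \<notin> D \<longrightarrow> n x = 1) \<and>
     (\<exists>M. AE x in lebesgue. x \<in> D \<longrightarrow> norm (n x) \<le> M) \<and>
     (\<exists>c>0. AE x in lebesgue. x \<in> D \<longrightarrow> c \<le> Im (n x))"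

definition plane_wave :: "real \<Rightarrow> real^2 \<Rightarrow> real^2 \<Rightarrow> complex" where
  "plane_wave k d x = exp (\<i> * of_real (k * (x \<bullet> d)))"

definition sommerfeld :: "real \<Rightarrow> (real^2 \<Rightarrow> complex) \<Rightarrow> bool" where
  "sommerfeld k v \<longleftrightarrow>
     uniform_limit (sphere 0 1)
       (\<lambda>r xhat. of_real (sqrt r) *
          (dir_deriv xhat v (r *\<^sub>R xhat) - \<i> * of_real k * v (r *\<^sub>R xhat)))
       (\<lambda>_. 0) at_top"

text \<open>\<open>\<Delta>\<^sup>2u - k\<^sup>4 n u = - k\<^sup>4 (1 - n) u\<^sup>i\<close> in the sense of distributions on the whole plane.\<close>

definition biharmonic_eq ::
  "real \<Rightarrow> (real^2 \<Rightarrow> complex) \<Rightarrow> (real^2 \<Rightarrow> complex) \<Rightarrow> (real^2 \<Rightarrow> complex) \<Rightarrow> bool" where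
  "biharmonic_eq k n ui us \<longleftrightarrow> (\<forall>\<phi>. test_function UNIV \<phi> \<longrightarrow>
     (LINT x|lebesgue. us x * lap (lap \<phi>) x - of_real (k^4) * n x * us x * \<phi> x)
       = (LINT x|lebesgue. - of_real (k^4) * (1 - n x) * ui x * \<phi> x))"

text \<open>Elements of \<open>H\<^sup>2\<^sub>l\<^sub>o\<^sub>c\<close> are functions up to null sets. A solution of the equation is smooth outside
  \<open>closure D\<close> after modification on a null set, and the radiation condition is imposed on that
  smooth representative.\<close>

definition scattering_solution ::
  "real \<Rightarrow> (real^2) set \<Rightarrow> (real^2 \<Rightarrow> complex) \<Rightarrow> real^2 \<Rightarrow> (real^2 \<Rightarrow> complex) \<Rightarrow> bool" where
  "scattering_solution k D n d us \<longleftrightarrow>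
     H2_loc us \<and>
     biharmonic_eq k n (plane_wave k d) us \<and>
     no_jumps D (\<lambda>x. us x + plane_wave k d x) \<and>
     (\<exists>v. (AE x in lebesgue. x \<notin> closure D \<longrightarrow> v x = us x) \<and>
          smooth_on (- closure D) v \<and> sommerfeld k v \<and> sommerfeld k (lap v))"

section \<open>Far-field pattern\<close>

definition decomposition ::
  "real \<Rightarrow> (real^2) set \<Rightarrow> (real^2 \<Rightarrow> complex) \<Rightarrow> (real^2 \<Rightarrow> complex) \<Rightarrow> (real^2 \<Rightarrow> complex) \<Rightarrow> bool" where
  "decomposition k D us upr uev \<longleftrightarrow>
     (AE x in lebesgue. x \<notin> closure D \<longrightarrow> us x = upr x + uev x) \<and>
     Ck_on 2 (- closure D) upr \<and> Ck_on 2 (- closure D) uev \<and>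
     (\<forall>x \<in> - closure D. lap upr x + of_real (k\<^sup>2) * upr x = 0) \<and>
     (\<forall>x \<in> - closure D. lap uev x - of_real (k\<^sup>2) * uev x = 0) \<and>
     sommerfeld k upr \<and>
     (\<exists>C a R. a > 0 \<and> (\<forall>x. norm x \<ge> R \<longrightarrow> norm (uev x) \<le> C * exp (- a * norm x)))"

text \<open>Arc length integral over the circle of radius \<open>R\<close> around the origin.\<close>

definition circle_integral :: "real \<Rightarrow> (real^2 \<Rightarrow> complex) \<Rightarrow> complex" where
  "circle_integral R f = integral {0..2*pi} (\<lambda>t. of_real R * f (R *\<^sub>R vector [cos t, sin t]))"

definition far_field_integral ::
  "real \<Rightarrow> real \<Rightarrow> (real^2 \<Rightarrow> complex) \<Rightarrow> real^2 \<Rightarrow> complex" where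
  "far_field_integral k R upr xhat =
     circle_integral R (\<lambda>y. let \<nu> = y /\<^sub>R R; e = (\<lambda>z. exp (- \<i> * of_real (k * (xhat \<bullet> z)))) in
       upr y * dir_deriv \<nu> e y - dir_deriv \<nu> upr y * e y)"

text \<open>\<open>uinf\<close> is the far-field pattern of \<open>us\<close>, computed on any admissible circle.\<close>

definition far_field_pattern ::
  "real \<Rightarrow> (real^2) set \<Rightarrow> (real^2 \<Rightarrow> complex) \<Rightarrow> (real^2 \<Rightarrow> complex) \<Rightarrow> bool" where
  "far_field_pattern k D us uinf \<longleftrightarrow> (\<exists>upr uev R.
     decomposition k D us upr uev \<and> R > 0 \<and> closure D \<subseteq> ball 0 R \<and>
     (\<forall>xhat \<in> sphere 0 1. uinf xhat = far_field_integral k R upr xhat))"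

end

theory Submission
  imports Defs
begin

text \<open>The total fields \<open>u = u\<^sup>i + u\<^sup>s\<close> for the directions \<open>d\<close> and \<open>- xhat\<close> satisfy the same equation
  \<open>\<Delta>\<^sup>2 u = k\<^sup>4 n u\<close>, so testing one with a cutoff of the other and conversely leaves only commutator
  terms in an annulus around \<open>D\<close>. There \<open>u = a + b\<close> with \<open>\<Delta>a = - k\<^sup>2 a\<close>, \<open>\<Delta>b = k\<^sup>2 b\<close>, and these terms
  say that the circle Wronskians \<open>W(a\<^sub>1, a\<^sub>2)\<close> and \<open>W(b\<^sub>1, b\<^sub>2)\<close> agree. Both are independent of the radius;
  \<open>W(b\<^sub>1, b\<^sub>2)\<close> vanishes by decay. With \<open>a = u\<^sup>i + u\<^sub>p\<^sub>r\<close> the term \<open>W(u\<^sup>i, u\<^sup>i)\<close> (constant, and tending to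
  0 as the radius shrinks) and the term \<open>W(u\<^sub>p\<^sub>r, u\<^sub>p\<^sub>r)\<close> (by the radiation condition) vanish as well,
  and the two mixed terms that remain are the two far-field patterns. Since the equation holds weakly on the whole plane, the test function
  is a mollified cutoff of the other total field; this needs neither traces nor interior
  regularity, only \<open>L\<^sup>2\<^sub>l\<^sub>o\<^sub>c\<close>.\<close>

text \<open>Put \<open>\<kappa> = k ^ 2\<close>. On the annulus
  \<open>lap u = \<kappa> * (b - a)\<close>, and Green's second identity for the squared Laplacian
  pairs \<open>u1\<close> with \<open>lap u2\<close> and \<open>lap u1\<close> with
  \<open>u2\<close>. In the sum the mixed Wronskians of an \<open>a\<close> with a \<open>b\<close>
  cancel, which leaves \<open>2 * \<kappa>\<close> times \<open>W(b1, b2) - W(a1, a2)\<close>; so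
  the two families separate by algebra alone. Two of the vanishing Wronskians hide an obstacle. The
  exponential bound concerns the values of \<open>b\<close> only, so decay of its radial derivative
  is not at hand; a nonzero Wronskian is refuted by an energy that would have to grow. Likewise the
  Sommerfeld condition controls \<open>radial f - i k f\<close> and not \<open>f\<close> itself; it
  has to be combined with Rellich's flux identity, which bounds the mean square of \<open>f\<close>
  on large circles. Mollification is used in weak form: in the limit the same integral with
  \<open>N\<close> occurs on both sides and cancels, so convergence of pairings of square integrable
  functions is enough.\<close>

section \<open>Calculus of the classes \<open>C\<^sup>m\<close>\<close>

lemma has_derivative_axis_expand:
  fixes f :: "real^2 \<Rightarrow> 'b::real_normed_vector"
  assumes "(f has_derivative f') (at x)"
  shows "f' h = (\<Sum>i\<in>UNIV. h $ i *\<^sub>R f' (axis i 1))"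
proof -
  interpret linear f' using assms has_derivative_linear by blast
  have "f' h = f' (\<Sum>i\<in>UNIV. h $ i *\<^sub>R axis i 1)"
    by (simp only: basis_expansion[of h, unfolded scalar_mult_eq_scaleR])
  also have "\<dots> = (\<Sum>i\<in>UNIV. h $ i *\<^sub>R f' (axis i 1))"
    by (simp add: sum scale)
  finally show ?thesis .
qed

lemma pd_eqI: "(f has_derivative f') (at x) \<Longrightarrow> pd i f x = f' (axis i 1)"
  unfolding pd_def using frechet_derivative_at[of f f' x] by simp

lemma has_derivative_pd:
  assumes "f differentiable (at x)"
  shows "(f has_derivative (\<lambda>h. \<Sum>i\<in>UNIV. h $ i *\<^sub>R pd i f x)) (at x)"
proof -
  have *: "(f has_derivative frechet_derivative f (at x)) (at x)"
    using assms frechet_derivative_works by blast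
  then have "frechet_derivative f (at x) = (\<lambda>h. \<Sum>i\<in>UNIV. h $ i *\<^sub>R pd i f x)"
    unfolding pd_def using has_derivative_axis_expand[OF *] by blast
  with * show ?thesis by simp
qed

lemma dir_deriv_eq:
  assumes "f differentiable (at x)"
  shows "dir_deriv v f x = (\<Sum>i\<in>UNIV. v $ i *\<^sub>R pd i f x)"
  unfolding dir_deriv_def using frechet_derivative_at[OF has_derivative_pd[OF assms], symmetric]
  by (rule fun_cong)

lemma differentiable_cong_open:
  assumes "open S" "x \<in> S" "\<And>y. y \<in> S \<Longrightarrow> f y = g y" "f differentiable (at x)"
  shows "g differentiable (at x)"
  using has_derivative_transform_within_open[of f _ x UNIV S g] assms
  unfolding differentiable_def by blast

text \<open>Differentiability is not assumed: \<open>f\<close> and \<open>g\<close> have the same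
  Frechet derivatives at \<open>x\<close>, so the choice operator in
  \<open>frechet_derivative\<close> makes the same choice for both, default value included.\<close>

lemma pd_cong_open:
  fixes f g :: "real^2 \<Rightarrow> 'b::real_normed_vector"
  assumes "open S" "x \<in> S" "\<And>y. y \<in> S \<Longrightarrow> f y = g y"
  shows "pd i f x = pd i g x"
proof -
  have "(f has_derivative f') (at x) \<longleftrightarrow> (g has_derivative f') (at x)" for f'
    using has_derivative_transform_within_open[of f f' x UNIV S g]
      has_derivative_transform_within_open[of g f' x UNIV S f] assms by auto
  then show ?thesis unfolding pd_def frechet_derivative_def by simp
qed

lemma Ck_on_cong:
  fixes f g :: "real^2 \<Rightarrow> 'b::real_normed_vector"
  assumes "open S" "\<And>y. y \<in> S \<Longrightarrow> f y = g y" "Ck_on m S f"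
  shows "Ck_on m S g"
  using assms(2,3)
proof (induction m arbitrary: f g)
  case 0
  then show ?case by (auto cong: continuous_on_cong)
next
  case (Suc m)
  have "g differentiable (at x)" if "x \<in> S" for x
    using differentiable_cong_open[OF assms(1) that Suc.prems(1)] Suc.prems(2) that by auto
  moreover have "Ck_on m S (pd i g)" for i
    by (rule Suc.IH[of "pd i f"]) (use Suc.prems pd_cong_open[OF assms(1) _ Suc.prems(1)] in auto)
  ultimately show ?case by simp
qed

lemma lap_cong_open:
  fixes f g :: "real^2 \<Rightarrow> 'b::real_normed_vector"
  assumes "open S" "x \<in> S" "\<And>y. y \<in> S \<Longrightarrow> f y = g y"
  shows "lap f x = lap g x"
  unfolding lap_def
  by (intro sum.cong refl pd_cong_open[OF assms(1,2)] pd_cong_open[OF assms(1) _ assms(3)])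

lemma Ck_on_subset: "Ck_on m S f \<Longrightarrow> T \<subseteq> S \<Longrightarrow> Ck_on m T f"
  by (induction m arbitrary: f) (auto intro: continuous_on_subset)

lemma Ck_on_Suc_imp: "Ck_on (Suc m) S f \<Longrightarrow> Ck_on m S f"
proof (induction m arbitrary: f)
  case 0
  then show ?case
    by (simp add: continuous_at_imp_continuous_on differentiable_imp_continuous_within)
next
  case (Suc m)
  then show ?case by (metis Ck_on.simps(2))
qed

lemma Ck_on_mono: "Ck_on n S f \<Longrightarrow> m \<le> n \<Longrightarrow> Ck_on m S f"
  by (induction n) (use Ck_on_Suc_imp le_Suc_eq in blast)+

lemma Ck_on_imp_continuous_on: "Ck_on m S f \<Longrightarrow> continuous_on S f"
  using Ck_on_mono[of m S f 0] by simp

lemma pd_const [simp]: "pd i (\<lambda>x. c) = (\<lambda>x. 0)"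
  by (rule ext) (use pd_eqI[OF has_derivative_const] in auto)

lemma Ck_on_const: "Ck_on m S (\<lambda>x. c)"
  by (induction m arbitrary: c) auto

lemma pd_add:
  assumes "f differentiable (at x)" "g differentiable (at x)"
  shows "pd i (\<lambda>x. f x + g x) x = pd i f x + pd i g x"
  using pd_eqI[OF has_derivative_add[OF assms[THEN has_derivative_pd]]]
    pd_eqI[OF assms(1)[THEN has_derivative_pd]] pd_eqI[OF assms(2)[THEN has_derivative_pd]]
  by metis

lemma pd_minus:
  assumes "f differentiable (at x)"
  shows "pd i (\<lambda>x. - f x) x = - pd i f x"
  using pd_eqI[OF has_derivative_minus[OF assms[THEN has_derivative_pd]]]
    pd_eqI[OF assms(1)[THEN has_derivative_pd]] 
  by metis

lemma pd_mult:
  fixes f g :: "real^2 \<Rightarrow> 'b::real_normed_algebra"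
  assumes "f differentiable (at x)" "g differentiable (at x)"
  shows "pd i (\<lambda>x. f x * g x) x = f x * pd i g x + pd i f x * g x"
  using pd_eqI[OF has_derivative_mult[OF assms[THEN has_derivative_pd]], of i]
    pd_eqI[OF assms(1)[THEN has_derivative_pd], of i] pd_eqI[OF assms(2)[THEN has_derivative_pd], of i]
  by metis

lemma pd_cmult:
  fixes f :: "real^2 \<Rightarrow> 'b::real_normed_algebra"
  assumes "f differentiable (at x)"
  shows "pd i (\<lambda>x. c * f x) x = c * pd i f x"
  using pd_mult[OF differentiable_const assms, of i c] by simp

lemma Ck_on_add:
  fixes f g :: "real^2 \<Rightarrow> 'b::real_normed_vector"
  assumes "open S" "Ck_on m S f" "Ck_on m S g"
  shows "Ck_on m S (\<lambda>x. f x + g x)"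
  using assms(2,3)
proof (induction m arbitrary: f g)
  case 0
  then show ?case by (simp add: continuous_on_add)
next
  case (Suc m)
  have "Ck_on m S (pd i (\<lambda>x. f x + g x))" for i
    by (rule Ck_on_cong[OF assms(1) _ Suc.IH[of "pd i f" "pd i g"]])
       (use Suc.prems in \<open>auto simp: pd_add\<close>)
  then show ?case using Suc.prems by (auto intro: differentiable_add)
qed

lemma Ck_on_mult:
  fixes f g :: "real^2 \<Rightarrow> 'b::real_normed_algebra"
  assumes "open S" "Ck_on m S f" "Ck_on m S g"
  shows "Ck_on m S (\<lambda>x. f x * g x)"
  using assms(2,3)
proof (induction m arbitrary: f g)
  case 0
  then show ?case by (simp add: continuous_on_mult)
next
  case (Suc m)
  have "Ck_on m S (pd i (\<lambda>x. f x * g x))" for i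
  proof (rule Ck_on_cong[OF assms(1)])
    show "Ck_on m S (\<lambda>x. f x * pd i g x + pd i f x * g x)"
      using Suc.prems Ck_on_Suc_imp[OF Suc.prems(1)] Ck_on_Suc_imp[OF Suc.prems(2)]
      by (intro Ck_on_add[OF assms(1)] Suc.IH) auto
  qed (use Suc.prems in \<open>auto simp: pd_mult\<close>)
  then show ?case using Suc.prems by (auto intro: differentiable_mult)
qed

lemma Ck_on_cmult:
  fixes f :: "real^2 \<Rightarrow> 'b::real_normed_algebra"
  assumes "open S" "Ck_on m S f"
  shows "Ck_on m S (\<lambda>x. c * f x)"
  using Ck_on_mult[OF assms(1) Ck_on_const assms(2)] .

lemma Ck_on_diff:
  fixes f g :: "real^2 \<Rightarrow> 'b::real_normed_algebra_1"
  assumes "open S" "Ck_on m S f" "Ck_on m S g"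
  shows "Ck_on m S (\<lambda>x. f x - g x)"
  using Ck_on_add[OF assms(1,2) Ck_on_cmult[OF assms(1,3), of "-1"]] by simp

lemma Ck_on_sum:
  fixes f :: "'a \<Rightarrow> real^2 \<Rightarrow> 'b::real_normed_vector"
  assumes "open S" "finite I" "\<And>i. i \<in> I \<Longrightarrow> Ck_on m S (f i)"
  shows "Ck_on m S (\<lambda>x. \<Sum>i\<in>I. f i x)"
  using assms(2,3)
  by (induction I) (auto simp: Ck_on_const intro!: Ck_on_add[OF assms(1)])

lemma Ck_on_lap: "open S \<Longrightarrow> Ck_on (Suc (Suc m)) S f \<Longrightarrow> Ck_on m S (lap f)"
  unfolding lap_def[abs_def] by (rule Ck_on_sum) auto

lemma Ck_on_Un:
  assumes "open S" "open T" "Ck_on m S f" "Ck_on m T f"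
  shows "Ck_on m (S \<union> T) f"
  using assms(3,4)
  by (induction m arbitrary: f) (auto intro: continuous_on_open_Un[OF assms(1,2)])

lemma pd_zero_open: "open S \<Longrightarrow> x \<in> S \<Longrightarrow> (\<And>y. y \<in> S \<Longrightarrow> f y = 0) \<Longrightarrow> pd i f x = 0"
  using pd_cong_open[of S x f "\<lambda>_. 0"] by simp

lemma lap_zero_open: "open S \<Longrightarrow> x \<in> S \<Longrightarrow> (\<And>y. y \<in> S \<Longrightarrow> f y = 0) \<Longrightarrow> lap f x = 0"
  unfolding lap_def using pd_zero_open[of S x "pd _ f"] pd_zero_open[of S _ f] by simp

text \<open>Used for products with a test function: on the open set \<open>- K\<close> the function
  vanishes, and \<open>S\<close> and \<open>- K\<close> cover the plane.\<close>

lemma Ck_on_zero_extension: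
  assumes "open S" "closed K" "K \<subseteq> S" "Ck_on m S f" "\<And>x. x \<notin> K \<Longrightarrow> f x = 0"
  shows "Ck_on m UNIV f"
proof -
  have "Ck_on m (- K) f"
    by (rule Ck_on_cong[OF _ _ Ck_on_const[of m "-K" 0]]) (use assms in auto)
  then have "Ck_on m (S \<union> - K) f"
    using Ck_on_Un[OF assms(1) _ assms(4)] assms(2) by blast
  moreover have "S \<union> - K = UNIV" using assms(3) by auto
  ultimately show ?thesis by simp
qed

lemma smooth_on_mult:
  fixes f g :: "real^2 \<Rightarrow> 'b::real_normed_algebra"
  shows "open S \<Longrightarrow> smooth_on S f \<Longrightarrow> smooth_on S g \<Longrightarrow> smooth_on S (\<lambda>x. f x * g x)"
  unfolding smooth_on_def using Ck_on_mult by blast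

lemma smooth_on_const: "smooth_on S (\<lambda>x. c)"
  unfolding smooth_on_def using Ck_on_const by blast

lemma smooth_on_diff:
  fixes f g :: "real^2 \<Rightarrow> 'b::real_normed_algebra_1"
  shows "open S \<Longrightarrow> smooth_on S f \<Longrightarrow> smooth_on S g \<Longrightarrow> smooth_on S (\<lambda>x. f x - g x)"
  unfolding smooth_on_def using Ck_on_diff by blast

lemma smooth_on_lap: "open S \<Longrightarrow> smooth_on S f \<Longrightarrow> smooth_on S (lap f)"
  unfolding smooth_on_def using Ck_on_lap by blast

lemma pd_linear:
  fixes L :: "'b::real_normed_vector \<Rightarrow> 'c::real_normed_vector"
  assumes "bounded_linear L" "f differentiable (at x)"
  shows "pd i (\<lambda>x. L (f x)) x = L (pd i f x)"
  using pd_eqI[OF bounded_linear.has_derivative[OF assms(1) has_derivative_pd[OF assms(2)]], of i]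
    pd_eqI[OF has_derivative_pd[OF assms(2)], of i] by metis

text \<open>Treats several maps at once: negation, the embedding of the reals, complex conjugation
  and the inner product with a fixed vector.\<close>

lemma Ck_on_linear:
  fixes L :: "'b::real_normed_vector \<Rightarrow> 'c::real_normed_vector"
  assumes L: "bounded_linear L" and S: "open S" and f: "Ck_on m S f"
  shows "Ck_on m S (\<lambda>x. L (f x))"
  using f
proof (induction m arbitrary: f)
  case 0
  then show ?case using L by (simp add: bounded_linear.continuous_on)
next
  case (Suc m)
  have "Ck_on m S (pd i (\<lambda>x. L (f x)))" for i
    by (rule Ck_on_cong[OF S _ Suc.IH[of "pd i f"]]) (use Suc.prems in \<open>auto simp: pd_linear[OF L]\<close>)
  moreover have "(\<lambda>x. L (f x)) differentiable (at x)" if "x \<in> S" for x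
  proof -
    have "f differentiable (at x)" using Suc.prems that by auto
    from bounded_linear.has_derivative[OF L has_derivative_pd[OF this]] show ?thesis
      by (rule differentiableI)
  qed
  ultimately show ?case by simp
qed

text \<open>A convolution at \<open>x\<close> is an integral against
  \<open>\<lambda>y. \<eta> (x - y)\<close>. This kernel will be inserted as a test function, so its
  derivatives in \<open>y\<close> have to be known; for the Laplacian the two signs cancel.\<close>

lemma pd_reflect:
  fixes f :: "real^2 \<Rightarrow> 'b::real_normed_vector"
  assumes "f differentiable (at (x - y))"
  shows "pd i (\<lambda>y. f (x - y)) y = - pd i f (x - y)"
    and "(\<lambda>y. f (x - y)) differentiable (at y)"
proof -
  have 1: "((\<lambda>y. x - y) has_derivative (\<lambda>h. - h)) (at y)"
    by (auto intro!: derivative_eq_intros)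
  have 2: "((\<lambda>y. f (x - y)) has_derivative (\<lambda>h. \<Sum>i\<in>UNIV. (- h) $ i *\<^sub>R pd i f (x - y))) (at y)"
    using has_derivative_compose[OF 1 has_derivative_pd[OF assms]] by simp
  then show "(\<lambda>y. f (x - y)) differentiable (at y)" unfolding differentiable_def by blast
  show "pd i (\<lambda>y. f (x - y)) y = - pd i f (x - y)"
    unfolding pd_eqI[OF 2] by (subst (2) pd_eqI[OF has_derivative_pd[OF assms]]) (simp add: sum_negf)
qed

lemma Ck_on_reflect:
  fixes f :: "real^2 \<Rightarrow> 'b::real_normed_vector"
  assumes "Ck_on m UNIV f"
  shows "Ck_on m UNIV (\<lambda>y. f (x - y))"
  using assms
proof (induction m arbitrary: f)
  case 0
  then show ?case by (auto intro!: continuous_intros continuous_on_compose2[of UNIV f])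
next
  case (Suc m)
  have "Ck_on m UNIV (pd i (\<lambda>y. f (x - y)))" for i
  proof (rule Ck_on_cong[OF open_UNIV])
    show "Ck_on m UNIV (\<lambda>y. - pd i f (x - y))"
      by (rule Ck_on_linear[OF bounded_linear_minus[OF bounded_linear_ident] open_UNIV Suc.IH])
         (use Suc.prems in auto)
  qed (use pd_reflect(1)[of f x _ i] Suc.prems in auto)
  then show ?case using pd_reflect(2)[of f x] Suc.prems by simp
qed

lemma lap_reflect:
  fixes f :: "real^2 \<Rightarrow> 'b::real_normed_vector"
  assumes "Ck_on 2 UNIV f"
  shows "lap (\<lambda>y. f (x - y)) y = lap f (x - y)"
proof -
  have f: "f differentiable (at z)" "pd i f differentiable (at z)" for z i
    using assms by (auto simp: numeral_2_eq_2)
  have 1: "pd i (\<lambda>y. f (x - y)) = (\<lambda>y. - pd i f (x - y))" for i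
    using pd_reflect(1)[OF f(1)] by blast
  have "pd i (\<lambda>y. - pd i f (x - y)) y = pd i (pd i f) (x - y)" for i
    using pd_minus[OF pd_reflect(2)[OF f(2)]] pd_reflect(1)[OF f(2)] by simp
  then show ?thesis unfolding lap_def 1 by simp
qed

lemma lap_add:
  assumes "open S" "x \<in> S" "Ck_on 2 S f" "Ck_on 2 S g"
  shows "lap (\<lambda>x. f x + g x) x = lap f x + lap g x"
proof -
  have 1: "\<And>y i. y \<in> S \<Longrightarrow> pd i (\<lambda>x. f x + g x) y = pd i f y + pd i g y"
    using assms by (intro pd_add) (auto simp: numeral_2_eq_2)
  have "pd i (pd i (\<lambda>x. f x + g x)) x = pd i (\<lambda>y. pd i f y + pd i g y) x" for i
    by (rule pd_cong_open[OF assms(1,2) 1])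
  also have "pd i (\<lambda>y. pd i f y + pd i g y) x = pd i (pd i f) x + pd i (pd i g) x" for i
    using assms by (intro pd_add) (auto simp: numeral_2_eq_2)
  finally have "pd i (pd i (\<lambda>x. f x + g x)) x = pd i (pd i f) x + pd i (pd i g) x" for i .
  then show ?thesis unfolding lap_def by (simp add: sum.distrib)
qed

lemma lap_linear:
  assumes L: "bounded_linear L" and S: "open S" "x \<in> S" and f: "Ck_on 2 S f"
  shows "lap (\<lambda>x. L (f x)) x = L (lap f x)"
proof -
  have 1: "\<And>y i. y \<in> S \<Longrightarrow> pd i (\<lambda>x. L (f x)) y = L (pd i f y)"
    using assms by (intro pd_linear[OF L]) (auto simp: numeral_2_eq_2)
  have "pd i (pd i (\<lambda>x. L (f x))) x = pd i (\<lambda>y. L (pd i f y)) x" for i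
    by (rule pd_cong_open[OF S 1])
  also have "pd i (\<lambda>y. L (pd i f y)) x = L (pd i (pd i f) x)" for i
    using assms by (intro pd_linear[OF L]) (auto simp: numeral_2_eq_2)
  finally have "pd i (pd i (\<lambda>x. L (f x))) x = L (pd i (pd i f) x)" for i .
  then show ?thesis unfolding lap_def
    by (simp add: linear_sum[OF bounded_linear.linear[OF L]])
qed

section \<open>Smooth bumps and cutoffs\<close>

text \<open>The powers of \<open>1 / s\<close> make this family closed under differentiation.\<close>

definition flat :: "nat \<Rightarrow> real \<Rightarrow> real" where
  "flat j s = (if s > 0 then exp (- 1 / s) / s ^ j else 0)"

text \<open>With \<open>u = 1 / s\<close> the quotient on the right of 0 is
  \<open>u ^ (j + 1) / exp u\<close>. As \<open>flat j 0 = 0\<close>, it is the difference quotient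
  at 0, so every member of the family has derivative 0 there.\<close>

lemma flat_over_tendsto_0: "((\<lambda>s. flat j s / s) \<longlongrightarrow> 0) (at 0)"
proof -
  have *: "((\<lambda>u::real. u ^ Suc j / exp u) \<longlongrightarrow> 0) at_top"
    by (rule tendsto_power_div_exp_0)
  have "((\<lambda>s. (inverse s) ^ Suc j / exp (inverse s)) \<longlongrightarrow> 0) (at_right (0::real))"
    by (rule filterlim_compose[OF * filterlim_inverse_at_top_right])
  moreover have "\<forall>\<^sub>F s in at_right (0::real). (inverse s) ^ Suc j / exp (inverse s) = flat j s / s"
    by (rule eventually_at_right_less[THEN eventually_mono])
       (auto simp: flat_def exp_minus field_simps)
  ultimately have R: "((\<lambda>s. flat j s / s) \<longlongrightarrow> 0) (at_right 0)"
    by (rule Lim_transform_eventually)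
  have "\<forall>\<^sub>F s in at_left (0::real). 0 = flat j s / s"
    by (auto simp: eventually_at flat_def intro!: exI[of _ 1])
  then have L: "((\<lambda>s. flat j s / s) \<longlongrightarrow> 0) (at_left 0)"
    by (rule Lim_transform_eventually[OF tendsto_const])
  show ?thesis using L R by (simp add: filterlim_at_split)
qed

lemma flat_has_derivative:
  "(flat j has_real_derivative (flat (j + 2) s - real j * flat (j + 1) s)) (at s)"
proof (cases s "0::real" rule: linorder_cases)
  case greater
  have "((\<lambda>s. exp (- 1 / s) / s ^ j) has_real_derivative (flat (j + 2) s - real j * flat (j + 1) s)) (at s)"
    using greater
    apply (auto intro!: derivative_eq_intros simp: flat_def)
    apply (cases j; simp add: field_simps power2_eq_square)
    done
  then show ?thesis
    by (rule has_field_derivative_transform_within_open[OF _ open_greaterThan[of 0]])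
       (use greater in \<open>auto simp: flat_def\<close>)
next
  case less
  have "((\<lambda>s. 0) has_real_derivative (flat (j + 2) s - real j * flat (j + 1) s)) (at s)"
    using less by (auto simp: flat_def)
  then show ?thesis
    by (rule has_field_derivative_transform_within_open[OF _ open_lessThan[of 0]])
       (use less in \<open>auto simp: flat_def\<close>)
next
  case equal
  show ?thesis
    using flat_over_tendsto_0[of j] unfolding equal has_field_derivative_iff
    by (simp add: flat_def[of _ 0])
qed

text \<open>The chain rule as an induction step. Regularity of the composition with
  \<open>g'\<close> is a premise, since for \<open>flat\<close> it is supplied by other members of
  the family.\<close>

lemma Ck_on_comp_real:
  fixes g g' :: "real \<Rightarrow> real" and q :: "real^2 \<Rightarrow> real"
  assumes "\<And>s. (g has_real_derivative g' s) (at s)"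
    and "Ck_on (Suc m) UNIV q"
    and "Ck_on m UNIV (\<lambda>x. g' (q x))"
  shows "Ck_on (Suc m) UNIV (\<lambda>x. g (q x))"
proof -
  have q: "q differentiable (at x)" for x using assms(2) by auto
  have d: "((\<lambda>x. g (q x)) has_derivative (\<lambda>h. g' (q x) * (\<Sum>i\<in>UNIV. h $ i *\<^sub>R pd i q x))) (at x)" for x
    using has_derivative_compose[OF has_derivative_pd[OF q]] assms(1)
    unfolding has_field_derivative_def by blast
  have "pd i (\<lambda>x. g (q x)) = (\<lambda>x. g' (q x) * pd i q x)" for i
  proof
    fix x
    show "pd i (\<lambda>x. g (q x)) x = g' (q x) * pd i q x"
      using pd_eqI[OF d] pd_eqI[OF has_derivative_pd[OF q]] by metis
  qed
  moreover have "Ck_on m UNIV (\<lambda>x. g' (q x) * pd i q x)" for i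
    using assms by (intro Ck_on_mult) auto
  moreover have "(\<lambda>x. g (q x)) differentiable (at x)" for x
    using d unfolding differentiable_def by blast
  ultimately show ?thesis by simp
qed

text \<open>The induction runs over all \<open>j\<close> at once, because differentiating
  \<open>flat j\<close> raises the index.\<close>

lemma Ck_on_flat_comp:
  assumes "\<And>m. Ck_on m UNIV q"
  shows "Ck_on m UNIV (\<lambda>x. flat j (q x))"
proof (induction m arbitrary: j)
  case 0
  have "continuous_on UNIV (flat j)"
    using flat_has_derivative by (meson DERIV_isCont continuous_at_imp_continuous_on)
  then show ?case
    using assms[of 0] by (auto intro: continuous_on_compose2[of UNIV "flat j"])
next
  case (Suc m)
  show ?case
    by (rule Ck_on_comp_real[OF flat_has_derivative assms])
       (intro Ck_on_diff Ck_on_cmult Suc open_UNIV)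
qed

lemma Ck_on_inner_self: "Ck_on m UNIV (\<lambda>x::real^2. x \<bullet> x)"
proof -
  have lin: "Ck_on m UNIV (\<lambda>x::real^2. c *\<^sub>R x)" for m and c :: real
  proof (cases m)
    case (Suc k)
    have d: "((\<lambda>x::real^2. c *\<^sub>R x) has_derivative (\<lambda>h. c *\<^sub>R h)) (at x)" for x
      by (auto intro!: derivative_eq_intros)
    have "pd i (\<lambda>x::real^2. c *\<^sub>R x) = (\<lambda>x. c *\<^sub>R axis i 1)" for i
      using pd_eqI[OF d] by blast
    then show ?thesis using d Suc by (auto simp: Ck_on_const differentiable_def)
  qed (auto intro!: continuous_intros)
  have d: "((\<lambda>x::real^2. x \<bullet> x) has_derivative (\<lambda>h. 2 * (x \<bullet> h))) (at x)" for x
    by (auto intro!: derivative_eq_intros simp: inner_commute)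
  have "pd i (\<lambda>x::real^2. x \<bullet> x) = (\<lambda>x. 2 * (x \<bullet> axis i 1))" for i
    using pd_eqI[OF d] by blast
  moreover have "Ck_on m UNIV (\<lambda>x::real^2. 2 * (x \<bullet> axis i 1))" for m i
    using Ck_on_linear[OF bounded_linear_inner_left open_UNIV lin[of m 2]] by simp
  ultimately have "Ck_on (Suc m) UNIV (\<lambda>x::real^2. x \<bullet> x)" for m
    using d by (simp add: differentiableI)
  then show ?thesis using Ck_on_Suc_imp by blast
qed

lemma smooth_on_of_real:
  "(\<And>m. Ck_on m UNIV f) \<Longrightarrow> smooth_on UNIV (\<lambda>x. complex_of_real (f x))"
  unfolding smooth_on_def using Ck_on_linear[OF bounded_linear_of_real open_UNIV] by blast

lemma smooth_bump:
  assumes "e > 0"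
  obtains b :: "real^2 \<Rightarrow> real" where "smooth_on UNIV (\<lambda>x. complex_of_real (b x))"
    "\<And>x. b x \<ge> 0" "\<And>x. norm x < e \<Longrightarrow> b x > 0" "\<And>x. norm x \<ge> e \<Longrightarrow> b x = 0" "\<And>x. b (- x) = b x"
    "continuous_on UNIV b"
proof
  let ?b = "\<lambda>x::real^2. flat 0 (e\<^sup>2 - x \<bullet> x)"
  have C: "Ck_on m UNIV ?b" for m
    by (intro Ck_on_flat_comp Ck_on_diff Ck_on_const Ck_on_inner_self open_UNIV)
  show "smooth_on UNIV (\<lambda>x. complex_of_real (?b x))" by (rule smooth_on_of_real[OF C])
  show "continuous_on UNIV ?b" using C Ck_on_imp_continuous_on by blast
  show "?b x \<ge> 0" for x by (auto simp: flat_def)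
  have 1: "x \<bullet> x < e\<^sup>2 \<longleftrightarrow> norm x < e" for x :: "real^2"
    using power_strict_mono[of "norm x" e 2] power_less_imp_less_base[of "norm x" 2 e] assms
    unfolding dot_square_norm by auto
  show "norm x < e \<Longrightarrow> ?b x > 0" for x using 1[of x] by (auto simp: flat_def)
  show "norm x \<ge> e \<Longrightarrow> ?b x = 0" for x using 1[of x] by (auto simp: flat_def)
  show "?b (- x) = ?b x" for x by simp
qed

text \<open>In the variable \<open>x \<bullet> x\<close> the cutoff is one minus the normalised
  primitive of a bump on the interval from \<open>r1 ^ 2\<close> to \<open>r2 ^ 2\<close>.\<close>

lemma smooth_cutoff:
  assumes "0 < r1" "r1 < r2"
  shows "\<exists>w :: real^2 \<Rightarrow> complex. smooth_on UNIV w \<and>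
    (\<forall>x. norm x \<le> r1 \<longrightarrow> w x = 1) \<and> (\<forall>x. norm x \<ge> r2 \<longrightarrow> w x = 0)"
proof -
  \<comment> \<open>Squares, because \<open>x \<bullet> x\<close> is smooth at the origin and the
    norm is not.\<close>
  define A B where "A = r1\<^sup>2" and "B = r2\<^sup>2"
  have AB: "0 < A" "A < B" using assms by (auto simp: A_def B_def power_strict_mono)
  define f where "f = (\<lambda>s. flat 0 ((s - A) * (B - s)))"
  have fc: "continuous_on UNIV f"
  proof -
    have "continuous_on UNIV (flat 0)"
      using flat_has_derivative by (meson DERIV_isCont continuous_at_imp_continuous_on)
    then show ?thesis unfolding f_def
      by (rule continuous_on_compose2) (auto intro!: continuous_intros)
  qed
  have f0: "f s = 0" if "s \<le> A \<or> s \<ge> B" for s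
    using that AB by (auto simp: f_def flat_def zero_less_mult_iff)
  have fpos: "f s > 0" if "A < s" "s < B" for s
    using that by (auto simp: f_def flat_def)
  define F where "F = (\<lambda>s. integral {0..s} f)"
  have Fd0: "(F has_real_derivative f s) (at s)" if "s > 0" for s
  proof -
    have "(F has_real_derivative f s) (at s within {0..s+1})"
      unfolding F_def by (rule integral_has_real_derivative)
        (use that in \<open>auto intro: continuous_on_subset[OF fc]\<close>)
    then show ?thesis using that
      by (metis DERIV_subset atLeastAtMost_iff at_within_interior interior_atLeastAtMost_real greaterThanLessThan_iff less_add_one)
  qed
  \<comment> \<open>For \<open>s < 0\<close> the interval \<open>{0..s}\<close> is empty, and
    between 0 and \<open>A\<close> the bump has not started; hence the primitive may be taken from
    0.\<close>
  have Fneg: "F s = 0" if "s \<le> A" for s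
  proof -
    have "F s = integral {0..s} (\<lambda>_. 0)"
      unfolding F_def by (rule integral_cong) (use that f0 in auto)
    then show ?thesis by simp
  qed
  have Fd: "(F has_real_derivative f s) (at s)" for s
  proof (cases "s > 0")
    case False
    have "((\<lambda>_. 0) has_real_derivative f s) (at s)"
      using f0[of s] AB False by auto
    then show ?thesis
      by (rule has_field_derivative_transform_within_open[OF _ open_lessThan[of A]])
         (use False AB Fneg in auto)
  qed (rule Fd0)
  have Fconst: "F s = F B" if "s \<ge> B" for s
  proof (cases "s = B")
    case False
    then have "B < s" using that by simp
    then obtain z where "B < z" "F s - F B = (s - B) * f z"
      using MVT2[of B s F f, OF _ Fd] by blast
    then show ?thesis using f0[of z] by simp
  qed simp
  have Fpos: "F B > 0"
  proof -
    obtain z where z: "A < z" "z < B" "F B - F A = (B - A) * f z"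
      using MVT2[of A B F f] AB Fd by blast
    moreover have "(B - A) * f z > 0" using fpos[OF z(1,2)] AB by auto
    ultimately show ?thesis using Fneg[of A] by linarith
  qed
  define g where "g = (\<lambda>s. 1 - F s / F B)"
  have gd: "(g has_real_derivative - f s / F B) (at s)" for s
    unfolding g_def using Fpos by (auto intro!: derivative_eq_intros Fd)
  have fC: "Ck_on m UNIV (\<lambda>x::real^2. f (x \<bullet> x))" for m
    unfolding f_def
    by (intro Ck_on_flat_comp Ck_on_diff Ck_on_const Ck_on_mult Ck_on_inner_self open_UNIV)
  have "Ck_on (Suc m) UNIV (\<lambda>x::real^2. g (x \<bullet> x))" for m
  proof (rule Ck_on_comp_real[OF gd Ck_on_inner_self])
    show "Ck_on m UNIV (\<lambda>x::real^2. - f (x \<bullet> x) / F B)"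
      using Ck_on_cmult[OF open_UNIV fC, of m "- 1 / F B"] by simp
  qed
  then have C: "Ck_on m UNIV (\<lambda>x::real^2. g (x \<bullet> x))" for m using Ck_on_Suc_imp by blast
  show ?thesis
  proof (intro exI conjI allI impI)
    show "smooth_on UNIV (\<lambda>x. complex_of_real (g (x \<bullet> x)))" by (rule smooth_on_of_real[OF C])
    fix x :: "real^2"
    show "complex_of_real (g (x \<bullet> x)) = 1" if "norm x \<le> r1"
    proof -
      have "x \<bullet> x \<le> A" unfolding A_def dot_square_norm by (rule power_mono[OF that norm_ge_zero])
      then show ?thesis using Fneg[of "x \<bullet> x"] unfolding g_def by simp
    qed
    show "complex_of_real (g (x \<bullet> x)) = 0" if "norm x \<ge> r2"
    proof -
      have "x \<bullet> x \<ge> B" unfolding B_def dot_square_norm by (rule power_mono[OF that]) (use assms in auto)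
      then show ?thesis using Fconst[of "x \<bullet> x"] Fpos unfolding g_def by simp
    qed
  qed
qed

section \<open>Integration by parts and convolution\<close>

text \<open>The two values of \<open>c\<close> cover translations and reflections; the Jacobian
  factor is 1 for both.\<close>

lemma lborel_distr_affine_unit:
  fixes t :: "'a::euclidean_space"
  assumes "c = 1 \<or> c = - 1"
  shows "distr lborel borel (\<lambda>x. t + c *\<^sub>R x) = lborel"
proof -
  have "lborel = density (distr lborel borel (\<lambda>x. t + c *\<^sub>R x)) (\<lambda>_. \<bar>c\<bar> ^ DIM('a))"
    using assms by (intro lborel_affine) auto
  also have "\<dots> = distr lborel borel (\<lambda>x. t + c *\<^sub>R x)"
    using assms by (auto simp: density_1)
  finally show ?thesis by simp
qed

lemma lborel_integrable_affine:
  fixes f :: "'a::euclidean_space \<Rightarrow> 'b::{banach, second_countable_topology}"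
  assumes "f \<in> borel_measurable borel" "c = 1 \<or> c = - 1"
  shows "integrable lborel (\<lambda>x. f (t + c *\<^sub>R x)) \<longleftrightarrow> integrable lborel f"
  using integrable_distr_eq[of "\<lambda>x. t + c *\<^sub>R x" lborel borel f] assms
  unfolding lborel_distr_affine_unit[OF assms(2)] by simp

lemma lborel_integral_affine:
  fixes f :: "'a::euclidean_space \<Rightarrow> 'b::{banach, second_countable_topology}"
  assumes "f \<in> borel_measurable borel" "c = 1 \<or> c = - 1"
  shows "(LINT x|lborel. f (t + c *\<^sub>R x)) = (LINT x|lborel. f x)"
  using integral_distr[of "\<lambda>x. t + c *\<^sub>R x" lborel borel f] assms
  unfolding lborel_distr_affine_unit[OF assms(2)] by simp

lemma lborel_integral_reflect:
  fixes f :: "'a::euclidean_space \<Rightarrow> 'b::{banach, second_countable_topology}"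
  assumes "f \<in> borel_measurable borel"
  shows "(LINT x|lborel. f (t - x)) = (LINT x|lborel. f x)"
  using lborel_integral_affine[OF assms, of "-1" t] by simp

lemma integrable_continuous_compact:
  fixes f :: "'a::euclidean_space \<Rightarrow> 'b::{banach, second_countable_topology}"
  assumes "compact K" "continuous_on K f" "\<And>x. x \<notin> K \<Longrightarrow> f x = 0"
  shows "integrable lborel f"
proof -
  have "(\<lambda>x. indicator K x *\<^sub>R f x) = f"
    using assms(3) by (auto simp: indicator_def fun_eq_iff)
  then show ?thesis using borel_integrable_compact[OF assms(1,2)] by simp
qed

lemma bounded_continuous_compact:
  fixes f :: "'a::topological_space \<Rightarrow> 'b::real_normed_vector"
  assumes "compact K" "continuous_on K f" "\<And>x. x \<notin> K \<Longrightarrow> f x = 0"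
  obtains M where "M > 0" "\<And>x. norm (f x) \<le> M"
proof -
  have "bounded (f ` K)"
    using assms by (simp add: compact_continuous_image compact_imp_bounded)
  then obtain M where "\<And>x. x \<in> K \<Longrightarrow> norm (f x) \<le> M" "M > 0"
    by (auto simp: bounded_pos)
  then show thesis using assms(3) that by (metis less_eq_real_def norm_zero)
qed

lemma pd_support:
  assumes "closed K" "\<And>x. x \<notin> K \<Longrightarrow> f x = 0" "x \<notin> K"
  shows "pd i f x = 0"
  using pd_zero_open[of "- K" x f] assms by auto

lemma lap_support:
  assumes "closed K" "\<And>x. x \<notin> K \<Longrightarrow> f x = 0" "x \<notin> K"
  shows "lap f x = 0"
  using lap_zero_open[of "- K" x f] assms by auto

lemma norm_sum_axis_le:
  fixes h :: "real^2" and p :: "2 \<Rightarrow> 'b::real_normed_vector"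
  assumes "\<And>i. norm (p i) \<le> M"
  shows "norm (\<Sum>i\<in>UNIV. h $ i *\<^sub>R p i) \<le> 2 * M * norm h"
proof -
  have "norm (\<Sum>i\<in>UNIV. h $ i *\<^sub>R p i) \<le> (\<Sum>i\<in>(UNIV::2 set). norm h * M)"
    by (intro sum_norm_le) (auto intro!: mult_mono assms component_le_norm_cart)
  then show ?thesis by (simp add: algebra_simps)
qed

text \<open>The mean value inequality. The constant bounds all difference quotients at once and so
  supplies the dominating function in \<open>integral_pd_eq_0\<close>.\<close>

lemma C1_compact_support_Lipschitz:
  fixes F :: "real^2 \<Rightarrow> 'b::real_normed_vector"
  assumes F: "Ck_on 1 UNIV F" and K: "compact K" "\<And>x. x \<notin> K \<Longrightarrow> F x = 0"
  obtains M where "M > 0" "\<And>x y. norm (F x - F y) \<le> M * norm (x - y)"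
proof -
  have d: "\<And>x. F differentiable (at x)" and c: "\<And>i. continuous_on UNIV (pd i F)" using F by auto
  have "\<exists>M. \<forall>x. norm (pd i F x) \<le> M" for i
    by (rule bounded_continuous_compact[OF K(1) continuous_on_subset[OF c[of i] subset_UNIV]
        pd_support[OF compact_imp_closed[OF K(1)] K(2)]]) auto
  then obtain m where m: "\<And>i x. norm (pd i F x) \<le> m i" by metis
  define M where "M = \<bar>m 1\<bar> + \<bar>m 2\<bar> + 1"
  have M: "norm (pd i F x) \<le> M" for i x
    using m[where i=i and x=x] exhaust_2[of i] unfolding M_def by force
  have "norm (F x - F y) \<le> (2 * M) * norm (x - y)" for x y
  proof (rule differentiable_bound[OF convex_UNIV])
    show "(F has_derivative (\<lambda>h. \<Sum>i\<in>UNIV. h $ i *\<^sub>R pd i F x)) (at x within UNIV)" for x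
      using has_derivative_pd[OF d] by simp
    show "onorm (\<lambda>h. \<Sum>i\<in>UNIV. h $ i *\<^sub>R pd i F x) \<le> 2 * M" for x
      by (rule onorm_le) (rule norm_sum_axis_le[OF M])
  qed auto
  moreover have "2 * M > 0" unfolding M_def by simp
  ultimately show thesis using that by blast
qed

text \<open>Translation invariance makes the integral of every difference quotient zero, and
  dominated convergence passes to the derivative.\<close>

lemma integral_pd_eq_0:
  fixes F :: "real^2 \<Rightarrow> 'b::{banach, second_countable_topology}"
  assumes F: "Ck_on 1 UNIV F" and K: "compact K" "\<And>x. x \<notin> K \<Longrightarrow> F x = 0"
  shows "(LINT x|lborel. pd i F x) = 0"
proof -
  obtain M where M: "M > 0" "\<And>x y. norm (F x - F y) \<le> M * norm (x - y)"
    using C1_compact_support_Lipschitz[OF F K] by blast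
  obtain B where B: "\<And>x. x \<in> K \<Longrightarrow> norm x \<le> B"
    using compact_imp_bounded[OF K(1)] by (auto simp: bounded_iff)
  have dF: "F differentiable (at x)" for x using F by simp
  have cF: "continuous_on UNIV F" using F Ck_on_imp_continuous_on by blast
  then have mF: "F \<in> borel_measurable borel" by (rule borel_measurable_continuous_onI)
  have iF: "integrable lborel F"
    by (rule integrable_continuous_compact[OF K(1) continuous_on_subset[OF cF]]) (use K in auto)
  define e where "e = (axis i 1 :: real^2)"
  define h where "h = (\<lambda>n. 1 / real (Suc n))"
  have h: "0 < h n" "h n \<le> 1" for n by (auto simp: h_def)
  define D where "D = (\<lambda>n x. (F (x + h n *\<^sub>R e) - F x) /\<^sub>R h n)"
  have shift: "(\<lambda>x. F (x + a)) \<in> borel_measurable borel" "integrable lborel (\<lambda>x. F (x + a))"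
     "(LINT x|lborel. F (x + a)) = (LINT x|lborel. F x)" for a
    using lborel_integrable_affine[OF mF, of 1 a] lborel_integral_affine[OF mF, of 1 a] iF mF
    by (auto simp: add.commute)
  have D0: "(LINT x|lborel. D n x) = 0" for n
    using iF shift[of "h n *\<^sub>R e"] by (simp add: D_def)
  have "(\<lambda>n. LINT x|lborel. D n x) \<longlonglongrightarrow> (LINT x|lborel. pd i F x)"
  proof (rule integral_dominated_convergence)
    show "pd i F \<in> borel_measurable lborel"
      using F by (simp add: borel_measurable_continuous_onI)
    show "D n \<in> borel_measurable lborel" for n
      using shift(1) mF unfolding D_def by simp
    \<comment> \<open>The radius \<open>B + 1\<close> leaves room for steps
      \<open>h n \<le> 1\<close>: outside this ball neither \<open>x\<close> nor the shifted point
      lies in \<open>K\<close>.\<close>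
    show "integrable lborel (\<lambda>x. indicator (cball 0 (B + 1)) x *\<^sub>R M :: real)"
      by (rule borel_integrable_compact) auto
    show "AE x in lborel. (\<lambda>n. D n x) \<longlonglongrightarrow> pd i F x"
    proof (rule AE_I2)
      fix x
      have dd: "(F has_derivative frechet_derivative F (at x)) (at x)"
        using dF frechet_derivative_works by blast
      have "((\<lambda>s. F (x + s *\<^sub>R e)) has_vector_derivative pd i F x) (at 0)"
      proof -
        have 1: "((\<lambda>s. x + s *\<^sub>R e) has_derivative (\<lambda>s. s *\<^sub>R e)) (at 0)"
          by (auto intro!: derivative_eq_intros)
        have "((\<lambda>s. F (x + s *\<^sub>R e)) has_derivative (\<lambda>s. frechet_derivative F (at x) (s *\<^sub>R e))) (at 0)"
          by (rule has_derivative_compose[OF 1]) (use dd in simp)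
        moreover have "frechet_derivative F (at x) (s *\<^sub>R e) = s *\<^sub>R pd i F x" for s
          unfolding pd_def e_def using linear_scale[OF has_derivative_linear[OF dd]] by blast
        ultimately show ?thesis unfolding has_vector_derivative_def by simp
      qed
      then have "((\<lambda>s. (F (x + s *\<^sub>R e) - F x) /\<^sub>R s) \<longlongrightarrow> pd i F x) (at 0)"
      proof -
        assume "((\<lambda>s. F (x + s *\<^sub>R e)) has_vector_derivative pd i F x) (at 0)"
        then have L: "((\<lambda>s. norm (F (x + s *\<^sub>R e) - F x - s *\<^sub>R pd i F x) / norm s) \<longlongrightarrow> 0) (at 0)"
          unfolding has_vector_derivative_def has_derivative_at by simp
        have "norm (F (x + s *\<^sub>R e) - F x - s *\<^sub>R pd i F x) / norm s =
            norm ((F (x + s *\<^sub>R e) - F x) /\<^sub>R s - pd i F x)" if "s \<noteq> 0" for s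
        proof -
          have "(F (x + s *\<^sub>R e) - F x) /\<^sub>R s - pd i F x = (F (x + s *\<^sub>R e) - F x - s *\<^sub>R pd i F x) /\<^sub>R s"
            using that by (simp add: scaleR_diff_right)
          then show ?thesis by (simp add: divide_inverse mult.commute)
        qed
        then have "((\<lambda>s. norm ((F (x + s *\<^sub>R e) - F x) /\<^sub>R s - pd i F x)) \<longlongrightarrow> 0) (at 0)"
          by (intro Lim_transform_eventually[OF L]) (auto simp: eventually_at intro!: exI[of _ 1])
        then show ?thesis by (simp add: tendsto_norm_zero_iff LIM_zero_iff)
      qed
      moreover have "filterlim h (at 0) sequentially"
        unfolding filterlim_at using LIMSEQ_inverse_real_of_nat
        by (auto simp: h_def inverse_eq_divide)
      ultimately show "(\<lambda>n. D n x) \<longlonglongrightarrow> pd i F x"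
        unfolding D_def by (rule filterlim_compose)
    qed
    show "AE x in lborel. norm (D n x) \<le> indicator (cball 0 (B + 1)) x *\<^sub>R M" for n
    proof (rule AE_I2)
      fix x
      have ne: "norm (h n *\<^sub>R e) = h n" using h[of n] by (simp add: e_def)
      show "norm (D n x) \<le> indicator (cball 0 (B + 1)) x *\<^sub>R M"
      proof (cases "norm x \<le> B + 1")
        case True
        have "norm (F (x + h n *\<^sub>R e) - F x) \<le> M * h n"
          using M(2)[of "x + h n *\<^sub>R e" x] ne by simp
        then have "norm (D n x) \<le> M"
          using h[of n] unfolding D_def norm_scaleR by (simp add: pos_divide_le_eq divide_inverse_commute[symmetric])
        then show ?thesis using True by simp
      next
        case False
        have "norm (x + h n *\<^sub>R e) \<ge> norm x - h n"
          using norm_diff_ineq[of x "h n *\<^sub>R e"] ne by simp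
        then have "x + h n *\<^sub>R e \<notin> K" "x \<notin> K"
          using B[of x] B[of "x + h n *\<^sub>R e"] False h[of n] by linarith+
        then show ?thesis using False K(2) by (simp add: D_def)
      qed
    qed
  qed
  then show ?thesis unfolding D0 using LIMSEQ_unique tendsto_const by metis
qed

lemma continuous_on_mult_support:
  fixes f \<phi> :: "real^2 \<Rightarrow> complex"
  assumes "continuous_on S f" "continuous_on UNIV \<phi>" "compact K" "K \<subseteq> S" "\<And>x. x \<notin> K \<Longrightarrow> \<phi> x = 0"
  shows "integrable lborel (\<lambda>x. f x * \<phi> x)"
  by (rule integrable_continuous_compact[OF assms(3)])
    (use assms in \<open>auto intro!: continuous_intros intro: continuous_on_subset\<close>)

text \<open>\<open>f\<close> is controlled on \<open>S\<close> only, but its product with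
  \<open>\<phi>\<close> extends by zero to a C1 function on the plane, and the integral of the
  derivative of that product vanishes.\<close>

lemma integral_by_parts_pd:
  fixes f \<phi> :: "real^2 \<Rightarrow> complex"
  assumes S: "open S" and f: "Ck_on 1 S f" and \<phi>: "Ck_on 1 UNIV \<phi>"
    and K: "compact K" "K \<subseteq> S" "\<And>x. x \<notin> K \<Longrightarrow> \<phi> x = 0"
  shows "(LINT x|lborel. pd i f x * \<phi> x) = - (LINT x|lborel. f x * pd i \<phi> x)"
proof -
  have K': "closed K" using K(1) by (rule compact_imp_closed)
  have 1: "integrable lborel (\<lambda>x. pd i f x * \<phi> x)"
    by (rule continuous_on_mult_support[OF _ Ck_on_imp_continuous_on[OF \<phi>] K]) (use f in auto)
  have 2: "integrable lborel (\<lambda>x. f x * pd i \<phi> x)"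
    by (rule continuous_on_mult_support[OF Ck_on_imp_continuous_on[OF f] _ K(1,2)])
       (use \<phi> pd_support[OF K' K(3)] in auto)
  have C: "Ck_on 1 UNIV (\<lambda>x. f x * \<phi> x)"
    by (rule Ck_on_zero_extension[OF S K' K(2)])
       (use Ck_on_mult[OF S f Ck_on_subset[OF \<phi>]] K(3) in auto)
  have "pd i (\<lambda>x. f x * \<phi> x) x = f x * pd i \<phi> x + pd i f x * \<phi> x" for x
  proof (cases "x \<in> S")
    case True
    then show ?thesis using f \<phi> by (intro pd_mult) auto
  next
    case False
    then have "x \<notin> K" using K by auto
    then show ?thesis using pd_support[OF K', of \<phi> x i] pd_support[OF K', of "\<lambda>x. f x * \<phi> x" x i] K(3)
      by simp
  qed
  then have eq: "pd i (\<lambda>x. f x * \<phi> x) = (\<lambda>x. f x * pd i \<phi> x + pd i f x * \<phi> x)" by blast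
  have "0 = (LINT x|lborel. f x * pd i \<phi> x + pd i f x * \<phi> x)"
    using integral_pd_eq_0[OF C K(1), of i] K(3) unfolding eq by simp
  also have "\<dots> = (LINT x|lborel. f x * pd i \<phi> x) + (LINT x|lborel. pd i f x * \<phi> x)"
    using 1 2 by simp
  finally show ?thesis by (simp add: add_eq_0_iff)
qed

text \<open>The support of \<open>\<phi>\<close> removes all boundary terms. Regularity of
  \<open>f\<close> is asked on \<open>S\<close> only, which admits fields known just outside the
  scatterer.\<close>

lemma integral_green:
  fixes f \<phi> :: "real^2 \<Rightarrow> complex"
  assumes S: "open S" and f: "Ck_on 2 S f" and \<phi>: "Ck_on 2 UNIV \<phi>"
    and K: "compact K" "K \<subseteq> S" "\<And>x. x \<notin> K \<Longrightarrow> \<phi> x = 0"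
  shows "(LINT x|lborel. lap f x * \<phi> x) = (LINT x|lborel. f x * lap \<phi> x)"
proof -
  have K': "closed K" using K(1) by (rule compact_imp_closed)
  have f1: "Ck_on 1 S f" "\<And>i. Ck_on 1 S (pd i f)" "\<And>i. continuous_on S (pd i (pd i f))"
    using f Ck_on_mono[OF f, of 1] by (auto simp: numeral_2_eq_2)
  have \<phi>1: "Ck_on 1 UNIV \<phi>" "\<And>i. Ck_on 1 UNIV (pd i \<phi>)" "\<And>i. continuous_on UNIV (pd i (pd i \<phi>))"
    using \<phi> Ck_on_mono[OF \<phi>, of 1] by (auto simp: numeral_2_eq_2)
  have p0: "\<And>i x. x \<notin> K \<Longrightarrow> pd i \<phi> x = 0" "\<And>i x. x \<notin> K \<Longrightarrow> pd i (pd i \<phi>) x = 0"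
    using pd_support[OF K' K(3)] pd_support[OF K', of "pd _ \<phi>"] pd_support[OF K' K(3)] by auto
  have "(LINT x|lborel. lap f x * \<phi> x) = (LINT x|lborel. (\<Sum>i\<in>UNIV. pd i (pd i f) x * \<phi> x))"
    unfolding lap_def sum_distrib_right by (rule refl)
  also have "\<dots> = (\<Sum>i\<in>UNIV. LINT x|lborel. pd i (pd i f) x * \<phi> x)"
    by (intro Bochner_Integration.integral_sum continuous_on_mult_support[OF f1(3) Ck_on_imp_continuous_on[OF \<phi>] K])
  also have "\<dots> = (\<Sum>i\<in>UNIV. LINT x|lborel. f x * pd i (pd i \<phi>) x)"
  proof (rule sum.cong)
    fix i :: 2
    show "(LINT x|lborel. pd i (pd i f) x * \<phi> x) = (LINT x|lborel. f x * pd i (pd i \<phi>) x)"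
      using integral_by_parts_pd[OF S f1(2) \<phi>1(1) K, of i i]
        integral_by_parts_pd[OF S f1(1) \<phi>1(2)[of i] K(1,2) p0(1), of i] by simp
  qed simp
  also have "\<dots> = (LINT x|lborel. (\<Sum>i\<in>UNIV. f x * pd i (pd i \<phi>) x))"
    by (intro Bochner_Integration.integral_sum[symmetric] continuous_on_mult_support[OF Ck_on_imp_continuous_on[OF f] \<phi>1(3) K(1,2) p0(2)])
  also have "\<dots> = (LINT x|lborel. f x * lap \<phi> x)"
    unfolding lap_def sum_distrib_left by (rule refl)
  finally show ?thesis .
qed

section \<open>Convolution with a compactly supported kernel\<close>

definition conv :: "(real^2 \<Rightarrow> complex) \<Rightarrow> (real^2 \<Rightarrow> complex) \<Rightarrow> real^2 \<Rightarrow> complex" where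
  "conv g \<eta> x = (LINT y|lborel. g y * \<eta> (x - y))"

lemma integrable_mult_bounded:
  fixes g f :: "'a \<Rightarrow> complex"
  assumes "integrable M g" "f \<in> borel_measurable M" "\<And>x. norm (f x) \<le> B"
  shows "integrable M (\<lambda>x. g x * f x)"
proof (rule Bochner_Integration.integrable_bound)
  show "integrable M (\<lambda>x. B * norm (g x))" using assms(1) by simp
  show "(\<lambda>x. g x * f x) \<in> borel_measurable M" using assms by measurable
  show "AE x in M. norm (g x * f x) \<le> norm (B * norm (g x))"
  proof (rule AE_I2)
    fix x
    have "norm (f x) * norm (g x) \<le> B * norm (g x)" by (intro mult_right_mono assms) auto
    then show "norm (g x * f x) \<le> norm (B * norm (g x))" by (simp add: norm_mult mult.commute)
  qed
qed

lemma integrable_conv: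
  fixes g \<eta> :: "real^2 \<Rightarrow> complex"
  assumes "integrable lborel g" "continuous_on UNIV \<eta>" "compact K" "\<And>x. x \<notin> K \<Longrightarrow> \<eta> x = 0"
  shows "integrable lborel (\<lambda>y. g y * \<eta> (x - y))"
proof -
  obtain M where "\<And>x. norm (\<eta> x) \<le> M"
    using bounded_continuous_compact[OF assms(3) continuous_on_subset[OF assms(2)] assms(4)] by auto
  moreover have "continuous_on UNIV (\<lambda>y. \<eta> (x - y))"
    by (rule continuous_on_compose2[OF assms(2)]) (auto intro!: continuous_intros)
  ultimately show ?thesis
    by (intro integrable_mult_bounded[OF assms(1), of _ M]) (auto intro: borel_measurable_continuous_onI)
qed

text \<open>The point is uniformity in \<open>z\<close>: the remainder of the linearisation is later
  integrated over all translates of the kernel.\<close>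

lemma C1_compact_support_uniform_derivative:
  fixes \<eta> :: "real^2 \<Rightarrow> complex"
  assumes \<eta>: "Ck_on 1 UNIV \<eta>" and K: "compact K" "\<And>x. x \<notin> K \<Longrightarrow> \<eta> x = 0" and e: "e > 0"
  obtains d where "d > 0" "\<And>z h. norm h < d \<Longrightarrow>
    norm (\<eta> (z + h) - \<eta> z - (\<Sum>i\<in>UNIV. h $ i *\<^sub>R pd i \<eta> z)) \<le> e * norm h"
proof -
  obtain B where B: "\<And>x. x \<in> K \<Longrightarrow> norm x \<le> B"
    using compact_imp_bounded[OF K(1)] by (auto simp: bounded_iff)
  have p0: "norm x > B \<Longrightarrow> pd i \<eta> x = 0" for i x
    using pd_support[OF compact_imp_closed[OF K(1)] K(2)] B by force
  have "\<exists>d>0. \<forall>z h. norm h < d \<longrightarrow> norm (pd i \<eta> (z + h) - pd i \<eta> z) \<le> e / 2" for i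
  proof -
    have "continuous_on UNIV (pd i \<eta>)" using \<eta> by simp
    then have "continuous_on (cball 0 (B + 1)) (pd i \<eta>)" by (rule continuous_on_subset) simp
    then have "uniformly_continuous_on (cball 0 (B + 1)) (pd i \<eta>)"
      by (rule compact_uniformly_continuous) auto
    then obtain d where d: "d > 0"
      "\<And>x y. \<lbrakk>norm x \<le> B + 1; norm y \<le> B + 1; dist y x < d\<rbrakk> \<Longrightarrow> dist (pd i \<eta> y) (pd i \<eta> x) < e / 2"
      unfolding uniformly_continuous_on_def using e by (metis half_gt_zero mem_cball_0)
    \<comment> \<open>A step shorter than 1 does not lead from outside the ball of radius
      \<open>B + 1\<close> into the ball of radius \<open>B\<close>. So either both points lie in
      the larger ball, or both derivatives vanish.\<close>
    have "norm (pd i \<eta> (z + h) - pd i \<eta> z) \<le> e / 2" if "norm h < min d 1" for z h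
    proof (cases "norm z \<le> B + 1 \<and> norm (z + h) \<le> B + 1")
      case True
      then show ?thesis using d(2)[of z "z + h"] that by (simp add: dist_norm)
    next
      case False
      then have "norm z > B" "norm (z + h) > B"
        using norm_triangle_ineq[of z h] norm_triangle_ineq4[of "z + h" h] that by auto
      then show ?thesis using p0 e by simp
    qed
    then show ?thesis using d(1) by (intro exI[of _ "min d 1"]) auto
  qed
  then obtain dd where dd: "\<And>i. dd i > 0"
    "\<And>i z h. norm h < dd i \<Longrightarrow> norm (pd i \<eta> (z + h) - pd i \<eta> z) \<le> e / 2" by metis
  define d where "d = min (dd 1) (dd 2)"
  have d: "d > 0" "\<And>i z h. norm h < d \<Longrightarrow> norm (pd i \<eta> (z + h) - pd i \<eta> z) \<le> e / 2"
    using dd exhaust_2 unfolding d_def by (auto, metis)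
  have "norm (\<eta> (z + h) - \<eta> z - (\<Sum>i\<in>UNIV. h $ i *\<^sub>R pd i \<eta> z)) \<le> e * norm h" if h: "norm h < d" for z h
  proof -
    \<comment> \<open>The linearisation at \<open>z\<close> is subtracted, so the derivative of
      \<open>G\<close> consists of differences of partial derivatives of \<open>\<eta>\<close>; two
      coordinates with \<open>e / 2\<close> each give the bound \<open>e\<close>.\<close>
    define G where "G = (\<lambda>w. \<eta> (z + w) - (\<Sum>i\<in>UNIV. w $ i *\<^sub>R pd i \<eta> z))"
    have "norm (G h - G 0) \<le> e * norm (h - 0)"
    proof (rule differentiable_bound[OF convex_ball[of 0 d]])
      fix w assume w: "w \<in> ball (0::real^2) d"
      have "((\<lambda>w. \<eta> (z + w)) has_derivative (\<lambda>h. \<Sum>i\<in>UNIV. h $ i *\<^sub>R pd i \<eta> (z + w))) (at w)"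
      proof -
        have 1: "((\<lambda>w. z + w) has_derivative (\<lambda>h. h)) (at w)"
          by (auto intro!: derivative_eq_intros)
        show ?thesis
          by (rule has_derivative_compose[OF 1 has_derivative_pd]) (use \<eta> in simp)
      qed
      moreover have "((\<lambda>w. \<Sum>i\<in>UNIV. w $ i *\<^sub>R pd i \<eta> z) has_derivative
          (\<lambda>h. \<Sum>i\<in>UNIV. h $ i *\<^sub>R pd i \<eta> z)) (at w)"
        by (intro has_derivative_sum has_derivative_scaleR_left bounded_linear.has_derivative[OF bounded_linear_vec_nth] has_derivative_ident)
      ultimately have "(G has_derivative (\<lambda>h. (\<Sum>i\<in>UNIV. h $ i *\<^sub>R pd i \<eta> (z + w)) -
          (\<Sum>i\<in>UNIV. h $ i *\<^sub>R pd i \<eta> z))) (at w)"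
        unfolding G_def by (rule has_derivative_diff)
      then have "(G has_derivative (\<lambda>h. \<Sum>i\<in>UNIV. h $ i *\<^sub>R (pd i \<eta> (z + w) - pd i \<eta> z))) (at w)"
        by (simp add: sum_subtractf scaleR_diff_right)
      then show "(G has_derivative (\<lambda>h. \<Sum>i\<in>UNIV. h $ i *\<^sub>R (pd i \<eta> (z + w) - pd i \<eta> z))) (at w within ball 0 d)"
        by (rule has_derivative_at_withinI)
      have "norm (\<Sum>i\<in>UNIV. h $ i *\<^sub>R (pd i \<eta> (z + w) - pd i \<eta> z)) \<le> 2 * (e / 2) * norm h" for h
        by (rule norm_sum_axis_le) (use d(2) w in auto)
      then show "onorm (\<lambda>h. \<Sum>i\<in>UNIV. h $ i *\<^sub>R (pd i \<eta> (z + w) - pd i \<eta> z)) \<le> e"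
        by (intro onorm_le) simp
    qed (use h d(1) in auto)
    then show ?thesis by (simp add: G_def algebra_simps)
  qed
  then show thesis using that d(1) by blast
qed

text \<open>All derivatives fall on the kernel, so integrability of \<open>g\<close> is enough.
  Integrated against the norm of \<open>g\<close>, the uniform remainder gains the factor
  \<open>G\<close>, compensated by the tolerance \<open>e / (G + 1)\<close>; the 1 prevents division
  by zero.\<close>

lemma conv_has_derivative:
  assumes g: "integrable lborel g" and \<eta>: "Ck_on 1 UNIV \<eta>"
    and K: "compact K" "\<And>x. x \<notin> K \<Longrightarrow> \<eta> x = 0"
  shows "(conv g \<eta> has_derivative (\<lambda>h. \<Sum>i\<in>UNIV. h $ i *\<^sub>R conv g (pd i \<eta>) x)) (at x)"
proof -
  define G where "G = (LINT y|lborel. norm (g y))"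
  have G: "G \<ge> 0" unfolding G_def by simp
  have i0: "integrable lborel (\<lambda>y. g y * \<eta> (x - y))" for x
    by (rule integrable_conv[OF g Ck_on_imp_continuous_on[OF \<eta>] K])
  have i1: "integrable lborel (\<lambda>y. g y * pd i \<eta> (x - y))" for x i
    by (rule integrable_conv[OF g _ K(1)])
       (use \<eta> pd_support[OF compact_imp_closed[OF K(1)] K(2)] in auto)
  have "\<exists>d>0. \<forall>y. norm (y - x) < d \<longrightarrow> norm (conv g \<eta> y - conv g \<eta> x -
      (\<Sum>i\<in>UNIV. (y - x) $ i *\<^sub>R conv g (pd i \<eta>) x)) \<le> e * norm (y - x)" if e: "e > 0" for e
  proof -
    have e': "e / (G + 1) > 0" using e G by simp
    obtain d where d: "d > 0" "\<And>z h. norm h < d \<Longrightarrow>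
      norm (\<eta> (z + h) - \<eta> z - (\<Sum>i\<in>UNIV. h $ i *\<^sub>R pd i \<eta> z)) \<le> e / (G + 1) * norm h"
      using C1_compact_support_uniform_derivative[OF \<eta> K e'] by blast
    have "norm (conv g \<eta> y - conv g \<eta> x - (\<Sum>i\<in>UNIV. (y - x) $ i *\<^sub>R conv g (pd i \<eta>) x)) \<le> e * norm (y - x)"
      if y: "norm (y - x) < d" for y
    proof -
      define R where "R = (\<lambda>u. g u * (\<eta> (y - u) - \<eta> (x - u) - (\<Sum>i\<in>UNIV. (y - x) $ i *\<^sub>R pd i \<eta> (x - u))))"
      have Req: "R u = g u * \<eta> (y - u) - g u * \<eta> (x - u) - (\<Sum>i\<in>UNIV. (y - x) $ i *\<^sub>R (g u * pd i \<eta> (x - u)))" for u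
        unfolding R_def by (simp add: algebra_simps sum_distrib_left)
      have "conv g \<eta> y - conv g \<eta> x - (\<Sum>i\<in>UNIV. (y - x) $ i *\<^sub>R conv g (pd i \<eta>) x) = (LINT u|lborel. R u)"
        unfolding Req conv_def using i0 i1 by simp
      also have "norm \<dots> \<le> (LINT u|lborel. norm (g u) * (e / (G + 1) * norm (y - x)))"
      proof (rule Bochner_Integration.integral_norm_bound_integral)
        show "integrable lborel R" unfolding Req[abs_def] using i0 i1 by auto
        show "integrable lborel (\<lambda>u. norm (g u) * (e / (G + 1) * norm (y - x)))"
          using g by simp
        show "norm (R u) \<le> norm (g u) * (e / (G + 1) * norm (y - x))" for u
          using d(2)[OF y, of "x - u"] unfolding R_def norm_mult
          by (intro mult_left_mono) (auto simp: algebra_simps)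
      qed
      also have "\<dots> = G * (e / (G + 1) * norm (y - x))" unfolding G_def by simp
      also have "\<dots> = (G / (G + 1)) * (e * norm (y - x))" by simp
      also have "\<dots> \<le> 1 * (e * norm (y - x))"
        using G e by (intro mult_right_mono) auto
      finally show ?thesis by simp
    qed
    then show ?thesis using d(1) by blast
  qed
  moreover have "bounded_linear (\<lambda>h::real^2. \<Sum>i\<in>UNIV. h $ i *\<^sub>R conv g (pd i \<eta>) x)"
    by (intro bounded_linear_sum bounded_linear_scaleR_const bounded_linear_vec_nth)
  ultimately show ?thesis unfolding has_derivative_within_alt by auto
qed

lemma pd_conv:
  assumes "integrable lborel g" "Ck_on 1 UNIV \<eta>" "compact K" "\<forall>x. x \<notin> K \<longrightarrow> \<eta> x = 0"
  shows "pd i (conv g \<eta>) = conv g (pd i \<eta>)"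
proof
  fix x
  have "pd i (conv g \<eta>) x = (\<Sum>j\<in>UNIV. axis i 1 $ j *\<^sub>R conv g (pd j \<eta>) x)"
    using pd_eqI[OF conv_has_derivative[OF assms(1-3)]] assms(4) by simp
  also have "\<dots> = (\<Sum>j\<in>UNIV. if j = i then conv g (pd j \<eta>) x else 0)"
    by (intro sum.cong) (auto simp: axis_def)
  finally show "pd i (conv g \<eta>) x = conv g (pd i \<eta>) x" by simp
qed

text \<open>One order is given away: continuity of the convolution is read off from its
  differentiability, which asks for a C1 kernel. For smooth kernels nothing is lost.\<close>

lemma Ck_on_conv:
  assumes "integrable lborel g" "Ck_on (Suc m) UNIV \<eta>" "compact K" "\<And>x. x \<notin> K \<Longrightarrow> \<eta> x = 0"
  shows "Ck_on m UNIV (conv g \<eta>)"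
  using assms(2,4)
proof (induction m arbitrary: \<eta>)
  case 0
  have "continuous (at x) (conv g \<eta>)" for x
    using has_derivative_continuous[OF conv_has_derivative[OF assms(1) _ assms(3) 0(2)]] 0(1) by simp
  then show ?case by (simp add: continuous_at_imp_continuous_on)
next
  case (Suc m)
  have C1: "Ck_on 1 UNIV \<eta>" using Ck_on_mono[OF Suc.prems(1), of 1] by simp
  have supp: "\<forall>x. x \<notin> K \<longrightarrow> \<eta> x = 0" using Suc.prems(2) by blast
  have "Ck_on m UNIV (pd i (conv g \<eta>))" for i
    unfolding pd_conv[OF assms(1) C1 assms(3) supp]
    by (rule Suc.IH)
       (use Suc.prems pd_support[OF compact_imp_closed[OF assms(3)] Suc.prems(2)] in auto)
  moreover have "conv g \<eta> differentiable (at x)" for x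
    using conv_has_derivative[OF assms(1) C1 assms(3) Suc.prems(2)] by (rule differentiableI)
  ultimately show ?case by simp
qed

lemma smooth_on_conv:
  assumes "integrable lborel g" "smooth_on UNIV \<eta>" "compact K" "\<And>x. x \<notin> K \<Longrightarrow> \<eta> x = 0"
  shows "smooth_on UNIV (conv g \<eta>)"
  using assms Ck_on_conv unfolding smooth_on_def by blast

lemma lap_conv:
  assumes g: "integrable lborel g" and \<eta>: "Ck_on 2 UNIV \<eta>"
    and K: "compact K" "\<forall>x. x \<notin> K \<longrightarrow> \<eta> x = 0"
  shows "lap (conv g \<eta>) = conv g (lap \<eta>)"
proof
  fix x
  have K1: "\<forall>x. x \<notin> K \<longrightarrow> pd i \<eta> x = 0" for i
    using pd_support[OF compact_imp_closed[OF K(1)]] K(2) by metis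
  have K2: "\<forall>x. x \<notin> K \<longrightarrow> pd i (pd i \<eta>) x = 0" for i
    using pd_support[OF compact_imp_closed[OF K(1)]] K1 by metis
  have C: "Ck_on 1 UNIV \<eta>" "\<And>i. Ck_on 1 UNIV (pd i \<eta>)" "\<And>i. continuous_on UNIV (pd i (pd i \<eta>))"
    using \<eta> Ck_on_mono[OF \<eta>, of 1] by (auto simp: numeral_2_eq_2)
  have "lap (conv g \<eta>) x = (\<Sum>i\<in>UNIV. conv g (pd i (pd i \<eta>)) x)"
    unfolding lap_def pd_conv[OF g C(1) K] pd_conv[OF g C(2) K(1) K1] by (rule refl)
  also have "\<dots> = conv g (lap \<eta>) x"
    unfolding conv_def lap_def sum_distrib_left
    by (rule Bochner_Integration.integral_sum[symmetric])
       (rule integrable_conv[OF g C(3) K(1)], use K2 in blast)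
  finally show "lap (conv g \<eta>) x = conv g (lap \<eta>) x" .
qed

lemma conv_support:
  assumes "\<And>x. norm x > R \<Longrightarrow> g x = 0" "\<And>x. norm x \<ge> e \<Longrightarrow> \<eta> x = 0" "norm x \<ge> R + e"
  shows "conv g \<eta> x = 0"
proof -
  have "g y * \<eta> (x - y) = 0" for y
    using assms(1)[of y] assms(2)[of "x - y"] assms(3) norm_triangle_ineq2[of x y] by (cases "norm y > R") auto
  then show ?thesis unfolding conv_def by (simp only: integral_zero)
qed

lemma conv_support_inner:
  assumes "\<And>x. norm x < R \<Longrightarrow> g x = 0" "\<And>x. norm x \<ge> e \<Longrightarrow> \<eta> x = 0" "norm x \<le> R - e"
  shows "conv g \<eta> x = 0"
proof -
  have "g y * \<eta> (x - y) = 0" for y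
    using assms(1)[of y] assms(2)[of "x - y"] assms(3) norm_triangle_ineq2[of y x]
    by (cases "norm y < R") (auto simp: norm_minus_commute)
  then show ?thesis unfolding conv_def by (simp only: integral_zero)
qed

section \<open>Mollification in \<open>L\<^sup>2\<close>\<close>

text \<open>Kept on the Borel side, because affine substitutions and Fubini ask for Borel functions.
  The Lebesgue measurable data of the problem enter through Borel representatives.\<close>

definition sq_integrable :: "('a::euclidean_space \<Rightarrow> complex) \<Rightarrow> bool" where
  "sq_integrable f \<longleftrightarrow> f \<in> borel_measurable borel \<and> integrable lborel (\<lambda>x. (norm (f x))\<^sup>2)"

text \<open>Young's inequality with a free weight and a generous constant, in the role of
  Cauchy-Schwarz: a small \<open>s\<close> weakens the factor that is merely bounded, while the
  other factor tends to zero.\<close>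

lemma mult_le_weighted_squares:
  fixes a b s :: real
  assumes "s > 0"
  shows "a * b \<le> s * a\<^sup>2 + b\<^sup>2 / s"
proof -
  have "0 \<le> (s * a - b)\<^sup>2 + (s * a)\<^sup>2 + b\<^sup>2" by simp
  then have "s * (a * b) \<le> s * (s * a\<^sup>2 + b\<^sup>2 / s)"
    using assms by (simp add: power2_eq_square algebra_simps)
  then show ?thesis using assms by simp
qed

lemma sq_integrable_mult:
  fixes f g :: "'a::euclidean_space \<Rightarrow> complex"
  assumes "sq_integrable f" "sq_integrable g"
  shows "integrable lborel (\<lambda>x. f x * g x)"
proof (rule Bochner_Integration.integrable_bound)
  show "integrable lborel (\<lambda>x. (norm (f x))\<^sup>2 + (norm (g x))\<^sup>2)"
    using assms by (simp add: sq_integrable_def)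
  show "(\<lambda>x. f x * g x) \<in> borel_measurable lborel"
    using assms by (auto simp: sq_integrable_def)
  have "norm (f x) * norm (g x) \<le> (norm (f x))\<^sup>2 + (norm (g x))\<^sup>2" for x
    using mult_le_weighted_squares[of 1 "norm (f x)" "norm (g x)"] by simp
  then show "AE x in lborel. norm (f x * g x) \<le> norm ((norm (f x))\<^sup>2 + (norm (g x))\<^sup>2)"
    by (intro AE_I2) (simp add: norm_mult)
qed

lemma norm_add_sq_le:
  fixes a b :: "'a::real_normed_vector"
  shows "(norm (a + b))\<^sup>2 \<le> 2 * (norm a)\<^sup>2 + 2 * (norm b)\<^sup>2"
proof -
  have "(norm (a + b))\<^sup>2 \<le> (norm a + norm b)\<^sup>2"
    by (intro power_mono norm_triangle_ineq) simp
  also have "\<dots> \<le> 2 * (norm a)\<^sup>2 + 2 * (norm b)\<^sup>2"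
    using sum_squares_bound[of "norm a" "norm b"] by (simp add: power2_sum)
  finally show ?thesis .
qed

lemma sq_integrable_add:
  fixes f g :: "'a::euclidean_space \<Rightarrow> complex"
  assumes "sq_integrable f" "sq_integrable g"
  shows "sq_integrable (\<lambda>x. f x + g x)"
proof -
  have "integrable lborel (\<lambda>x. (norm (f x + g x))\<^sup>2)"
  proof (rule Bochner_Integration.integrable_bound)
    show "integrable lborel (\<lambda>x. 2 * (norm (f x))\<^sup>2 + 2 * (norm (g x))\<^sup>2)"
      using assms by (simp add: sq_integrable_def)
    show "(\<lambda>x. (norm (f x + g x))\<^sup>2) \<in> borel_measurable lborel"
      using assms by (auto simp: sq_integrable_def)
    show "AE x in lborel. norm ((norm (f x + g x))\<^sup>2) \<le> norm (2 * (norm (f x))\<^sup>2 + 2 * (norm (g x))\<^sup>2)"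
      using norm_add_sq_le by (intro AE_I2) simp
  qed
  then show ?thesis using assms by (auto simp: sq_integrable_def)
qed

lemma sq_integrable_cmult:
  fixes f :: "'a::euclidean_space \<Rightarrow> complex"
  assumes "sq_integrable f"
  shows "sq_integrable (\<lambda>x. c * f x)"
  using assms by (auto simp: sq_integrable_def norm_mult power_mult_distrib)

lemma sq_integrable_diff:
  fixes f g :: "'a::euclidean_space \<Rightarrow> complex"
  assumes "sq_integrable f" "sq_integrable g"
  shows "sq_integrable (\<lambda>x. f x - g x)"
  using sq_integrable_add[OF assms(1) sq_integrable_cmult[OF assms(2), of "-1"]] by simp

lemma sq_integrable_bound:
  fixes f g :: "'a::euclidean_space \<Rightarrow> complex"
  assumes "sq_integrable f" "g \<in> borel_measurable borel" "\<And>x. norm (g x) \<le> C * norm (f x)"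
  shows "sq_integrable g"
proof -
  have "integrable lborel (\<lambda>x. (norm (g x))\<^sup>2)"
  proof (rule Bochner_Integration.integrable_bound)
    show "integrable lborel (\<lambda>x. C\<^sup>2 * (norm (f x))\<^sup>2)"
      using assms(1) by (simp add: sq_integrable_def)
    show "(\<lambda>x. (norm (g x))\<^sup>2) \<in> borel_measurable lborel"
      using assms(2) by simp
    have "(norm (g x))\<^sup>2 \<le> C\<^sup>2 * (norm (f x))\<^sup>2" for x
      using power_mono[OF assms(3)[of x] norm_ge_zero, of 2] by (simp add: power_mult_distrib)
    then show "AE x in lborel. norm ((norm (g x))\<^sup>2) \<le> norm (C\<^sup>2 * (norm (f x))\<^sup>2)"
      by (intro AE_I2) simp
  qed
  then show ?thesis using assms(2) by (simp add: sq_integrable_def)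
qed

lemma sq_integrable_continuous_compact:
  fixes f :: "'a::euclidean_space \<Rightarrow> complex"
  assumes "compact K" "continuous_on UNIV f" "\<And>x. x \<notin> K \<Longrightarrow> f x = 0"
  shows "sq_integrable f"
proof -
  have "integrable lborel (\<lambda>x. (norm (f x))\<^sup>2)"
    by (rule integrable_continuous_compact[OF assms(1)])
       (use assms in \<open>auto intro!: continuous_intros intro: continuous_on_subset\<close>)
  then show ?thesis using assms(2) by (simp add: sq_integrable_def borel_measurable_continuous_onI)
qed

lemma sq_integrable_affine:
  fixes f :: "'a::euclidean_space \<Rightarrow> complex"
  assumes "sq_integrable f" "c = 1 \<or> c = - 1"
  shows "sq_integrable (\<lambda>x. f (t + c *\<^sub>R x))"
proof -
  have m: "(\<lambda>x. (norm (f x))\<^sup>2) \<in> borel_measurable borel" "f \<in> borel_measurable borel"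
    using assms(1) by (auto simp: sq_integrable_def)
  have "(\<lambda>x. f (t + c *\<^sub>R x)) \<in> borel_measurable borel"
    using m(2) by simp
  then show ?thesis
    using lborel_integrable_affine[OF m(1) assms(2), of t] assms(1) by (simp add: sq_integrable_def)
qed

text \<open>Density of continuous functions with compact support. A measurable \<open>f\<close> is
  an almost everywhere limit of continuous \<open>g m\<close>, but without a dominating function;
  the same truncation \<open>tr n\<close> applied to \<open>f\<close> and to \<open>g m\<close>
  preserves continuity and makes dominated convergence available.\<close>

lemma sq_integrable_approx_continuous:
  fixes f :: "'a::euclidean_space \<Rightarrow> complex"
  assumes f: "sq_integrable f" and e: "e > 0"
  obtains c R where "continuous_on UNIV c" "\<And>x. norm x \<ge> R \<Longrightarrow> c x = 0"
    "(LINT x|lborel. (norm (f x - c x))\<^sup>2) < e"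
proof -
  have mf: "f \<in> borel_measurable borel" and int_f: "integrable lborel (\<lambda>x. (norm (f x))\<^sup>2)"
    using f by (auto simp: sq_integrable_def)
  have "f measurable_on UNIV"
    using mf by (intro lebesgue_measurable_imp_measurable_on measurable_completion) auto
  then obtain Z g where Z: "negligible Z" and g: "\<And>m::nat. continuous_on UNIV (g m)"
      "\<And>x. x \<notin> Z \<Longrightarrow> (\<lambda>m. g m x) \<longlonglongrightarrow> f x"
    unfolding measurable_on_def by auto
  have "AE x in lebesgue. x \<notin> Z"
    using Z AE_not_in negligible_iff_null_sets by blast
  then have Z': "AE x in lborel. x \<notin> Z" by (simp add: AE_completion_iff)
  \<comment> \<open>The numerator cuts off in space between the radii \<open>n + 1\<close> and
    \<open>n + 2\<close>; the denominator clips values to norm at most \<open>n + 1\<close>. Both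
    act through a factor between 0 and 1, so \<open>norm z\<close> remains a bound.\<close>
  define s where "s = (\<lambda>(n::nat) (x::'a) (z::complex).
     max 0 (min 1 (real n + 2 - norm x)) / max 1 (norm z / (real n + 1)))"
  define tr where "tr = (\<lambda>n x z. s n x z *\<^sub>R z)"
  have s01: "0 \<le> s n x z" "s n x z \<le> 1" for n x z
    unfolding s_def by (auto simp: divide_le_eq)
  have s1: "s n x z = 1" if "norm x \<le> n" "norm z \<le> n" for n x z
    using that by (auto simp: s_def field_simps max_def min_def)
  have tr0: "tr n x z = 0" if "norm x \<ge> real n + 2" for n x z
    using that by (auto simp: tr_def s_def)
  have trb: "norm (tr n x z) \<le> real n + 1" for n x z
  proof -
    define den where "den = max 1 (norm z / (real n + 1))"
    have den: "den \<ge> 1" "norm z / (real n + 1) \<le> den" by (auto simp: den_def)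
    have "norm (tr n x z) = max 0 (min 1 (real n + 2 - norm x)) * (norm z / den)"
      using den by (simp add: tr_def s_def flip: den_def)
    also have "\<dots> \<le> norm z / den" using den by (intro mult_left_le_one_le) auto
    also have "\<dots> \<le> real n + 1" using den by (simp add: divide_le_eq mult.commute)
    finally show ?thesis .
  qed
  have tr_diff: "norm (z - tr n x z) \<le> norm z" for n x z
  proof -
    have "z - tr n x z = (1 - s n x z) *\<^sub>R z" by (simp add: tr_def algebra_simps)
    then show ?thesis using s01[of n x z] by (simp add: mult_left_le_one_le)
  qed
  have trc: "continuous_on UNIV (\<lambda>x. tr n x (h x))" if "continuous_on UNIV h" for n h
    unfolding tr_def s_def by (intro continuous_intros that) (auto simp: max_def)
  have trc2: "continuous_on UNIV (\<lambda>z. tr n x z)" for n x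
    unfolding tr_def s_def by (intro continuous_intros) (auto simp: max_def)
  have trm: "(\<lambda>x. tr n x (h x)) \<in> borel_measurable borel" if [measurable]: "h \<in> borel_measurable borel" for n h
    unfolding tr_def s_def by measurable
  have "(\<lambda>n. LINT x|lborel. (norm (f x - tr n x (f x)))\<^sup>2) \<longlonglongrightarrow> (LINT x::'a|lborel. 0)"
  proof (rule integral_dominated_convergence[OF _ _ int_f])
    show "(\<lambda>x. (norm (f x - tr n x (f x)))\<^sup>2) \<in> borel_measurable lborel" for n
      using mf trm[OF mf] by simp
    show "AE x in lborel. (\<lambda>n. (norm (f x - tr n x (f x)))\<^sup>2) \<longlonglongrightarrow> 0"
    proof (rule AE_I2)
      fix x
      obtain N :: nat where N: "max (norm x) (norm (f x)) \<le> N" using real_arch_simple by blast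
      have "\<forall>\<^sub>F n in sequentially. 0 = (norm (f x - tr n x (f x)))\<^sup>2"
        unfolding eventually_sequentially
        by (rule exI[of _ N]) (use N s1 in \<open>auto simp: tr_def\<close>)
      then show "(\<lambda>n. (norm (f x - tr n x (f x)))\<^sup>2) \<longlonglongrightarrow> 0"
        by (rule Lim_transform_eventually[OF tendsto_const])
    qed
    show "AE x in lborel. norm ((norm (f x - tr n x (f x)))\<^sup>2) \<le> (norm (f x))\<^sup>2" for n
      using tr_diff by (intro AE_I2) (simp add: power_mono)
  qed simp
  \<comment> \<open>Two errors of \<open>e / 4\<close>, this one and the one for \<open>g m\<close>,
    are doubled by \<open>norm_add_sq_le\<close> and add up to \<open>e\<close>.\<close>
  then have "\<forall>\<^sub>F n in sequentially. (LINT x|lborel. (norm (f x - tr n x (f x)))\<^sup>2) < e / 4"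
    using e by (intro order_tendstoD) auto
  then obtain n where n: "(LINT x|lborel. (norm (f x - tr n x (f x)))\<^sup>2) < e / 4"
    by (auto dest: eventually_happens)
  have gm: "g m \<in> borel_measurable borel" for m
    using g(1) by (rule borel_measurable_continuous_onI)
  have "(\<lambda>m. LINT x|lborel. (norm (tr n x (f x) - tr n x (g m x)))\<^sup>2) \<longlonglongrightarrow> (LINT x::'a|lborel. 0)"
  proof (rule integral_dominated_convergence)
    show "integrable lborel (\<lambda>x::'a. indicator (cball 0 (real n + 2)) x *\<^sub>R (2 * (real n + 1))\<^sup>2 :: real)"
      by (rule borel_integrable_compact) auto
    show "(\<lambda>x. (norm (tr n x (f x) - tr n x (g m x)))\<^sup>2) \<in> borel_measurable lborel" for m
      using trm[OF gm] trm[OF mf] by simp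
    show "AE x in lborel. (\<lambda>m. (norm (tr n x (f x) - tr n x (g m x)))\<^sup>2) \<longlonglongrightarrow> 0"
      using Z'
    proof eventually_elim
      case (elim x)
      have "isCont (tr n x) (f x)" using trc2[of n x] by (simp add: continuous_on_eq_continuous_at)
      then have "(\<lambda>m. tr n x (g m x)) \<longlonglongrightarrow> tr n x (f x)"
        using g(2)[OF elim] by (rule isCont_tendsto_compose)
      then have "(\<lambda>m. (norm (tr n x (f x) - tr n x (g m x)))\<^sup>2) \<longlonglongrightarrow> (norm (tr n x (f x) - tr n x (f x)))\<^sup>2"
        by (intro tendsto_intros)
      then show ?case by simp
    qed
    show "AE x in lborel. norm ((norm (tr n x (f x) - tr n x (g m x)))\<^sup>2) \<le>
        indicator (cball 0 (real n + 2)) x *\<^sub>R (2 * (real n + 1))\<^sup>2" for m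
    proof (rule AE_I2)
      fix x
      have "norm (tr n x (f x) - tr n x (g m x)) \<le> 2 * (real n + 1)"
        using order_trans[OF norm_triangle_ineq4 add_mono[OF trb[of n x "f x"] trb[of n x "g m x"]]]
        by (simp add: algebra_simps)
      then show "norm ((norm (tr n x (f x) - tr n x (g m x)))\<^sup>2) \<le>
        indicator (cball 0 (real n + 2)) x *\<^sub>R (2 * (real n + 1))\<^sup>2"
        using tr0[of n x] by (cases "norm x \<le> real n + 2") (auto intro: power_mono)
    qed
  qed simp
  then have "\<forall>\<^sub>F m in sequentially. (LINT x|lborel. (norm (tr n x (f x) - tr n x (g m x)))\<^sup>2) < e / 4"
    using e by (intro order_tendstoD) auto
  then obtain m where m: "(LINT x|lborel. (norm (tr n x (f x) - tr n x (g m x)))\<^sup>2) < e / 4"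
    by (auto dest: eventually_happens)
  define c where "c = (\<lambda>x. tr n x (g m x))"
  have ic: "sq_integrable c"
    by (rule sq_integrable_continuous_compact[of "cball 0 (real n + 2)"])
       (use trc[OF g(1)] tr0 in \<open>auto simp: c_def\<close>)
  have it: "sq_integrable (\<lambda>x. tr n x (f x))"
    by (rule sq_integrable_bound[OF f trm[OF mf], of _ 1])
       (use s01 in \<open>auto simp: tr_def mult_left_le_one_le\<close>)
  have "(LINT x|lborel. (norm (f x - c x))\<^sup>2) \<le>
     (LINT x|lborel. 2 * (norm (f x - tr n x (f x)))\<^sup>2 + 2 * (norm (tr n x (f x) - c x))\<^sup>2)"
  proof (rule integral_mono)
    show "integrable lborel (\<lambda>x. (norm (f x - c x))\<^sup>2)"
      using sq_integrable_diff[OF f ic] by (simp add: sq_integrable_def)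
    show "integrable lborel (\<lambda>x. 2 * (norm (f x - tr n x (f x)))\<^sup>2 + 2 * (norm (tr n x (f x) - c x))\<^sup>2)"
      using sq_integrable_diff[OF f it] sq_integrable_diff[OF it ic] by (simp add: sq_integrable_def)
    show "(norm (f x - c x))\<^sup>2 \<le> 2 * (norm (f x - tr n x (f x)))\<^sup>2 + 2 * (norm (tr n x (f x) - c x))\<^sup>2" for x
      using norm_add_sq_le[of "f x - tr n x (f x)" "tr n x (f x) - c x"] by simp
  qed
  also have "\<dots> = 2 * (LINT x|lborel. (norm (f x - tr n x (f x)))\<^sup>2) + 2 * (LINT x|lborel. (norm (tr n x (f x) - c x))\<^sup>2)"
    using sq_integrable_diff[OF f it] sq_integrable_diff[OF it ic] by (simp add: sq_integrable_def)
  also have "\<dots> < e" using n m by (simp add: c_def)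
  finally have "(LINT x|lborel. (norm (f x - c x))\<^sup>2) < e" .
  moreover have "continuous_on UNIV c" unfolding c_def by (rule trc[OF g(1)])
  ultimately show thesis using that[of c "real n + 2"] tr0 unfolding c_def by blast
qed

text \<open>For a continuous function with compact support this is uniform continuity; the remainder
  \<open>w\<close> of the approximation is as small after translation as before, by translation
  invariance.\<close>

lemma sq_integrable_translation_continuous:
  fixes g :: "'a::euclidean_space \<Rightarrow> complex"
  assumes g: "sq_integrable g" and e: "e > 0"
  obtains d where "d > 0" "\<And>z. norm z < d \<Longrightarrow> (LINT x|lborel. (norm (g (x - z) - g x))\<^sup>2) \<le> e"
proof -
  \<comment> \<open>The error \<open>e / 24\<close> enters eight times below, and the continuous
    part contributes at most \<open>e / 2\<close>, so the total stays below
    \<open>e\<close>.\<close>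
  obtain c R where c: "continuous_on UNIV c" "\<And>x. norm x \<ge> R \<Longrightarrow> c x = 0"
    "(LINT x|lborel. (norm (g x - c x))\<^sup>2) < e / 24"
    using sq_integrable_approx_continuous[OF g, of "e / 24"] e by auto
  define V where "V = measure lborel (cball (0::'a) (\<bar>R\<bar> + 1)) + 1"
  have V: "V > 0" unfolding V_def by (smt (verit) measure_nonneg)
  define \<delta> where "\<delta> = sqrt (e / (4 * V))"
  have \<delta>: "\<delta> > 0" "\<delta>\<^sup>2 = e / (4 * V)" using e V by (auto simp: \<delta>_def)
  have sc: "sq_integrable c"
    by (rule sq_integrable_continuous_compact[of "cball 0 R"]) (use c in auto)
  have "uniformly_continuous_on (cball 0 (\<bar>R\<bar> + 2)) c"
    by (rule compact_uniformly_continuous) (use c(1) continuous_on_subset in auto)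
  then obtain d where d: "d > 0"
      "\<And>x y. \<lbrakk>norm x \<le> \<bar>R\<bar> + 2; norm y \<le> \<bar>R\<bar> + 2; dist y x < d\<rbrakk> \<Longrightarrow> dist (c y) (c x) < \<delta>"
    unfolding uniformly_continuous_on_def using \<delta>(1) by (metis mem_cball_0)
  have "(LINT x|lborel. (norm (g (x - z) - g x))\<^sup>2) \<le> e" if z: "norm z < min d 1" for z
  proof -
    have tr: "sq_integrable (\<lambda>x. h (x - z))" if "sq_integrable h" for h
      using sq_integrable_affine[OF that, of 1 "- z"] by simp
    define w where "w = (\<lambda>x. g x - c x)"
    have sw: "sq_integrable w" unfolding w_def by (rule sq_integrable_diff[OF g sc])
    have iw: "(LINT x|lborel. (norm (w (x - z)))\<^sup>2) = (LINT x|lborel. (norm (w x))\<^sup>2)"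
      using lborel_integral_affine[of "\<lambda>x. (norm (w x))\<^sup>2" 1 "- z"] sw
      by (auto simp: sq_integrable_def)
    have cd: "(norm (c (x - z) - c x))\<^sup>2 \<le> indicator (cball 0 (\<bar>R\<bar> + 1)) x *\<^sub>R \<delta>\<^sup>2" for x
    proof (cases "norm x \<le> \<bar>R\<bar> + 1")
      case True
      then have "norm (x - z) \<le> \<bar>R\<bar> + 2" using z norm_triangle_ineq4[of x z] by simp
      then have "norm (c (x - z) - c x) \<le> \<delta>"
        using d(2)[of x "x - z"] True z by (simp add: dist_norm)
      then show ?thesis using True by (simp add: power_mono)
    next
      case False
      then have "norm (x - z) \<ge> R" "norm x \<ge> R" using z norm_triangle_ineq2[of x z] by auto
      then show ?thesis using c(2) by simp
    qed
    have ind: "integrable lborel (\<lambda>x::'a. indicator (cball 0 (\<bar>R\<bar> + 1)) x *\<^sub>R \<delta>\<^sup>2 :: real)"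
      by (rule borel_integrable_compact) auto
    have "(LINT x|lborel. (norm (g (x - z) - g x))\<^sup>2) \<le>
      (LINT x|lborel. 4 * (norm (w (x - z)))\<^sup>2 + 4 * (norm (w x))\<^sup>2 + 2 * (indicator (cball 0 (\<bar>R\<bar> + 1)) x *\<^sub>R \<delta>\<^sup>2))"
    proof (rule integral_mono)
      show "integrable lborel (\<lambda>x. (norm (g (x - z) - g x))\<^sup>2)"
        using sq_integrable_diff[OF tr[OF g] g] by (simp add: sq_integrable_def)
      show "integrable lborel (\<lambda>x. 4 * (norm (w (x - z)))\<^sup>2 + 4 * (norm (w x))\<^sup>2 + 2 * (indicator (cball 0 (\<bar>R\<bar> + 1)) x *\<^sub>R \<delta>\<^sup>2))"
        using tr[OF sw] sw ind by (auto simp: sq_integrable_def)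
      fix x
      have "g (x - z) - g x = (w (x - z) + (- w x)) + (c (x - z) - c x)" by (simp add: w_def)
      then have "(norm (g (x - z) - g x))\<^sup>2 \<le> 2 * (norm (w (x - z) + (- w x)))\<^sup>2 + 2 * (norm (c (x - z) - c x))\<^sup>2"
        using norm_add_sq_le by metis
      also have "\<dots> \<le> 2 * (2 * (norm (w (x - z)))\<^sup>2 + 2 * (norm (w x))\<^sup>2) + 2 * (indicator (cball 0 (\<bar>R\<bar> + 1)) x *\<^sub>R \<delta>\<^sup>2)"
        using norm_add_sq_le[of "w (x - z)" "- w x"] cd[of x] by simp
      finally show "(norm (g (x - z) - g x))\<^sup>2 \<le>
        4 * (norm (w (x - z)))\<^sup>2 + 4 * (norm (w x))\<^sup>2 + 2 * (indicator (cball 0 (\<bar>R\<bar> + 1)) x *\<^sub>R \<delta>\<^sup>2)"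
        by simp
    qed
    also have "\<dots> = 8 * (LINT x|lborel. (norm (w x))\<^sup>2) + 2 * (LINT x::'a|lborel. indicator (cball 0 (\<bar>R\<bar> + 1)) x *\<^sub>R \<delta>\<^sup>2)"
      using tr[OF sw] sw ind iw by (simp add: sq_integrable_def)
    also have "(LINT x::'a|lborel. indicator (cball 0 (\<bar>R\<bar> + 1)) x *\<^sub>R \<delta>\<^sup>2) = (V - 1) * \<delta>\<^sup>2"
      by (simp add: V_def)
    also have "(V - 1) * \<delta>\<^sup>2 \<le> e / 4" unfolding \<delta>(2) using V e by (simp add: field_simps)
    finally show ?thesis using c(3) e by (simp add: w_def)
  qed
  then show thesis using d(1) that[of "min d 1"] by auto
qed

text \<open>The weighted Young inequality with \<open>s * A = e / 2\<close> turns continuity of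
  translation into continuity of the correlation at 0; the 1 in \<open>A\<close> makes it
  positive.\<close>

lemma correlation_continuous:
  fixes f g :: "'a::euclidean_space \<Rightarrow> complex"
  assumes f: "sq_integrable f" and g: "sq_integrable g" and e: "e > 0"
  obtains d where "d > 0" "\<And>z. norm z < d \<Longrightarrow>
    norm ((LINT x|lborel. f x * g (x - z)) - (LINT x|lborel. f x * g x)) \<le> e"
proof -
  define A where "A = (LINT x|lborel. (norm (f x))\<^sup>2) + 1"
  have A: "A > 0" unfolding A_def by (smt (verit) integral_nonneg_AE AE_I2 zero_le_power2)
  define s where "s = e / (2 * A)"
  have s: "s > 0" using e A by (simp add: s_def)
  obtain d where d: "d > 0" "\<And>z. norm z < d \<Longrightarrow> (LINT x|lborel. (norm (g (x - z) - g x))\<^sup>2) \<le> s * e / 2"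
    using sq_integrable_translation_continuous[OF g, of "s * e / 2"] e s by auto
  have "norm ((LINT x|lborel. f x * g (x - z)) - (LINT x|lborel. f x * g x)) \<le> e" if z: "norm z < d" for z
  proof -
    have tr: "sq_integrable (\<lambda>x. g (x - z))"
      using sq_integrable_affine[OF g, of 1 "- z"] by simp
    have sd: "sq_integrable (\<lambda>x. g (x - z) - g x)" by (rule sq_integrable_diff[OF tr g])
    have "(LINT x|lborel. f x * g (x - z)) - (LINT x|lborel. f x * g x) =
       (LINT x|lborel. f x * (g (x - z) - g x))"
      using sq_integrable_mult[OF f tr] sq_integrable_mult[OF f g] by (simp add: algebra_simps)
    also have "norm \<dots> \<le> (LINT x|lborel. s * (norm (f x))\<^sup>2 + (norm (g (x - z) - g x))\<^sup>2 / s)"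
    proof (rule Bochner_Integration.integral_norm_bound_integral)
      show "integrable lborel (\<lambda>x. f x * (g (x - z) - g x))" by (rule sq_integrable_mult[OF f sd])
      show "integrable lborel (\<lambda>x. s * (norm (f x))\<^sup>2 + (norm (g (x - z) - g x))\<^sup>2 / s)"
        using f sd by (simp add: sq_integrable_def)
      show "norm (f x * (g (x - z) - g x)) \<le> s * (norm (f x))\<^sup>2 + (norm (g (x - z) - g x))\<^sup>2 / s" for x
        unfolding norm_mult by (rule mult_le_weighted_squares[OF s])
    qed
    also have "\<dots> = s * (A - 1) + (LINT x|lborel. (norm (g (x - z) - g x))\<^sup>2) / s"
      using f sd by (simp add: sq_integrable_def A_def)
    also have "\<dots> \<le> e / 2 + (s * e / 2) / s"
      using d(2)[OF z] s A e by (intro add_mono divide_right_mono) (auto simp: s_def field_simps)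
    also have "\<dots> = e" using s by simp
    finally show ?thesis .
  qed
  then show thesis using d(1) that by blast
qed

text \<open>By Fubini the pairing of \<open>f\<close> with the mollified \<open>g\<close> is the
  average of the correlation \<open>\<Theta>\<close> against the probability density
  \<open>b\<close>, and \<open>\<Theta>\<close> is continuous at 0. The radius \<open>d\<close> is
  chosen before \<open>b\<close>, as a sequence of kernels requires.\<close>

lemma conv_limit:
  fixes f g :: "real^2 \<Rightarrow> complex"
  assumes f: "sq_integrable f" and g: "sq_integrable g" and e: "e > 0"
  obtains d where "d > 0" "\<And>b. \<lbrakk>continuous_on UNIV b; \<And>x. b x \<ge> 0; \<And>x. norm x \<ge> d \<Longrightarrow> b x = 0;
      (LINT x|lborel. b x) = 1\<rbrakk> \<Longrightarrow>
     norm ((LINT x|lborel. f x * conv g (\<lambda>x. complex_of_real (b x)) x) - (LINT x|lborel. f x * g x)) \<le> e"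
proof -
  obtain d where d: "d > 0" "\<And>z. norm z < d \<Longrightarrow>
    norm ((LINT x|lborel. f x * g (x - z)) - (LINT x|lborel. f x * g x)) \<le> e"
    using correlation_continuous[OF f g e] by blast
  have mf [measurable]: "f \<in> borel_measurable borel" and mg [measurable]: "g \<in> borel_measurable borel"
    using f g by (auto simp: sq_integrable_def)
  have "norm ((LINT x|lborel. f x * conv g (\<lambda>x. complex_of_real (b x)) x) - (LINT x|lborel. f x * g x)) \<le> e"
    if cb: "continuous_on UNIV b" and b0: "\<And>x. b x \<ge> 0" and bs: "\<And>x. norm x \<ge> d \<Longrightarrow> b x = 0"
      and b1: "(LINT x|lborel. b x) = 1" for b
  proof -
    have mb [measurable]: "b \<in> borel_measurable borel" using cb by (rule borel_measurable_continuous_onI)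
    have ib: "integrable lborel b" using b1 not_integrable_integral_eq by fastforce
    define \<Theta> where "\<Theta> = (\<lambda>z. LINT x|lborel. f x * g (x - z))"
    define H where "H = (\<lambda>z x. complex_of_real (b z) * (f x * g (x - z)))"
    have tr: "sq_integrable (\<lambda>x. g (x - z))" for z
      using sq_integrable_affine[OF g, of 1 "- z"] by simp
    have iz: "(LINT x|lborel. (norm (g (x - z)))\<^sup>2) = (LINT x|lborel. (norm (g x))\<^sup>2)" for z
      using lborel_integral_affine[of "\<lambda>x. (norm (g x))\<^sup>2" 1 "- z"] by simp
    define C where "C = (LINT x|lborel. (norm (f x))\<^sup>2) + (LINT x|lborel. (norm (g x))\<^sup>2)"
    have iH: "integrable lborel (H z)" for z
      unfolding H_def using sq_integrable_mult[OF f tr] by simp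
    have mH [measurable]: "case_prod H \<in> borel_measurable (lborel \<Otimes>\<^sub>M lborel)"
      unfolding H_def by measurable
    have bound: "(LINT x|lborel. norm (H z x)) \<le> C * b z" for z
    proof -
      have "(LINT x|lborel. norm (H z x)) \<le> (LINT x|lborel. b z * ((norm (f x))\<^sup>2 + (norm (g (x - z)))\<^sup>2))"
      proof (rule integral_mono)
        show "integrable lborel (\<lambda>x. norm (H z x))" using iH by simp
        show "integrable lborel (\<lambda>x. b z * ((norm (f x))\<^sup>2 + (norm (g (x - z)))\<^sup>2))"
          using f tr[of z] by (simp add: sq_integrable_def)
        show "norm (H z x) \<le> b z * ((norm (f x))\<^sup>2 + (norm (g (x - z)))\<^sup>2)" for x
          unfolding H_def norm_mult using mult_le_weighted_squares[of 1 "norm (f x)" "norm (g (x - z))"] b0[of z]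
          by (auto intro!: mult_left_mono)
      qed
      also have "\<dots> = C * b z"
        using f tr[of z] iz[of z] by (simp add: sq_integrable_def C_def)
      finally show ?thesis .
    qed
    \<comment> \<open>Fubini is justified by \<open>bound\<close>: the inner integral of the norm is
      at most \<open>C * b z\<close>, where translation invariance makes \<open>C\<close>
      independent of \<open>z\<close>.\<close>
    have int: "integrable (lborel \<Otimes>\<^sub>M lborel) (case_prod H)"
    proof (rule lborel_pair.Fubini_integrable[OF mH])
      show "AE z in lborel. integrable lborel (\<lambda>x. case_prod H (z, x))" using iH by simp
      show "integrable lborel (\<lambda>z. LINT x|lborel. norm (case_prod H (z, x)))"
      proof (rule Bochner_Integration.integrable_bound)
        show "integrable lborel (\<lambda>z. C * b z)" using ib by simp
        show "(\<lambda>z. LINT x|lborel. norm (case_prod H (z, x))) \<in> borel_measurable lborel"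
          by measurable
        have "0 \<le> (LINT x|lborel. norm (H z x))" for z by simp
        then show "AE z in lborel. norm (LINT x|lborel. norm (case_prod H (z, x))) \<le> norm (C * b z)"
          using bound by (intro AE_I2) (simp add: order_trans[OF _ abs_ge_self])
      qed
    qed
    have "(LINT x|lborel. f x * conv g (\<lambda>x. complex_of_real (b x)) x) = (LINT x|lborel. LINT z|lborel. H z x)"
    proof (rule Bochner_Integration.integral_cong[OF refl])
      fix x
      have "conv g (\<lambda>x. complex_of_real (b x)) x = (LINT z|lborel. g (x - z) * complex_of_real (b z))"
        unfolding conv_def
        using lborel_integral_reflect[of "\<lambda>y. g y * complex_of_real (b (x - y))" x] by simp
      then show "f x * conv g (\<lambda>x. complex_of_real (b x)) x = (LINT z|lborel. H z x)"
        unfolding H_def by (simp flip: integral_mult_right_zero add: mult_ac)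
    qed
    also have "\<dots> = (LINT z|lborel. LINT x|lborel. H z x)"
      by (rule lborel_pair.Fubini_integral[OF int])
    also have "\<dots> = (LINT z|lborel. b z * \<Theta> z)"
      unfolding H_def \<Theta>_def by simp
    finally have 1: "(LINT x|lborel. f x * conv g (\<lambda>x. complex_of_real (b x)) x) = (LINT z|lborel. b z * \<Theta> z)" .
    have i\<Theta>: "integrable lborel (\<lambda>z. b z * \<Theta> z)"
      using lborel_pair.integrable_fst'[OF int] unfolding H_def \<Theta>_def by simp
    have "(LINT z|lborel. b z * \<Theta> z) - \<Theta> 0 = (LINT z|lborel. b z * (\<Theta> z - \<Theta> 0))"
    proof -
      have "(LINT z|lborel. complex_of_real (b z) * \<Theta> 0) = \<Theta> 0"
        using b1 by simp
      moreover have "integrable lborel (\<lambda>z. complex_of_real (b z) * \<Theta> 0)" using ib by simp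
      ultimately show ?thesis using i\<Theta> by (simp add: right_diff_distrib)
    qed
    also have "norm \<dots> \<le> (LINT z|lborel. b z * e)"
    proof (rule Bochner_Integration.integral_norm_bound_integral)
      have "integrable lborel (\<lambda>z. complex_of_real (b z) * \<Theta> 0)" using ib by simp
      then show "integrable lborel (\<lambda>z. complex_of_real (b z) * (\<Theta> z - \<Theta> 0))"
        using i\<Theta> by (simp add: right_diff_distrib)
      show "integrable lborel (\<lambda>z. b z * e)" using ib by simp
      show "norm (complex_of_real (b z) * (\<Theta> z - \<Theta> 0)) \<le> b z * e" for z
        using d(2)[of z] b0[of z] bs[of z] by (cases "norm z < d") (auto simp: norm_mult \<Theta>_def intro!: mult_left_mono)
    qed
    also have "\<dots> = e" using b1 by simp
    finally show ?thesis unfolding 1 by (simp add: \<Theta>_def)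
  qed
  then show thesis using d(1) that by blast
qed

section \<open>Polar coordinates\<close>

definition polar :: "real \<Rightarrow> real \<Rightarrow> real^2" where
  "polar r t = r *\<^sub>R vector [cos t, sin t]"

lemma polar_nth [simp]: "polar r t $ 1 = r * cos t" "polar r t $ 2 = r * sin t"
  by (simp_all add: polar_def)

lemma norm_polar [simp]: "norm (polar r t) = \<bar>r\<bar>"
proof -
  have "(norm (polar r t))\<^sup>2 = (r * cos t)\<^sup>2 + (r * sin t)\<^sup>2"
    unfolding power2_norm_eq_inner by (simp add: inner_vec_def sum_2 power2_eq_square)
  also have "\<dots> = \<bar>r\<bar>\<^sup>2" by (simp add: power_mult_distrib flip: distrib_left)
  finally have "(norm (polar r t))\<^sup>2 = \<bar>r\<bar>\<^sup>2" .
  then show ?thesis by (rule power2_eq_imp_eq) auto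
qed

lemma polar_eq: "polar r t = (r * cos t) *\<^sub>R axis 1 1 + (r * sin t) *\<^sub>R axis 2 1"
  by (simp add: vec_eq_iff forall_2 axis_def)

lemma continuous_on_polar [continuous_intros]:
  fixes T :: "'a::t2_space set"
  shows "continuous_on T f \<Longrightarrow> continuous_on T g \<Longrightarrow> continuous_on T (\<lambda>x. polar (f x) (g x))"
  unfolding polar_eq by (intro continuous_intros)

lemma polar_surj:
  obtains t where "0 \<le> t" "t < 2 * pi" "x = polar (norm x) t"
proof (cases "x = 0")
  case True
  then show thesis using that[of 0] by (simp add: polar_def)
next
  case False
  have "(x $ 1)\<^sup>2 + (x $ 2)\<^sup>2 = (norm x)\<^sup>2"
    unfolding power2_norm_eq_inner by (simp add: inner_vec_def sum_2 power2_eq_square)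
  then have "(x $ 1 / norm x)\<^sup>2 + (x $ 2 / norm x)\<^sup>2 = 1"
    using False by (simp add: power_divide flip: add_divide_distrib)
  then obtain t where t: "0 \<le> t" "t < 2 * pi" "x $ 1 / norm x = cos t" "x $ 2 / norm x = sin t"
    using sincos_total_2pi by metis
  then have "x = polar (norm x) t"
    using False by (simp add: vec_eq_iff forall_2 flip: t(3,4))
  then show thesis using that t by blast
qed

text \<open>Fields live on \<open>real^2\<close>, iterated integrals on pairs. The identification
  preserves Lebesgue measure because it does so on boxes.\<close>

lemma lborel_vector_2:
  "distr (lborel :: (real \<times> real) measure) borel (\<lambda>p. vector [fst p, snd p]) = (lborel :: (real^2) measure)"
proof (rule lborel_eqI[symmetric])
  have eq: "vector [fst p, snd p] = fst p *\<^sub>R axis 1 1 + snd p *\<^sub>R (axis 2 1 :: real^2)" for p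
    by (simp add: vec_eq_iff forall_2 axis_def)
  have m: "(\<lambda>p. vector [fst p, snd p] :: real^2) \<in> borel_measurable (lborel :: (real \<times> real) measure)"
    unfolding eq by (simp add: borel_measurable_continuous_onI continuous_intros)
  fix l u :: "real^2" assume lu: "\<And>b. b \<in> Basis \<Longrightarrow> l \<bullet> b \<le> u \<bullet> b"
  have B: "Basis = {axis 1 1, axis 2 1 :: real^2}"
    by (auto simp: Basis_vec_def) (metis exhaust_2)
  have n: "axis 1 1 \<noteq> (axis 2 1 :: real^2)" by (simp add: axis_eq_axis)
  have le: "l $ 1 \<le> u $ 1" "l $ 2 \<le> u $ 2"
    using lu[of "axis 1 1"] lu[of "axis 2 1"] B by (auto simp: inner_axis)
  have pre: "(\<lambda>p. vector [fst p, snd p]) -` box l u \<inter> space (lborel :: (real \<times> real) measure) =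
      {l $ 1<..<u $ 1} \<times> {l $ 2<..<u $ 2}"
    by (auto simp: mem_box B inner_axis)
  have "emeasure (distr (lborel :: (real \<times> real) measure) borel (\<lambda>p. vector [fst p, snd p])) (box l u)
     = emeasure (lborel \<Otimes>\<^sub>M lborel) ({l $ 1<..<u $ 1} \<times> {l $ 2<..<u $ 2})"
    unfolding lborel_prod pre[symmetric] by (rule emeasure_distr[OF m]) simp
  also have "\<dots> = ennreal (u $ 1 - l $ 1) * ennreal (u $ 2 - l $ 2)"
    using le by (subst lborel.emeasure_pair_measure_Times) auto
  also have "\<dots> = (\<Prod>b\<in>Basis. (u - l) \<bullet> b)"
    using le n by (simp add: B inner_axis ennreal_mult')
  finally show "emeasure (distr (lborel :: (real \<times> real) measure) borel (\<lambda>p. vector [fst p, snd p])) (box l u) = (\<Prod>b\<in>Basis. (u - l) \<bullet> b)" .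
qed simp

lemma polar_map_has_derivative:
  "((\<lambda>x::real^2. polar (x $ 1) (x $ 2)) has_derivative (\<lambda>h.
     (h $ 1 * cos (x $ 2) - x $ 1 * sin (x $ 2) * h $ 2) *\<^sub>R axis 1 1 +
     (h $ 1 * sin (x $ 2) + x $ 1 * cos (x $ 2) * h $ 2) *\<^sub>R axis 2 1)) (at x within T)"
proof -
  have nth: "((\<lambda>x::real^2. x $ i) has_derivative (\<lambda>h. h $ i)) (at x within T)" for i
    by (rule bounded_linear_imp_has_derivative) (rule bounded_linear_vec_nth)
  show ?thesis
    unfolding polar_eq
    by (auto intro!: derivative_eq_intros nth simp: algebra_simps)
qed

text \<open>The parameter set is open, so that an open box fits into it; the missing ray of angle 0
  is negligible.\<close>

lemma inj_on_polar_map: "inj_on (\<lambda>x::real^2. polar (x $ 1) (x $ 2)) {x. 0 < x $ 1 \<and> 0 < x $ 2 \<and> x $ 2 < 2 * pi}"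
proof (rule inj_onI, clarify)
  fix x y :: "real^2"
  assume x: "0 < x $ 1" "0 < x $ 2" "x $ 2 < 2 * pi" and y: "0 < y $ 1" "0 < y $ 2" "y $ 2 < 2 * pi"
    and e: "polar (x $ 1) (x $ 2) = polar (y $ 1) (y $ 2)"
  have 1: "x $ 1 = y $ 1" using arg_cong[OF e, of norm] x y by simp
  have "sin (x $ 2) = sin (y $ 2) \<and> cos (x $ 2) = cos (y $ 2)"
    using e 1 x(1) by (simp add: vec_eq_iff forall_2)
  then obtain n :: int where n: "x $ 2 = y $ 2 + 2 * pi * n" using sin_cos_eq_iff by metis
  have "\<bar>2 * pi * n\<bar> < 2 * pi * 1" using n x y by linarith
  then have "\<bar>real_of_int n\<bar> < 1" by (simp add: abs_mult)
  then have "n = 0" by linarith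
  then show "x = y" using 1 n by (simp add: vec_eq_iff forall_2)
qed

text \<open>Change of variables on a box of radii and angles. The theorem behind it concerns maps
  into a vector type, so \<open>G\<close> is carried by the real field \<open>F\<close> and
  recovered through the linear \<open>L\<close>. As \<open>G\<close> vanishes up to
  \<open>r1 > 0\<close>, the box avoids the origin, and the Jacobian there is the positive number
  \<open>r\<close>.\<close>

lemma polar_integral:
  fixes G :: "real^2 \<Rightarrow> complex"
  assumes G: "continuous_on UNIV G" and r: "0 < r1" "r1 \<le> r2"
    and G0: "\<And>x. norm x \<le> r1 \<Longrightarrow> G x = 0" "\<And>x. norm x \<ge> r2 \<Longrightarrow> G x = 0"
  shows "(LINT x|lborel. G x) = integral {r1..r2} (\<lambda>r. integral {0..2*pi} (\<lambda>t. of_real r * G (polar r t)))"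
proof -
  define F where "F = (\<lambda>x. vector [Re (G x), Im (G x)] :: real^2)"
  define L where "L = (\<lambda>v::real^2. Complex (v $ 1) (v $ 2))"
  have L: "bounded_linear L"
  proof -
    have "L = (\<lambda>v. complex_of_real (v $ 1) + \<i> * complex_of_real (v $ 2))" unfolding L_def by (simp add: Complex_eq)
    then show ?thesis
      by (auto intro!: bounded_linear_intros bounded_linear_compose[OF bounded_linear_of_real] bounded_linear_vec_nth
         bounded_linear_compose[OF bounded_linear_mult_right])
  qed
  have LF: "L \<circ> F = G" unfolding L_def F_def by (simp add: fun_eq_iff)
  have cF: "continuous_on T F" for T
  proof -
    have "F = (\<lambda>x. Re (G x) *\<^sub>R axis 1 1 + Im (G x) *\<^sub>R axis 2 1)"
      unfolding F_def by (simp add: vec_eq_iff forall_2 axis_def fun_eq_iff)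
    then show ?thesis
      using continuous_on_subset[OF G subset_UNIV[of T]] by (auto intro!: continuous_intros)
  qed
  have F0: "norm x \<le> r1 \<or> norm x \<ge> r2 \<Longrightarrow> F x = 0" for x
    using G0[of x] by (auto simp: F_def vec_eq_iff forall_2)
  define g where "g = (\<lambda>x::real^2. polar (x $ 1) (x $ 2))"
  define g' where "g' = (\<lambda>(x::real^2) (h::real^2).
     (h $ 1 * cos (x $ 2) - x $ 1 * sin (x $ 2) * h $ 2) *\<^sub>R axis 1 1 +
     (h $ 1 * sin (x $ 2) + x $ 1 * cos (x $ 2) * h $ 2) *\<^sub>R (axis 2 1 :: real^2))"
  have dg: "(g has_derivative g' x) (at x within T)" for x :: "real^2" and T
    unfolding g_def g'_def by (rule polar_map_has_derivative)
  have cg: "continuous_on T g" for T :: "(real^2) set"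
    using dg has_derivative_continuous_on by blast
  define lo hi where "lo = (vector [r1, 0] :: real^2)" and "hi = (vector [r2, 2 * pi] :: real^2)"
  have mem: "x \<in> box lo hi \<longleftrightarrow> r1 < x $ 1 \<and> x $ 1 < r2 \<and> 0 < x $ 2 \<and> x $ 2 < 2 * pi"
       "x \<in> cbox lo hi \<longleftrightarrow> r1 \<le> x $ 1 \<and> x $ 1 \<le> r2 \<and> 0 \<le> x $ 2 \<and> x $ 2 \<le> 2 * pi" for x
    by (auto simp: lo_def hi_def mem_box_cart forall_2)
  have det: "\<bar>det (matrix (g' x))\<bar> = x $ 1" if "x \<in> box lo hi" for x
  proof -
    have "det (matrix (g' x)) = x $ 1 * (cos (x $ 2) * cos (x $ 2)) + x $ 1 * (sin (x $ 2) * sin (x $ 2))"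
      unfolding det_2 matrix_def g'_def by (simp add: axis_def)
    also have "\<dots> = x $ 1 * ((cos (x $ 2))\<^sup>2 + (sin (x $ 2))\<^sup>2)"
      by (simp only: power2_eq_square distrib_left)
    finally show ?thesis using that r mem(1) by simp
  qed
  define Q where "Q = (\<lambda>x::real^2. x $ 1 *\<^sub>R F (g x))"
  have cQ: "continuous_on T Q" for T
    unfolding Q_def by (intro continuous_intros continuous_on_compose2[OF cF[of UNIV] cg]) auto
  have Qint: "(\<lambda>x. \<bar>det (matrix (g' x))\<bar> *\<^sub>R F (g x)) absolutely_integrable_on box lo hi"
  proof -
    have "Q absolutely_integrable_on cbox lo hi"
      by (rule absolutely_integrable_continuous[OF cQ])
    then have "Q absolutely_integrable_on box lo hi"
      by (rule set_integrable_subset) (auto intro: box_subset_cbox[THEN subsetD])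
    then show ?thesis
      by (rule absolutely_integrable_spike[OF _ negligible_empty]) (simp add: Q_def det)
  qed
  have inj: "inj_on g (box lo hi)"
    unfolding g_def by (rule inj_on_subset[OF inj_on_polar_map]) (use mem(1) r in auto)
  have cov: "integral (g ` box lo hi) F = integral (box lo hi) Q"
  proof -
    have "integral (g ` box lo hi) F = integral (box lo hi) (\<lambda>x. \<bar>det (matrix (g' x))\<bar> *\<^sub>R F (g x))"
      by (rule integral_change_of_variables[OF _ dg inj]) (use Qint in auto)
    also have "\<dots> = integral (box lo hi) Q"
      by (rule integral_cong) (simp add: Q_def det)
    finally show ?thesis .
  qed
  have iG: "integrable lborel G"
    by (rule integrable_continuous_compact[OF compact_cball[of 0 r2] continuous_on_subset[OF G]])
       (use G0(2) in auto)
  have iF: "integrable lborel F"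
    by (rule integrable_continuous_compact[of "cball 0 r2"]) (use cF F0 in auto)
  have img: "integral (g ` box lo hi) F = integral UNIV F"
  proof (rule integral_spike_set)
    show "negligible {x \<in> g ` box lo hi - UNIV. F x \<noteq> 0}" by simp
    \<comment> \<open>A point with \<open>F x \<noteq> 0\<close> that the open parameter box misses
      has angle 0, hence lies on the horizontal axis.\<close>
    have "{x \<in> UNIV - g ` box lo hi. F x \<noteq> 0} \<subseteq> {x. x $ 2 = 0}"
    proof clarify
      fix x assume x: "x \<notin> g ` box lo hi" "F x \<noteq> 0"
      obtain t where t: "0 \<le> t" "t < 2 * pi" "x = polar (norm x) t" using polar_surj .
      have "r1 < norm x" "norm x < r2" using F0[of x] x(2) by force+
      then have "\<not> 0 < t" using t x(1) mem(1)[of "vector [norm x, t]"]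
        by (metis g_def image_eqI vector_2)
      then have "t = 0" using t(1) by simp
      then have "x $ 2 = polar (norm x) 0 $ 2" using t(3) by simp
      then show "x $ 2 = 0" by simp
    qed
    then show "negligible {x \<in> UNIV - g ` box lo hi. F x \<noteq> 0}"
      using negligible_standard_hyperplane_cart negligible_subset by blast
  qed
  have "(LINT x|lborel. G x) = integral UNIV G" using iG by (simp add: integral_lborel)
  also have "\<dots> = L (integral UNIV F)"
    unfolding LF[symmetric] by (rule integral_linear[OF integrable_on_lborel[OF iF] L])
  also have "integral UNIV F = integral (cbox lo hi) Q"
    unfolding img[symmetric] cov by (simp add: integral_open_interval)
  also have "L (integral (cbox lo hi) Q) = integral (cbox lo hi) (L \<circ> Q)"
    by (rule integral_linear[symmetric, OF integrable_continuous[OF cQ] L])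
  also have "\<dots> = (LINT x|lborel. indicator (cbox lo hi) x *\<^sub>R (L \<circ> Q) x)"
  proof -
    have c: "continuous_on (cbox lo hi) (L \<circ> Q)"
      unfolding o_def using bounded_linear.continuous_on[OF L cQ] .
    have "set_integrable lborel (cbox lo hi) (L \<circ> Q)"
      unfolding set_integrable_def by (rule borel_integrable_compact[OF compact_cbox c])
    then have "integral (cbox lo hi) (L \<circ> Q) = (LINT x:cbox lo hi|lborel. (L \<circ> Q) x)"
      by (rule set_borel_integral_eq_integral(2)[symmetric])
    then show ?thesis by (simp add: set_lebesgue_integral_def)
  qed
  also have "\<dots> = (LINT p|(lborel::(real\<times>real) measure). indicator (cbox lo hi) (vector [fst p, snd p]) *\<^sub>R (L \<circ> Q) (vector [fst p, snd p]))"
  proof -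
    have eq: "vector [fst p, snd p] = fst p *\<^sub>R axis 1 1 + snd p *\<^sub>R (axis 2 1 :: real^2)" for p
      by (simp add: vec_eq_iff forall_2 axis_def)
    have m: "(\<lambda>p. vector [fst p, snd p] :: real^2) \<in> borel_measurable (lborel :: (real \<times> real) measure)"
      unfolding eq by (simp add: borel_measurable_continuous_onI continuous_intros)
    have "continuous_on UNIV (L \<circ> Q)"
      unfolding o_def using bounded_linear.continuous_on[OF L cQ] .
    then have [measurable]: "L \<circ> Q \<in> borel_measurable borel" by (rule borel_measurable_continuous_onI)
    have "(\<lambda>x. indicator (cbox lo hi) x *\<^sub>R (L \<circ> Q) x) \<in> borel_measurable borel" by measurable
    then show ?thesis
      unfolding lborel_vector_2[symmetric] using integral_distr[OF m] by blast
  qed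
  also have "\<dots> = (LINT p|(lborel::(real\<times>real) measure). indicator (cbox (r1, 0) (r2, 2 * pi)) p *\<^sub>R (of_real (fst p) * G (polar (fst p) (snd p))))"
  proof (rule Bochner_Integration.integral_cong[OF refl])
    fix p :: "real \<times> real"
    have "L (Q (vector [fst p, snd p])) = of_real (fst p) * G (polar (fst p) (snd p))"
      using fun_cong[OF LF, of "polar (fst p) (snd p)"] linear_scale[OF bounded_linear.linear[OF L]]
      by (simp add: Q_def g_def scaleR_conv_of_real)
    moreover have "vector [fst p, snd p] \<in> cbox lo hi \<longleftrightarrow> p \<in> cbox (r1, 0) (r2, 2 * pi)"
      by (cases p) (auto simp: mem(2) cbox_Pair_eq)
    ultimately show "indicator (cbox lo hi) (vector [fst p, snd p]) *\<^sub>R (L \<circ> Q) (vector [fst p, snd p]) =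
        indicator (cbox (r1, 0) (r2, 2 * pi)) p *\<^sub>R (of_real (fst p) * G (polar (fst p) (snd p)))"
      by (simp add: indicator_def)
  qed
  also have "\<dots> = integral (cbox (r1, 0) (r2, 2 * pi)) (\<lambda>p. of_real (fst p) * G (polar (fst p) (snd p)))"
  proof -
    have "continuous_on (cbox (r1, 0) (r2, 2 * pi)) (\<lambda>p. of_real (fst p) * G (polar (fst p) (snd p)))"
      by (intro continuous_intros continuous_on_compose2[OF G]) auto
    then have "set_integrable lborel (cbox (r1, 0) (r2, 2 * pi)) (\<lambda>p. of_real (fst p) * G (polar (fst p) (snd p)))"
      unfolding set_integrable_def by (rule borel_integrable_compact[OF compact_cbox])
    then show ?thesis
      using set_borel_integral_eq_integral(2) by (simp add: set_lebesgue_integral_def)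
  qed
  also have "\<dots> = integral (cbox r1 r2) (\<lambda>r. integral (cbox 0 (2 * pi)) (\<lambda>t. of_real r * G (polar r t)))"
    by (subst integral_prod_continuous)
       (auto intro!: continuous_intros continuous_on_compose2[OF G])
  finally show ?thesis by simp
qed

section \<open>Radial and angular derivatives, pairings on circles\<close>

definition radial :: "(real^2 \<Rightarrow> complex) \<Rightarrow> real \<Rightarrow> real \<Rightarrow> complex" where
  "radial f r t = of_real (cos t) * pd 1 f (polar r t) + of_real (sin t) * pd 2 f (polar r t)"

text \<open>The derivative in the angle itself, not in arc length: the product of the gradients of
  \<open>f\<close> and \<open>g\<close> is
  \<open>radial f * radial g + angular f * angular g / r ^ 2\<close>, whence the divisions by
  \<open>r\<close> below.\<close>

definition angular :: "(real^2 \<Rightarrow> complex) \<Rightarrow> real \<Rightarrow> real \<Rightarrow> complex" where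
  "angular f r t = of_real (r * cos t) * pd 2 f (polar r t) - of_real (r * sin t) * pd 1 f (polar r t)"

lemma radial_has_vector_derivative:
  assumes "f differentiable (at (polar r t))"
  shows "((\<lambda>r. f (polar r t)) has_vector_derivative radial f r t) (at r within T)"
proof -
  have 1: "((\<lambda>r. polar r t) has_derivative (\<lambda>h. h *\<^sub>R polar 1 t)) (at r within T)"
    unfolding polar_def by (auto intro!: derivative_eq_intros)
  have "((\<lambda>r. f (polar r t)) has_derivative (\<lambda>h. \<Sum>i\<in>UNIV. (h *\<^sub>R polar 1 t) $ i *\<^sub>R pd i f (polar r t))) (at r within T)"
    by (rule has_derivative_compose[OF 1 has_derivative_pd[OF assms]])
  then show ?thesis unfolding has_vector_derivative_def radial_def
    by (simp add: sum_2 scaleR_conv_of_real[where 'a = complex] algebra_simps)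
qed

lemma angular_has_vector_derivative:
  assumes "f differentiable (at (polar r t))"
  shows "((\<lambda>t. f (polar r t)) has_vector_derivative angular f r t) (at t within T)"
proof -
  have 1: "((\<lambda>t. polar r t) has_derivative (\<lambda>h. h *\<^sub>R ((r * cos t) *\<^sub>R axis 2 1 - (r * sin t) *\<^sub>R axis 1 1))) (at t within T)"
    unfolding polar_eq by (auto intro!: derivative_eq_intros simp: algebra_simps)
  have "((\<lambda>t. f (polar r t)) has_derivative (\<lambda>h. \<Sum>i\<in>UNIV. (h *\<^sub>R ((r * cos t) *\<^sub>R axis 2 1 - (r * sin t) *\<^sub>R axis 1 1)) $ i *\<^sub>R pd i f (polar r t))) (at t within T)"
    by (rule has_derivative_compose[OF 1 has_derivative_pd[OF assms]])
  then show ?thesis unfolding has_vector_derivative_def angular_def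
    by (simp add: sum_2 axis_def scaleR_conv_of_real[where 'a = complex] algebra_simps)
qed

text \<open>The boundary term of Green's identity, \<open>f\<close> times the normal derivative of
  \<open>g\<close> over the circle of radius \<open>r\<close>; the factor \<open>r\<close> turns the
  angle into arc length.\<close>

definition pairing :: "(real^2 \<Rightarrow> complex) \<Rightarrow> (real^2 \<Rightarrow> complex) \<Rightarrow> real \<Rightarrow> complex" where
  "pairing f g r = integral {0..2*pi} (\<lambda>t. of_real r * (f (polar r t) * radial g r t))"

text \<open>Two instances are used: the complement of \<open>closure D\<close> with a radius
  \<open>\<rho>\<close> enclosing the closure, and the whole plane with \<open>\<rho> = 0\<close>
  for plane waves alone. Since \<open>\<rho> \<ge> 0\<close>, radii beyond \<open>\<rho>\<close> are
  positive.\<close>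

locale exterior =
  fixes \<rho> :: real and S :: "(real^2) set"
  assumes rho: "\<rho> \<ge> 0" and openS: "open S" and ext: "\<And>x. norm x > \<rho> \<Longrightarrow> x \<in> S"
begin

lemma polar_mem: "r > \<rho> \<Longrightarrow> polar r t \<in> S"
  using rho ext by simp

lemma continuous_on_polar_comp:
  fixes h :: "real^2 \<Rightarrow> complex"
  assumes "continuous_on S h"
  shows "continuous_on ({\<rho><..} \<times> T) (\<lambda>(r, t). h (polar r t))"
  unfolding split_beta
  by (rule continuous_on_compose2[OF assms]) (auto intro!: continuous_intros simp: polar_mem)

lemma continuous_on_radial:
  assumes "Ck_on 1 S f"
  shows "continuous_on ({\<rho><..} \<times> T) (\<lambda>(r, t). radial f r t)"
  using continuous_on_polar_comp[of "pd 1 f" T] continuous_on_polar_comp[of "pd 2 f" T] assms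
  unfolding radial_def split_beta by (auto intro!: continuous_intros)

lemma continuous_on_angular:
  assumes "Ck_on 1 S f"
  shows "continuous_on ({\<rho><..} \<times> T) (\<lambda>(r, t). angular f r t)"
  using continuous_on_polar_comp[of "pd 1 f" T] continuous_on_polar_comp[of "pd 2 f" T] assms
  unfolding angular_def split_beta by (auto intro!: continuous_intros)

lemma continuous_on_slice:
  assumes "continuous_on ({\<rho><..} \<times> T) (\<lambda>(r, t). h r t)" "r > \<rho>"
  shows "continuous_on T (h r)"
proof -
  have "continuous_on T (\<lambda>t. (r, t))" by (intro continuous_intros)
  then show ?thesis using continuous_on_compose2[OF assms(1), of T "\<lambda>t. (r, t)"] assms(2) by auto
qed

lemma circle_mean_has_derivative:
  assumes h: "Ck_on 1 S h" and r: "r > \<rho>"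
  shows "((\<lambda>r. integral {0..2*pi} (\<lambda>t. h (polar r t))) has_vector_derivative
    integral {0..2*pi} (radial h r)) (at r)"
proof -
  have "((\<lambda>r. integral (cbox 0 (2*pi)) (\<lambda>t. h (polar r t))) has_vector_derivative
      integral (cbox 0 (2*pi)) (radial h r)) (at r within {\<rho><..})"
  proof (rule leibniz_rule_vector_derivative)
    fix r t assume "r \<in> {\<rho><..}"
    then show "((\<lambda>r. h (polar r t)) has_vector_derivative radial h r t) (at r within {\<rho><..})"
      using h polar_mem by (intro radial_has_vector_derivative) auto
  next
    fix r assume "r \<in> {\<rho><..}"
    then show "(\<lambda>t. h (polar r t)) integrable_on cbox 0 (2*pi)"
      using continuous_on_slice[OF continuous_on_polar_comp[OF Ck_on_imp_continuous_on[OF h]]]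
      by (intro integrable_continuous) auto
  qed (use r continuous_on_radial[OF h] in auto)
  then show ?thesis using r by (simp add: at_within_open[OF _ open_greaterThan])
qed

text \<open>In polar coordinates \<open>r \<Delta>g = g\<^sub>r + r g\<^sub>r\<^sub>r + g\<^sub>t\<^sub>t / r\<close>; the angular term is integrated by
  parts over the period.\<close>

lemma pairing_has_derivative:
  assumes f: "Ck_on 2 S f" and g: "Ck_on 2 S g" and r: "r > \<rho>"
  shows "(pairing f g has_vector_derivative
    integral {0..2*pi} (\<lambda>t. of_real r * (radial f r t * radial g r t + f (polar r t) * lap g (polar r t))
       + angular f r t * angular g r t / of_real r)) (at r)"
proof -
  have f1: "Ck_on 1 S f" "continuous_on S f" and g1: "Ck_on 1 S g" "\<And>i. Ck_on 1 S (pd i g)"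
    and lg: "continuous_on S (lap g)"
    using f g Ck_on_mono[OF f, of 1] Ck_on_mono[OF g, of 1] Ck_on_imp_continuous_on[OF f]
      Ck_on_lap[OF openS, of 0 g] by (auto simp: numeral_2_eq_2)
  have d: "x \<in> S \<Longrightarrow> f differentiable (at x)" "x \<in> S \<Longrightarrow> g differentiable (at x)"
     "x \<in> S \<Longrightarrow> pd i g differentiable (at x)" for x i
    using f1 g1 by auto
  \<comment> \<open>\<open>rr\<close> and \<open>tt\<close> are the second derivatives of
    \<open>g\<close> in the radius and in the angle.\<close>
  define rr where "rr = (\<lambda>r t. of_real (cos t) * radial (pd 1 g) r t + of_real (sin t) * radial (pd 2 g) r t)"
  define tt where "tt = (\<lambda>r t. of_real (r * cos t) * angular (pd 2 g) r t - of_real (r * sin t) * pd 2 g (polar r t)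
     - of_real (r * sin t) * angular (pd 1 g) r t - of_real (r * cos t) * pd 1 g (polar r t))"
  define D where "D = (\<lambda>r t. f (polar r t) * radial g r t + of_real r *
     (f (polar r t) * rr r t + radial f r t * radial g r t))"
  note cont = continuous_on_polar_comp[OF f1(2), of "{0..2*pi}", unfolded split_beta]
    continuous_on_polar_comp[OF lg, of "{0..2*pi}", unfolded split_beta]
    continuous_on_radial[OF f1(1), of "{0..2*pi}", unfolded split_beta]
    continuous_on_radial[OF g1(1), of "{0..2*pi}", unfolded split_beta]
    continuous_on_radial[OF g1(2), of "{0..2*pi}", unfolded split_beta]
    continuous_on_angular[OF f1(1), of "{0..2*pi}", unfolded split_beta]
    continuous_on_angular[OF g1(1), of "{0..2*pi}", unfolded split_beta]
    continuous_on_angular[OF g1(2), of "{0..2*pi}", unfolded split_beta]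
    continuous_on_polar_comp[OF Ck_on_imp_continuous_on[OF g1(2)], of "{0..2*pi}", unfolded split_beta]
  have cD: "continuous_on ({\<rho><..} \<times> {0..2*pi}) (\<lambda>(r, t). D r t)"
    unfolding D_def rr_def split_beta by (intro continuous_intros cont)
  have "((\<lambda>r. integral (cbox 0 (2*pi)) (\<lambda>t. of_real r * (f (polar r t) * radial g r t))) has_vector_derivative
      integral (cbox 0 (2*pi)) (D r)) (at r within {\<rho><..})"
  proof (rule leibniz_rule_vector_derivative)
    fix r t assume "r \<in> {\<rho><..}"
    then have m: "polar r t \<in> S" using polar_mem by simp
    have rd: "((\<lambda>r. radial g r t) has_vector_derivative rr r t) (at r within {\<rho><..})"
      unfolding radial_def[of g] rr_def
      by (auto intro!: derivative_eq_intros radial_has_vector_derivative d(3) m)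
    have "((\<lambda>r. of_real r * (f (polar r t) * radial g r t)) has_vector_derivative
       of_real r * (f (polar r t) * rr r t + radial f r t * radial g r t) + 1 * (f (polar r t) * radial g r t)) (at r within {\<rho><..})"
      by (intro has_vector_derivative_mult rd radial_has_vector_derivative d(1) m)
         (auto intro!: derivative_eq_intros simp: has_vector_derivative_def scaleR_conv_of_real)
    then show "((\<lambda>r. of_real r * (f (polar r t) * radial g r t)) has_vector_derivative D r t) (at r within {\<rho><..})"
      by (simp add: D_def algebra_simps)
  next
    fix r assume r: "r \<in> {\<rho><..}"
    have "continuous_on ({\<rho><..} \<times> {0..2*pi}) (\<lambda>(r, t). of_real r * (f (polar r t) * radial g r t))"
      unfolding split_beta by (intro continuous_intros cont)
    then show "(\<lambda>t. of_real r * (f (polar r t) * radial g r t)) integrable_on cbox 0 (2*pi)"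
      using continuous_on_slice r by (intro integrable_continuous) auto
  qed (use r cD in auto)
  then have der: "(pairing f g has_vector_derivative integral {0..2*pi} (D r)) (at r)"
    using r by (simp add: at_within_open[OF _ open_greaterThan] pairing_def[abs_def])
  \<comment> \<open>\<open>E\<close> is the integrand of the claim. It exceeds \<open>D\<close> by
    \<open>1 / r\<close> times the angular derivative of \<open>f * angular g\<close>, whose
    integral over the period is zero.\<close>
  define E where "E = (\<lambda>r t. of_real r * (radial f r t * radial g r t + f (polar r t) * lap g (polar r t))
       + angular f r t * angular g r t / of_real r)"
  have r0: "r > 0" using r rho by simp
  have eq: "D r t = E r t - (f (polar r t) * tt r t + angular f r t * angular g r t) * (1 / of_real r)" for t
  proof -
    define C Sn R :: complex where "C = of_real (cos t)" and "Sn = of_real (sin t)" and "R = of_real r"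
    have CS: "C * C + Sn * Sn = 1"
      unfolding C_def Sn_def using sin_cos_squared_add3[of t] by (metis of_real_add of_real_mult of_real_1)
    have R: "R \<noteq> 0" using r0 by (simp add: R_def)
    have "radial g r t + R * rr r t + tt r t / R = R * lap g (polar r t)"
    proof -
      have "tt r t / R = C * angular (pd 2 g) r t - Sn * pd 2 g (polar r t) - Sn * angular (pd 1 g) r t - C * pd 1 g (polar r t)"
        unfolding tt_def C_def Sn_def using R by (simp add: R_def field_simps)
      moreover have "R * lap g (polar r t) = R * (pd 1 (pd 1 g) (polar r t) + pd 2 (pd 2 g) (polar r t)) * (C * C + Sn * Sn)"
        unfolding CS by (simp add: lap_def sum_2)
      ultimately show ?thesis
        unfolding rr_def radial_def angular_def of_real_mult C_def[symmetric] Sn_def[symmetric] R_def[symmetric]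
        by (simp add: algebra_simps)
    qed
    then have key: "R * lap g (polar r t) = radial g r t + R * rr r t + tt r t / R" by simp
    have "R * (radial f r t * radial g r t + f (polar r t) * lap g (polar r t)) =
      R * (radial f r t * radial g r t) + f (polar r t) * (R * lap g (polar r t))"
      by (simp add: algebra_simps)
    also have "\<dots> = R * (radial f r t * radial g r t) + f (polar r t) * (radial g r t + R * rr r t + tt r t / R)"
      unfolding key ..
    finally show ?thesis unfolding E_def D_def R_def[symmetric]
      by (simp add: algebra_simps add_divide_distrib)
  qed
  have ct: "continuous_on ({\<rho><..} \<times> {0..2*pi}) (\<lambda>(r, t). f (polar r t) * tt r t + angular f r t * angular g r t)"
    unfolding tt_def split_beta by (intro continuous_intros cont)
  have "((\<lambda>t. f (polar r t) * tt r t + angular f r t * angular g r t) has_integral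
     f (polar r (2*pi)) * angular g r (2*pi) - f (polar r 0) * angular g r 0) {0..2*pi}"
  proof (rule fundamental_theorem_of_calculus)
    fix t assume "t \<in> {0..2*pi}"
    have m: "polar r t \<in> S" using polar_mem r by simp
    have td: "(angular g r has_vector_derivative tt r t) (at t within {0..2*pi})"
    proof -
      have s: "((\<lambda>t. complex_of_real (r * sin t)) has_vector_derivative of_real (r * cos t)) (at t within {0..2*pi})"
        "((\<lambda>t. complex_of_real (r * cos t)) has_vector_derivative of_real (- (r * sin t))) (at t within {0..2*pi})"
        by (rule has_vector_derivative_of_real, auto intro!: derivative_eq_intros)+
      have "((\<lambda>t. of_real (r * cos t) * pd 2 g (polar r t) - of_real (r * sin t) * pd 1 g (polar r t)) has_vector_derivative
        (of_real (r * cos t) * angular (pd 2 g) r t + of_real (- (r * sin t)) * pd 2 g (polar r t)) -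
        (of_real (r * sin t) * angular (pd 1 g) r t + of_real (r * cos t) * pd 1 g (polar r t))) (at t within {0..2*pi})"
        by (intro has_vector_derivative_diff has_vector_derivative_mult s angular_has_vector_derivative d(3) m)
      then show ?thesis unfolding angular_def[of g, abs_def] tt_def by (simp add: algebra_simps)
    qed
    show "((\<lambda>t. f (polar r t) * angular g r t) has_vector_derivative
      f (polar r t) * tt r t + angular f r t * angular g r t) (at t within {0..2*pi})"
      by (intro has_vector_derivative_mult td angular_has_vector_derivative d(1) m)
  qed simp
  moreover have "polar r (2*pi) = polar r 0" "angular g r (2*pi) = angular g r 0"
    by (simp_all add: polar_def angular_def)
  ultimately have z: "integral {0..2*pi} (\<lambda>t. f (polar r t) * tt r t + angular f r t * angular g r t) = 0"
    by (simp add: integral_unique)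
  have cE: "continuous_on {0..2*pi} (E r)"
  proof -
    have "continuous_on ({\<rho><..} \<times> {0..2*pi}) (\<lambda>(r, t). E r t)"
      unfolding E_def split_beta using rho by (intro continuous_intros cont) auto
    then show ?thesis using continuous_on_slice r by blast
  qed
  have "integral {0..2*pi} (D r) = integral {0..2*pi} (E r) -
     integral {0..2*pi} (\<lambda>t. (f (polar r t) * tt r t + angular f r t * angular g r t) * (1 / of_real r))"
    unfolding eq using continuous_on_slice[OF ct r] cE r0
    by (intro Henstock_Kurzweil_Integration.integral_diff integrable_continuous_interval) (auto intro!: continuous_intros)
  also have "\<dots> = integral {0..2*pi} (E r)"
    unfolding integral_mult_left z by simp
  finally show ?thesis using der by (simp add: E_def)
qed

end

section \<open>Wronskians on circles\<close>

definition wronskian :: "(real^2 \<Rightarrow> complex) \<Rightarrow> (real^2 \<Rightarrow> complex) \<Rightarrow> real \<Rightarrow> complex" where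
  "wronskian f g r = pairing f g r - pairing g f r"

lemma wronskian_antisym: "wronskian g f r = - wronskian f g r"
  by (simp add: wronskian_def)

context exterior begin

lemma pairing_integrand_continuous:
  assumes "Ck_on 2 S f" "Ck_on 2 S g" "r > \<rho>"
  shows "continuous_on {0..2*pi} (\<lambda>t. f (polar r t))"
    and "continuous_on {0..2*pi} (radial f r)"
    and "continuous_on {0..2*pi} (angular f r)"
    and "continuous_on {0..2*pi} (\<lambda>t. lap f (polar r t))"
proof -
  have "Ck_on 1 S f" "continuous_on S f" "continuous_on S (lap f)"
    using assms(1) Ck_on_mono[OF assms(1), of 1] Ck_on_imp_continuous_on[OF assms(1)] Ck_on_lap[OF openS, of 0 f]
    by (auto simp: numeral_2_eq_2)
  then show "continuous_on {0..2*pi} (\<lambda>t. f (polar r t))" "continuous_on {0..2*pi} (radial f r)"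
    "continuous_on {0..2*pi} (angular f r)" "continuous_on {0..2*pi} (\<lambda>t. lap f (polar r t))"
    using continuous_on_slice[OF continuous_on_polar_comp _] continuous_on_slice[OF continuous_on_radial _]
      continuous_on_slice[OF continuous_on_angular _] assms(3) by blast+
qed

text \<open>Green's second identity in differential form: the products of first derivatives in
  \<open>pairing_has_derivative\<close> are symmetric in \<open>f\<close> and \<open>g\<close> and
  drop out.\<close>

lemma wronskian_has_derivative:
  assumes f: "Ck_on 2 S f" and g: "Ck_on 2 S g" and r: "r > \<rho>"
  shows "(wronskian f g has_vector_derivative
    integral {0..2*pi} (\<lambda>t. of_real r * (f (polar r t) * lap g (polar r t) - g (polar r t) * lap f (polar r t)))) (at r)"
proof -
  have r0: "r > 0" using r rho by simp
  note c = pairing_integrand_continuous[OF f g r] pairing_integrand_continuous[OF g f r]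
  let ?E = "\<lambda>f g t. of_real r * (radial f r t * radial g r t + f (polar r t) * lap g (polar r t))
       + angular f r t * angular g r t / of_real r"
  have i: "?E f g integrable_on {0..2*pi}" "?E g f integrable_on {0..2*pi}"
    using r0 by (auto intro!: integrable_continuous_interval continuous_intros c)
  have "integral {0..2*pi} (?E f g) - integral {0..2*pi} (?E g f) =
    integral {0..2*pi} (\<lambda>t. of_real r * (f (polar r t) * lap g (polar r t) - g (polar r t) * lap f (polar r t)))"
    unfolding Henstock_Kurzweil_Integration.integral_diff[OF i, symmetric]
    by (rule integral_cong) (simp add: algebra_simps)
  then show ?thesis
    unfolding wronskian_def[abs_def]
    using has_vector_derivative_diff[OF pairing_has_derivative[OF f g r] pairing_has_derivative[OF g f r]]
    by simp
qed

lemma wronskian_const: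
  assumes f: "Ck_on 2 S f" and g: "Ck_on 2 S g"
    and lf: "\<And>x. norm x > \<rho> \<Longrightarrow> lap f x = \<kappa> * f x" and lg: "\<And>x. norm x > \<rho> \<Longrightarrow> lap g x = \<kappa> * g x"
    and r: "r > \<rho>" "s > \<rho>"
  shows "wronskian f g r = wronskian f g s"
proof -
  have "(wronskian f g has_vector_derivative 0) (at u)" if "u > \<rho>" for u
  proof -
    have "norm (polar u t) > \<rho>" for t using that rho by simp
    then have "(\<lambda>t. of_real u * (f (polar u t) * lap g (polar u t) - g (polar u t) * lap f (polar u t))) = (\<lambda>t. 0)"
      using lf lg by (simp add: fun_eq_iff)
    then show ?thesis using wronskian_has_derivative[OF f g that] by simp
  qed
  then have "(wronskian f g has_derivative (\<lambda>h. 0)) (at u within {\<rho><..})" if "u \<in> {\<rho><..}" for u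
    using that unfolding has_vector_derivative_def by (auto intro: has_derivative_at_withinI)
  from has_derivative_zero_constant[OF convex_real_interval(3)[of \<rho>] this]
  obtain c where "\<And>u. u \<in> {\<rho><..} \<Longrightarrow> wronskian f g u = c" by blast
  then show ?thesis using r by simp
qed

text \<open>In polar coordinates the derivative of the Wronskian integrates to the area integral. As
  \<open>g\<close> vanishes from \<open>r2\<close> on, only the inner circle contributes, with the
  sign of an inner boundary.\<close>

lemma wronskian_eq_area_integral:
  assumes f: "Ck_on 2 S f" and g: "Ck_on 2 S g" and r: "\<rho> < r1" "r1 \<le> r2"
    and g0: "\<And>x. norm x \<ge> r2 \<Longrightarrow> g x = 0"
    and h: "continuous_on UNIV h" "\<And>x. norm x \<le> r1 \<Longrightarrow> h x = 0" "\<And>x. norm x \<ge> r2 \<Longrightarrow> h x = 0"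
      "\<And>x. norm x \<ge> r1 \<Longrightarrow> h x = f x * lap g x - g x * lap f x"
  shows "(LINT x|lborel. h x) = - wronskian f g r1"
proof -
  have "(LINT x|lborel. h x) = integral {r1..r2} (\<lambda>r. integral {0..2*pi} (\<lambda>t. of_real r * h (polar r t)))"
    using r rho by (intro polar_integral h) auto
  also have "\<dots> = wronskian f g r2 - wronskian f g r1"
  proof (rule integral_unique, rule fundamental_theorem_of_calculus)
    fix u assume u: "u \<in> {r1..r2}"
    have "(\<lambda>t. of_real u * (f (polar u t) * lap g (polar u t) - g (polar u t) * lap f (polar u t))) =
      (\<lambda>t. of_real u * h (polar u t))"
    proof
      fix t
      have n: "norm (polar u t) = u" using u r rho by simp
      show "of_real u * (f (polar u t) * lap g (polar u t) - g (polar u t) * lap f (polar u t)) =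
         of_real u * h (polar u t)"
        using h(4)[of "polar u t"] u n by simp
    qed
    then show "(wronskian f g has_vector_derivative integral {0..2*pi} (\<lambda>t. of_real u * h (polar u t))) (at u within {r1..r2})"
      using wronskian_has_derivative[OF f g, of u] u r by (auto intro: has_vector_derivative_at_within)
  qed (use r in simp)
  also have "wronskian f g r2 = 0"
  proof -
    have r2: "r2 > 0" "r2 > \<rho>" using r rho by auto
    have n: "norm (polar r2 t) = r2" for t using r2 by simp
    \<comment> \<open>\<open>g\<close> is known to vanish only from \<open>r2\<close> outwards, so
      its derivative at \<open>r2\<close> is computed on a one-sided interval.\<close>
    have "radial g r2 t = 0" for t
    proof -
      have "g differentiable (at (polar r2 t))"
        using g polar_mem[OF r2(2)] by (auto simp: numeral_2_eq_2)
      then have "((\<lambda>r. g (polar r t)) has_vector_derivative radial g r2 t) (at r2 within {r2..r2+1})"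
        by (rule radial_has_vector_derivative)
      moreover have "((\<lambda>r. g (polar r t)) has_vector_derivative 0) (at r2 within {r2..r2+1})"
        by (rule has_vector_derivative_transform[OF _ _ has_vector_derivative_const[of 0]])
           (use g0 r2 in auto)
      ultimately show ?thesis
        using vector_derivative_unique_within_closed_interval[of r2 "r2 + 1" r2] by (auto simp: cbox_interval)
    qed
    then show ?thesis
      unfolding wronskian_def pairing_def using g0 n by simp
  qed
  finally show ?thesis by simp
qed

lemma wronskian_bound:
  assumes f: "Ck_on 2 S f" and g: "Ck_on 2 S g" and r: "r > \<rho>"
    and h: "h integrable_on {0..2*pi}"
    and le: "\<And>t. norm (f (polar r t) * radial g r t - g (polar r t) * radial f r t) \<le> h t"
  shows "norm (wronskian f g r) \<le> r * integral {0..2*pi} h"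
proof -
  have r0: "r > 0" using r rho by simp
  note c = pairing_integrand_continuous[OF f g r] pairing_integrand_continuous[OF g f r]
  have i: "(\<lambda>t. of_real r * (f (polar r t) * radial g r t)) integrable_on {0..2*pi}"
     "(\<lambda>t. of_real r * (g (polar r t) * radial f r t)) integrable_on {0..2*pi}"
    by (auto intro!: integrable_continuous_interval continuous_intros c)
  have "wronskian f g r = integral {0..2*pi} (\<lambda>t. of_real r * (f (polar r t) * radial g r t) - of_real r * (g (polar r t) * radial f r t))"
    unfolding wronskian_def pairing_def Henstock_Kurzweil_Integration.integral_diff[OF i] ..
  also have "norm \<dots> \<le> integral {0..2*pi} (\<lambda>t. r * h t)"
  proof (rule Henstock_Kurzweil_Integration.integral_norm_bound_integral)
    show "(\<lambda>t. of_real r * (f (polar r t) * radial g r t) - of_real r * (g (polar r t) * radial f r t)) integrable_on {0..2*pi}"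
      using i by (rule Henstock_Kurzweil_Integration.integrable_diff)
    show "(\<lambda>t. r * h t) integrable_on {0..2*pi}" using h by (rule integrable_on_mult_right)
    fix t
    have "norm (of_real r * (f (polar r t) * radial g r t) - of_real r * (g (polar r t) * radial f r t)) =
       r * norm (f (polar r t) * radial g r t - g (polar r t) * radial f r t)"
      using r0 by (simp add: norm_mult flip: right_diff_distrib)
    also have "\<dots> \<le> r * h t" using le r0 by (intro mult_left_mono) auto
    finally show "norm (of_real r * (f (polar r t) * radial g r t) - of_real r * (g (polar r t) * radial f r t)) \<le> r * h t" .
  qed
  finally show ?thesis by simp
qed

section \<open>Energy on circles and evanescent fields\<close>

lemma cnj_calculus:
  assumes f: "Ck_on 2 S f"
  shows "Ck_on 2 S (\<lambda>x. cnj (f x))"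
    and "x \<in> S \<Longrightarrow> lap (\<lambda>x. cnj (f x)) x = cnj (lap f x)"
    and "r > \<rho> \<Longrightarrow> radial (\<lambda>x. cnj (f x)) r t = cnj (radial f r t)"
    and "r > \<rho> \<Longrightarrow> angular (\<lambda>x. cnj (f x)) r t = cnj (angular f r t)"
proof -
  show "Ck_on 2 S (\<lambda>x. cnj (f x))" by (rule Ck_on_linear[OF bounded_linear_cnj openS f])
  show "x \<in> S \<Longrightarrow> lap (\<lambda>x. cnj (f x)) x = cnj (lap f x)"
    by (rule lap_linear[OF bounded_linear_cnj openS _ f])
  have "pd i (\<lambda>x. cnj (f x)) (polar r t) = cnj (pd i f (polar r t))" if "r > \<rho>" for i r t
    using f polar_mem[OF that] by (intro pd_linear[OF bounded_linear_cnj]) (auto simp: numeral_2_eq_2)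
  then show "r > \<rho> \<Longrightarrow> radial (\<lambda>x. cnj (f x)) r t = cnj (radial f r t)"
    "r > \<rho> \<Longrightarrow> angular (\<lambda>x. cnj (f x)) r t = cnj (angular f r t)"
    by (simp_all add: radial_def angular_def)
qed

text \<open>The energy is an integral over the angle, not over arc length; its derivative is then
  \<open>2 / r\<close> times the flux, without a further term from the length of the circle.\<close>

lemma energy_derivative:
  assumes f: "Ck_on 2 S f" and r: "r > \<rho>"
  shows "((\<lambda>r. integral {0..2*pi} (\<lambda>t. (norm (f (polar r t)))\<^sup>2)) has_real_derivative
     2 / r * Re (pairing (\<lambda>x. cnj (f x)) f r)) (at r)"
proof -
  let ?c = "\<lambda>x. cnj (f x)"
  have r0: "r > 0" using r rho by simp
  have f1: "Ck_on 1 S f" "Ck_on 1 S ?c"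
    using f cnj_calculus(1)[OF f] Ck_on_mono[of 2 S _ 1] by auto
  have C: "Ck_on 1 S (\<lambda>x. ?c x * f x)" by (rule Ck_on_mult[OF openS f1(2,1)])
  note c = pairing_integrand_continuous[OF f f] pairing_integrand_continuous[OF cnj_calculus(1)[OF f] f]
  have rad: "radial (\<lambda>x. ?c x * f x) r t = ?c (polar r t) * radial f r t + cnj (?c (polar r t) * radial f r t)" for t
  proof -
    have "pd i (\<lambda>x. ?c x * f x) (polar r t) = ?c (polar r t) * pd i f (polar r t) + pd i ?c (polar r t) * f (polar r t)" for i
      using f1 polar_mem[OF r] by (intro pd_mult) auto
    then have "radial (\<lambda>x. ?c x * f x) r t = ?c (polar r t) * radial f r t + radial ?c r t * f (polar r t)"
      by (simp add: radial_def algebra_simps)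
    then show ?thesis using cnj_calculus(3)[OF f r] by simp
  qed
  have re: "((\<lambda>r. Re (integral {0..2*pi} (\<lambda>t. ?c (polar r t) * f (polar r t)))) has_real_derivative
      Re (integral {0..2*pi} (radial (\<lambda>x. ?c x * f x) r))) (at r)"
    using bounded_linear.has_vector_derivative[OF bounded_linear_Re circle_mean_has_derivative[OF C r]]
    by (simp add: has_real_derivative_iff_has_vector_derivative)
  have i: "(\<lambda>t. ?c (polar u t) * f (polar u t)) integrable_on {0..2*pi}" if "u > \<rho>" for u
    using c[OF that] by (auto intro!: integrable_continuous_interval continuous_intros)
  have e1: "Re (integral {0..2*pi} (\<lambda>t. ?c (polar u t) * f (polar u t))) = integral {0..2*pi} (\<lambda>t. (norm (f (polar u t)))\<^sup>2)"
    if "u > \<rho>" for u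
  proof -
    have "Re (integral {0..2*pi} (\<lambda>t. ?c (polar u t) * f (polar u t))) = integral {0..2*pi} (\<lambda>t. Re (?c (polar u t) * f (polar u t)))"
      using integral_linear[OF i[OF that] bounded_linear_Re] by (simp add: o_def)
    also have "(\<lambda>t. Re (?c (polar u t) * f (polar u t))) = (\<lambda>t. (norm (f (polar u t)))\<^sup>2)"
      by (auto simp: fun_eq_iff cmod_power2 simp flip: power2_eq_square)
    finally show ?thesis .
  qed
  have i2: "(\<lambda>t. ?c (polar r t) * radial f r t) integrable_on {0..2*pi}"
    using c[OF r] by (auto intro!: integrable_continuous_interval continuous_intros)
  have i3: "(\<lambda>t. cnj (?c (polar r t) * radial f r t)) integrable_on {0..2*pi}"
    using c[OF r] by (auto intro!: integrable_continuous_interval continuous_intros)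
  have "integral {0..2*pi} (radial (\<lambda>x. ?c x * f x) r) = integral {0..2*pi} (\<lambda>t. ?c (polar r t) * radial f r t)
     + cnj (integral {0..2*pi} (\<lambda>t. ?c (polar r t) * radial f r t))"
  proof -
    have "radial (\<lambda>x. ?c x * f x) r = (\<lambda>t. ?c (polar r t) * radial f r t + cnj (?c (polar r t) * radial f r t))"
      using rad by blast
    moreover have "integral {0..2*pi} (\<lambda>t. cnj (?c (polar r t) * radial f r t)) = cnj (integral {0..2*pi} (\<lambda>t. ?c (polar r t) * radial f r t))"
      using integral_linear[OF i2 bounded_linear_cnj] by (simp add: o_def)
    ultimately show ?thesis
      using Henstock_Kurzweil_Integration.integral_add[OF i2 i3] by simp
  qed
  then have e2: "Re (integral {0..2*pi} (radial (\<lambda>x. ?c x * f x) r)) = 2 / r * Re (pairing ?c f r)"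
    unfolding pairing_def using r0 by simp
  show ?thesis
    by (rule has_field_derivative_transform_within_open[OF re[unfolded e2] open_greaterThan[of \<rho>]])
       (use r e1 in auto)
qed

text \<open>The derivative of the flux is the arc length integral of the squared gradient plus
  \<open>\<kappa>\<close> times the squared modulus. For \<open>\<kappa> \<ge> 0\<close> every term
  is nonnegative, and the radial one is kept because it occurs in the Wronskian.\<close>

lemma energy_flux_derivative:
  assumes f: "Ck_on 2 S f" and lf: "\<And>x. norm x > \<rho> \<Longrightarrow> lap f x = of_real \<kappa> * f x" and \<kappa>: "\<kappa> \<ge> 0" and r: "r > \<rho>"
  obtains q where "((\<lambda>r. Re (pairing (\<lambda>x. cnj (f x)) f r)) has_real_derivative q) (at r)"
    "q \<ge> r * integral {0..2*pi} (\<lambda>t. (norm (radial f r t))\<^sup>2)"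
proof -
  let ?c = "\<lambda>x. cnj (f x)"
  have r0: "r > 0" using r rho by simp
  note c = pairing_integrand_continuous[OF f f r] pairing_integrand_continuous[OF cnj_calculus(1)[OF f] f r]
  let ?E = "\<lambda>t. of_real r * (radial ?c r t * radial f r t + ?c (polar r t) * lap f (polar r t))
       + angular ?c r t * angular f r t / of_real r"
  have der: "((\<lambda>r. Re (pairing ?c f r)) has_real_derivative Re (integral {0..2*pi} ?E)) (at r)"
    using bounded_linear.has_vector_derivative[OF bounded_linear_Re pairing_has_derivative[OF cnj_calculus(1)[OF f] f r]]
    by (simp add: has_real_derivative_iff_has_vector_derivative)
  have iE: "?E integrable_on {0..2*pi}"
    using r0 by (auto intro!: integrable_continuous_interval continuous_intros c)
  have "Re (integral {0..2*pi} ?E) = integral {0..2*pi} (\<lambda>t. Re (?E t))"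
    using integral_linear[OF iE bounded_linear_Re] by (simp add: o_def)
  moreover have "integral {0..2*pi} (\<lambda>t. r * (norm (radial f r t))\<^sup>2) \<le> integral {0..2*pi} (\<lambda>t. Re (?E t))"
  proof (rule integral_le)
    show "(\<lambda>t. r * (norm (radial f r t))\<^sup>2) integrable_on {0..2*pi}"
      by (auto intro!: integrable_continuous_interval continuous_intros c)
    show "(\<lambda>t. Re (?E t)) integrable_on {0..2*pi}"
      using r0 by (auto intro!: integrable_continuous_interval continuous_intros c)
    fix t
    have n: "norm (polar r t) > \<rho>" using r r0 by simp
    have sq: "cnj z * z = of_real ((norm z)\<^sup>2)" for z
      by (metis complex_norm_square mult.commute)
    have "?E t = of_real (r * ((norm (radial f r t))\<^sup>2 + \<kappa> * (norm (f (polar r t)))\<^sup>2) + (norm (angular f r t))\<^sup>2 / r)"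
      using cnj_calculus(3,4)[OF f r] lf[OF n] sq by (simp add: algebra_simps)
    then have "Re (?E t) = r * ((norm (radial f r t))\<^sup>2 + \<kappa> * (norm (f (polar r t)))\<^sup>2) + (norm (angular f r t))\<^sup>2 / r"
      by (metis Re_complex_of_real)
    moreover have "r * (\<kappa> * (norm (f (polar r t)))\<^sup>2) \<ge> 0" "(norm (angular f r t))\<^sup>2 / r \<ge> 0" using r0 \<kappa> by auto
    ultimately show "r * (norm (radial f r t))\<^sup>2 \<le> Re (?E t)" by (simp add: distrib_left)
  qed
  ultimately show thesis using that[OF der] by simp
qed

lemma linear_growth_of_derivative:
  fixes f f' :: "real \<Rightarrow> real"
  assumes "\<And>r. r \<ge> A \<Longrightarrow> (f has_real_derivative f' r) (at r)" "\<And>r. r \<ge> A \<Longrightarrow> f' r \<ge> c" "r \<ge> A"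
  shows "f r \<ge> f A + c * (r - A)"
proof (cases "r = A")
  case False
  then obtain z where z: "A < z" "z < r" "f r - f A = (r - A) * f' z"
    using MVT2[of A r f f'] assms by auto
  moreover have "(r - A) * c \<le> (r - A) * f' z" using assms z by (intro mult_left_mono) auto
  ultimately show ?thesis by (simp add: algebra_simps)
qed simp

text \<open>If the constant Wronskian were nonzero, the energy flux \<open>Q\<close> would grow linearly, and with
  it the bounded energy \<open>F\<close>.\<close>

lemma wronskian_evanescent:
  assumes f: "Ck_on 2 S f" and g: "Ck_on 2 S g" and \<kappa>: "\<kappa> \<ge> 0"
    and lf: "\<And>x. norm x > \<rho> \<Longrightarrow> lap f x = of_real \<kappa> * f x" and lg: "\<And>x. norm x > \<rho> \<Longrightarrow> lap g x = of_real \<kappa> * g x"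
    and decay: "\<And>x. norm x \<ge> R \<Longrightarrow> norm x * ((norm (f x))\<^sup>2 + (norm (g x))\<^sup>2) \<le> \<epsilon> (norm x)"
    and \<epsilon>: "(\<epsilon> \<longlongrightarrow> 0) at_top"
    and r: "r > \<rho>"
  shows "wronskian f g r = 0"
proof (rule ccontr)
  assume "wronskian f g r \<noteq> 0"
  define c where "c = norm (wronskian f g r)"
  have c: "c > 0" using \<open>wronskian f g r \<noteq> 0\<close> by (simp add: c_def)
  have w: "norm (wronskian f g u) = c" if "u > \<rho>" for u
    unfolding c_def using wronskian_const[OF f g lf lg that r] by simp
  define e where "e = (\<lambda>u t. (norm (f (polar u t)))\<^sup>2 + (norm (g (polar u t)))\<^sup>2)"
  define d where "d = (\<lambda>u t. (norm (radial f u t))\<^sup>2 + (norm (radial g u t))\<^sup>2)"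
  define F where "F = (\<lambda>u. integral {0..2*pi} (\<lambda>t. (norm (f (polar u t)))\<^sup>2) + integral {0..2*pi} (\<lambda>t. (norm (g (polar u t)))\<^sup>2))"
  define Q where "Q = (\<lambda>u. Re (pairing (\<lambda>x. cnj (f x)) f u) + Re (pairing (\<lambda>x. cnj (g x)) g u))"
  have "\<forall>\<^sub>F u in at_top. \<epsilon> u < c / (2 * pi)" using \<epsilon> c by (intro order_tendstoD) auto
  then obtain A0 where A0: "\<And>u. u \<ge> A0 \<Longrightarrow> \<epsilon> u < c / (2 * pi)" by (auto simp: eventually_at_top_linorder)
  \<comment> \<open>From \<open>A\<close> on the radius is at least 1, and the decay bound reads
    \<open>u * e u t \<le> c / (2 * pi)\<close>, which integrates to
    \<open>u * F u \<le> c\<close>.\<close>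
  define A where "A = max (max A0 R) (\<rho> + 1)"
  have A: "u > \<rho>" "u > 0" "u \<ge> 1" "u \<ge> A0" "u \<ge> R" if "u \<ge> A" for u using that rho by (auto simp: A_def)
  have cont: "continuous_on {0..2*pi} (\<lambda>t. f (polar u t))" "continuous_on {0..2*pi} (\<lambda>t. g (polar u t))"
    "continuous_on {0..2*pi} (radial f u)" "continuous_on {0..2*pi} (radial g u)" if "u > \<rho>" for u
    using pairing_integrand_continuous[OF f g that] pairing_integrand_continuous[OF g f that] by auto
  have ie: "(\<lambda>t. (norm (f (polar u t)))\<^sup>2) integrable_on {0..2*pi}" "(\<lambda>t. (norm (g (polar u t)))\<^sup>2) integrable_on {0..2*pi}"
    "(\<lambda>t. (norm (radial f u t))\<^sup>2) integrable_on {0..2*pi}" "(\<lambda>t. (norm (radial g u t))\<^sup>2) integrable_on {0..2*pi}"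
    if "u > \<rho>" for u
    using cont[OF that] by (auto intro!: integrable_continuous_interval continuous_intros)
  have Fe: "F u = integral {0..2*pi} (e u)" if "u > \<rho>" for u
    unfolding F_def e_def using ie[OF that] by (simp add: Henstock_Kurzweil_Integration.integral_add)
  have ie2: "e u integrable_on {0..2*pi}" "d u integrable_on {0..2*pi}" if "u > \<rho>" for u
    unfolding e_def d_def using ie[OF that] by (auto intro!: Henstock_Kurzweil_Integration.integrable_add)
  have rF: "u * F u \<le> c" if u: "u \<ge> A" for u
  proof -
    have "integral {0..2*pi} (\<lambda>t. u * e u t) \<le> integral {0..2*pi} (\<lambda>t. c / (2 * pi))"
    proof (rule integral_le)
      show "(\<lambda>t. u * e u t) integrable_on {0..2*pi}" using ie2(1)[OF A(1)[OF u]] by (rule integrable_on_mult_right)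
      fix t
      show "u * e u t \<le> c / (2 * pi)"
        using decay[of "polar u t"] A0[of u] A[OF u] by (simp add: e_def)
    qed auto
    then show ?thesis using Fe[OF A(1)[OF u]] by simp
  qed
  \<comment> \<open>The Wronskian is at most \<open>u\<close> times the half sum of the integrals of
    \<open>e\<close> and \<open>d\<close>. The part with \<open>e\<close> accounts for at most
    \<open>c / 2\<close>, so the radial derivatives must carry the other half.\<close>
  have flux: "u * integral {0..2*pi} (d u) \<ge> c" if u: "u \<ge> A" for u
  proof -
    have "c \<le> u * integral {0..2*pi} (\<lambda>t. (e u t + d u t) / 2)"
      unfolding w[OF A(1)[OF u], symmetric]
    proof (rule wronskian_bound[OF f g A(1)[OF u]])
      show "(\<lambda>t. (e u t + d u t) / 2) integrable_on {0..2*pi}"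
        using ie2[OF A(1)[OF u]] by (intro integrable_on_divide Henstock_Kurzweil_Integration.integrable_add)
      fix t
      have "norm (f (polar u t) * radial g u t - g (polar u t) * radial f u t) \<le>
         norm (f (polar u t)) * norm (radial g u t) + norm (g (polar u t)) * norm (radial f u t)"
        using norm_triangle_ineq4[of "f (polar u t) * radial g u t" "g (polar u t) * radial f u t"] by (simp add: norm_mult)
      also have "\<dots> \<le> (e u t + d u t) / 2"
      proof -
        have "2 * (x * y) \<le> x\<^sup>2 + y\<^sup>2" for x y :: real
          using sum_squares_bound[of x y] by (simp add: mult.assoc)
        from this[of "norm (f (polar u t))" "norm (radial g u t)"] this[of "norm (g (polar u t))" "norm (radial f u t)"]
        show ?thesis unfolding e_def d_def by argo
      qed
      finally show "norm (f (polar u t) * radial g u t - g (polar u t) * radial f u t) \<le> (e u t + d u t) / 2" .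
    qed
    also have "integral {0..2*pi} (\<lambda>t. (e u t + d u t) / 2) = (F u + integral {0..2*pi} (d u)) / 2"
      using ie2[OF A(1)[OF u]] Fe[OF A(1)[OF u]] by (simp add: Henstock_Kurzweil_Integration.integral_add)
    finally show ?thesis using rF[OF u] by (simp add: algebra_simps)
  qed
  have "\<exists>q. (Q has_real_derivative q) (at u) \<and> q \<ge> c" if u: "u \<ge> A" for u
  proof -
    obtain q1 where q1: "((\<lambda>r. Re (pairing (\<lambda>x. cnj (f x)) f r)) has_real_derivative q1) (at u)"
      "q1 \<ge> u * integral {0..2*pi} (\<lambda>t. (norm (radial f u t))\<^sup>2)"
      using energy_flux_derivative[OF f lf \<kappa> A(1)[OF u]] by blast
    obtain q2 where q2: "((\<lambda>r. Re (pairing (\<lambda>x. cnj (g x)) g r)) has_real_derivative q2) (at u)"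
      "q2 \<ge> u * integral {0..2*pi} (\<lambda>t. (norm (radial g u t))\<^sup>2)"
      using energy_flux_derivative[OF g lg \<kappa> A(1)[OF u]] by blast
    have "integral {0..2*pi} (d u) = integral {0..2*pi} (\<lambda>t. (norm (radial f u t))\<^sup>2) + integral {0..2*pi} (\<lambda>t. (norm (radial g u t))\<^sup>2)"
      unfolding d_def using ie[OF A(1)[OF u]] by (simp add: Henstock_Kurzweil_Integration.integral_add)
    then have "q1 + q2 \<ge> c" using q1(2) q2(2) flux[OF u] by (simp add: distrib_left)
    then show ?thesis unfolding Q_def using DERIV_add[OF q1(1) q2(1)] by blast
  qed
  then obtain Q' where Q': "\<And>u. u \<ge> A \<Longrightarrow> (Q has_real_derivative Q' u) (at u)" "\<And>u. u \<ge> A \<Longrightarrow> Q' u \<ge> c" by metis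
  have Qg: "Q u \<ge> Q A + c * (u - A)" if "u \<ge> A" for u
    using linear_growth_of_derivative[OF Q' that] .
  have F': "(F has_real_derivative 2 / u * Q u) (at u)" if "u \<ge> A" for u
    using DERIV_add[OF energy_derivative[OF f A(1)[OF that]] energy_derivative[OF g A(1)[OF that]]]
    unfolding F_def Q_def by (simp add: distrib_left)
  \<comment> \<open>From \<open>B\<close> on the linear lower bound for \<open>Q\<close> exceeds
    \<open>c * u / 2\<close>, so the energy has slope at least \<open>c\<close>.\<close>
  define B where "B = max A (2 * (A + \<bar>Q A\<bar> / c))"
  have B: "2 / u * Q u \<ge> c" "u \<ge> A" if u: "u \<ge> B" for u
  proof -
    show uA: "u \<ge> A" using u by (simp add: B_def)
    have "u \<ge> 2 * (A + \<bar>Q A\<bar> / c)" using u by (simp add: B_def)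
    then have "c * u \<ge> c * (2 * (A + \<bar>Q A\<bar> / c))" using c by (intro mult_left_mono) auto
    also have "c * (2 * (A + \<bar>Q A\<bar> / c)) = 2 * (c * A) + 2 * \<bar>Q A\<bar>" using c by (simp add: algebra_simps)
    finally have "c * u \<ge> 2 * (c * A) + 2 * \<bar>Q A\<bar>" .
    then have "2 * Q u \<ge> c * u" using Qg[OF uA] by (simp add: algebra_simps)
    then show "2 / u * Q u \<ge> c" using A[OF uA] by (simp add: field_simps)
  qed
  \<comment> \<open>Far enough out for \<open>F u \<ge> c + 1\<close>, whatever the sign of
    \<open>F B\<close>; with \<open>u \<ge> 1\<close> this contradicts
    \<open>u * F u \<le> c\<close>.\<close>
  define u where "u = B + (\<bar>F B\<bar> + c + 1) / c"
  have uB: "u \<ge> B" using c by (simp add: u_def)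
  have "F u \<ge> F B + c * (u - B)"
    by (rule linear_growth_of_derivative[OF _ _ uB, of F "\<lambda>u. 2 / u * Q u"]) (use F' B in auto)
  also have "c * (u - B) = \<bar>F B\<bar> + c + 1" using c by (simp add: u_def)
  finally have "F u \<ge> c + 1" by simp
  moreover have "F u \<le> u * F u"
    using A(3)[OF B(2)[OF uB]] \<open>F u \<ge> c + 1\<close> c mult_right_mono[of 1 u "F u"] by simp
  ultimately show False using rF[OF B(2)[OF uB]] by simp
qed

section \<open>Radiating fields\<close>

lemma sommerfeld_polar:
  assumes f: "Ck_on 2 S f" and som: "sommerfeld k f" and e: "e > 0"
  obtains A where "A > \<rho>" "\<And>r t. r \<ge> A \<Longrightarrow>
    r * (norm (radial f r t - \<i> * of_real k * f (polar r t)))\<^sup>2 \<le> e"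
proof -
  have "\<forall>\<^sub>F r in at_top. \<forall>xhat\<in>sphere 0 1. dist (of_real (sqrt r) *
          (dir_deriv xhat f (r *\<^sub>R xhat) - \<i> * of_real k * f (r *\<^sub>R xhat))) 0 < sqrt e"
    using som e unfolding sommerfeld_def uniform_limit_iff by simp
  then obtain A0 where A: "\<forall>r\<ge>A0. \<forall>xhat\<in>sphere 0 1. dist (of_real (sqrt r) *
          (dir_deriv xhat f (r *\<^sub>R xhat) - \<i> * of_real k * f (r *\<^sub>R xhat))) 0 < sqrt e"
    unfolding eventually_at_top_linorder by blast
  have A0: "norm (of_real (sqrt r) * (dir_deriv xhat f (r *\<^sub>R xhat) - \<i> * of_real k * f (r *\<^sub>R xhat))) < sqrt e"
    if "r \<ge> A0" "norm xhat = 1" for r xhat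
    using A that unfolding dist_norm diff_zero by (metis mem_sphere_0)
  define A where "A = max A0 (\<rho> + 1)"
  have "r * (norm (radial f r t - \<i> * of_real k * f (polar r t)))\<^sup>2 \<le> e" if r: "r \<ge> A" for r t
  proof -
    have r0: "r > \<rho>" "r > 0" "r \<ge> A0" using r rho by (auto simp: A_def)
    have p: "r *\<^sub>R polar 1 t = polar r t" by (simp add: polar_def)
    have "f differentiable (at (polar r t))"
      using f polar_mem[OF r0(1)] by (auto simp: numeral_2_eq_2)
    then have d: "dir_deriv (polar 1 t) f (polar r t) = radial f r t"
      by (simp add: dir_deriv_eq radial_def sum_2 scaleR_conv_of_real)
    have "sqrt r * norm (radial f r t - \<i> * of_real k * f (polar r t)) < sqrt e"
      using A0[OF r0(3), of "polar 1 t"] r0 unfolding p d by (simp add: norm_mult)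
    then have "(sqrt r * norm (radial f r t - \<i> * of_real k * f (polar r t)))\<^sup>2 \<le> (sqrt e)\<^sup>2"
      using r0 by (intro power_mono) auto
    then show ?thesis using r0 e by (simp add: power_mult_distrib)
  qed
  then show thesis using that[of A] by (auto simp: A_def)
qed

text \<open>Rellich's argument. The squared modulus of \<open>radial f - i k f\<close> is that of
  \<open>radial f\<close> plus \<open>k ^ 2\<close> times that of \<open>f\<close> minus
  \<open>2 * k\<close> times the density of the imaginary flux. This flux is independent of the
  radius, because \<open>f\<close> and its conjugate solve the same Helmholtz equation.
  \<open>B\<close> is fixed before \<open>e\<close>, since the tolerance in
  \<open>wronskian_sommerfeld\<close> depends on it.\<close>

lemma sommerfeld_energy_bound:
  assumes f: "Ck_on 2 S f" and lf: "\<And>x. norm x > \<rho> \<Longrightarrow> lap f x = - of_real (k\<^sup>2) * f x"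
    and k: "k > 0" and som: "sommerfeld k f"
  obtains B where "\<And>e. e > 0 \<Longrightarrow> \<exists>A > \<rho>. \<forall>r \<ge> A.
     r * integral {0..2*pi} (\<lambda>t. (norm (radial f r t - \<i> * of_real k * f (polar r t)))\<^sup>2) \<le> e \<and>
     r * integral {0..2*pi} (\<lambda>t. (norm (f (polar r t)))\<^sup>2) \<le> B"
proof -
  let ?c = "\<lambda>x. cnj (f x)"
  define \<sigma> where "\<sigma> = (\<lambda>r t. radial f r t - \<i> * of_real k * f (polar r t))"
  have cC: "Ck_on 2 S ?c" by (rule cnj_calculus(1)[OF f])
  have cont: "continuous_on {0..2*pi} (\<lambda>t. f (polar r t))" "continuous_on {0..2*pi} (radial f r)" if "r > \<rho>" for r
    using pairing_integrand_continuous[OF f f that] by auto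
  have c\<sigma>: "continuous_on {0..2*pi} (\<sigma> r)" if "r > \<rho>" for r
    unfolding \<sigma>_def by (intro continuous_intros cont that)
  have i1: "(\<lambda>t. ?c (polar r t) * radial f r t) integrable_on {0..2*pi}" if "r > \<rho>" for r
    using cont[OF that] by (auto intro!: integrable_continuous_interval continuous_intros)
  have i2: "(\<lambda>t. (norm (\<sigma> r t))\<^sup>2) integrable_on {0..2*pi}" "(\<lambda>t. (norm (f (polar r t)))\<^sup>2) integrable_on {0..2*pi}"
    if "r > \<rho>" for r
    using cont[OF that] c\<sigma>[OF that] by (auto intro!: integrable_continuous_interval continuous_intros)
  \<comment> \<open>Exchanging \<open>f\<close> and its conjugate conjugates the pairing, so its
    imaginary part is half that of their Wronskian, which is constant.\<close>
  define J where "J = Im (pairing ?c f (\<rho> + 1))"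
  have J: "Im (pairing ?c f r) = J" if r: "r > \<rho>" for r
  proof -
    have sym: "pairing f ?c u = cnj (pairing ?c f u)" if u: "u > \<rho>" for u
    proof -
      have "pairing f ?c u = of_real u * integral {0..2*pi} (\<lambda>t. cnj (?c (polar u t) * radial f u t))"
        unfolding pairing_def using cnj_calculus(3)[OF f u] by simp
      also have "integral {0..2*pi} (\<lambda>t. cnj (?c (polar u t) * radial f u t)) =
          cnj (integral {0..2*pi} (\<lambda>t. ?c (polar u t) * radial f u t))"
        using integral_linear[OF i1[OF u] bounded_linear_cnj] by (simp add: o_def)
      finally show ?thesis by (simp add: pairing_def)
    qed
    have lc: "lap ?c x = - of_real (k\<^sup>2) * ?c x" if "norm x > \<rho>" for x
      using cnj_calculus(2)[OF f ext[OF that]] lf[OF that] by simp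
    have "wronskian ?c f r = wronskian ?c f (\<rho> + 1)"
      by (rule wronskian_const[OF cC f lc lf r]) auto
    then have "Im (wronskian ?c f r) = Im (wronskian ?c f (\<rho> + 1))" by simp
    then show ?thesis unfolding wronskian_def J_def using sym r by simp
  qed
  have bound: "k\<^sup>2 * (r * integral {0..2*pi} (\<lambda>t. (norm (f (polar r t)))\<^sup>2)) \<le>
     r * integral {0..2*pi} (\<lambda>t. (norm (\<sigma> r t))\<^sup>2) + 2 * k * J" if r: "r > \<rho>" for r
  proof -
    have r0: "r > 0" using r rho by simp
    have iI: "(\<lambda>t. Im (?c (polar r t) * radial f r t)) integrable_on {0..2*pi}"
      using cont[OF r] by (intro integrable_continuous_interval continuous_intros)
    have "k\<^sup>2 * integral {0..2*pi} (\<lambda>t. (norm (f (polar r t)))\<^sup>2) = integral {0..2*pi} (\<lambda>t. k\<^sup>2 * (norm (f (polar r t)))\<^sup>2)"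
      by simp
    also have "\<dots> \<le> integral {0..2*pi} (\<lambda>t. (norm (\<sigma> r t))\<^sup>2 + 2 * k * Im (?c (polar r t) * radial f r t))"
    proof (rule integral_le)
      show "(\<lambda>t. k\<^sup>2 * (norm (f (polar r t)))\<^sup>2) integrable_on {0..2*pi}"
        using i2(2)[OF r] by (rule integrable_on_mult_right)
      show "(\<lambda>t. (norm (\<sigma> r t))\<^sup>2 + 2 * k * Im (?c (polar r t) * radial f r t)) integrable_on {0..2*pi}"
        by (intro Henstock_Kurzweil_Integration.integrable_add i2(1)[OF r] integrable_on_mult_right iI)
      fix t
      have "(norm (\<sigma> r t))\<^sup>2 + 2 * k * Im (?c (polar r t) * radial f r t) =
         k\<^sup>2 * (norm (f (polar r t)))\<^sup>2 + (norm (radial f r t))\<^sup>2"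
        unfolding \<sigma>_def cmod_power2 by (simp add: power2_eq_square algebra_simps)
      then show "k\<^sup>2 * (norm (f (polar r t)))\<^sup>2 \<le> (norm (\<sigma> r t))\<^sup>2 + 2 * k * Im (?c (polar r t) * radial f r t)"
        by simp
    qed
    also have "\<dots> = integral {0..2*pi} (\<lambda>t. (norm (\<sigma> r t))\<^sup>2) + 2 * k * integral {0..2*pi} (\<lambda>t. Im (?c (polar r t) * radial f r t))"
      by (subst Henstock_Kurzweil_Integration.integral_add[OF i2(1)[OF r] integrable_on_mult_right[OF iI]]) simp
    also have "integral {0..2*pi} (\<lambda>t. Im (?c (polar r t) * radial f r t)) = Im (integral {0..2*pi} (\<lambda>t. ?c (polar r t) * radial f r t))"
      using integral_linear[OF i1[OF r] bounded_linear_Im] by (simp add: o_def)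
    finally have *: "k\<^sup>2 * integral {0..2*pi} (\<lambda>t. (norm (f (polar r t)))\<^sup>2) \<le>
      integral {0..2*pi} (\<lambda>t. (norm (\<sigma> r t))\<^sup>2) + 2 * k * Im (integral {0..2*pi} (\<lambda>t. ?c (polar r t) * radial f r t))" .
    have "J = r * Im (integral {0..2*pi} (\<lambda>t. ?c (polar r t) * radial f r t))"
      unfolding J[OF r, symmetric] pairing_def by simp
    then show ?thesis using mult_left_mono[OF *, of r] r0 by (simp add: algebra_simps)
  qed
  show thesis
  proof (rule that)
    fix e :: real assume e: "e > 0"
    \<comment> \<open>The minimum with 1 makes the energy bound independent of \<open>e\<close>; the
      division by \<open>2 * pi\<close> pays for the integration over the angle.\<close>
    define e' where "e' = min e 1 / (2 * pi)"
    have e': "e' > 0" using e by (simp add: e'_def)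
    obtain A where A: "A > \<rho>" "\<And>r t. r \<ge> A \<Longrightarrow> r * (norm (\<sigma> r t))\<^sup>2 \<le> e'"
      using sommerfeld_polar[OF f som e'] unfolding \<sigma>_def by blast
    have N: "r * integral {0..2*pi} (\<lambda>t. (norm (\<sigma> r t))\<^sup>2) \<le> min e 1" if r: "r \<ge> A" for r
    proof -
      have "integral {0..2*pi} (\<lambda>t. r * (norm (\<sigma> r t))\<^sup>2) \<le> integral {0..2*pi} (\<lambda>t. e')"
        by (rule integral_le) (use i2(1)[of r] r A in \<open>auto intro: integrable_on_mult_right\<close>)
      then show ?thesis by (simp add: e'_def)
    qed
    have "r * integral {0..2*pi} (\<lambda>t. (norm (f (polar r t)))\<^sup>2) \<le> (1 + 2 * k * J) / k\<^sup>2" if r: "r \<ge> A" for r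
      using bound[of r] N[OF r] r A(1) k by (simp add: field_simps)
    then show "\<exists>A > \<rho>. \<forall>r \<ge> A.
       r * integral {0..2*pi} (\<lambda>t. (norm (radial f r t - \<i> * of_real k * f (polar r t)))\<^sup>2) \<le> e \<and>
       r * integral {0..2*pi} (\<lambda>t. (norm (f (polar r t)))\<^sup>2) \<le> (1 + 2 * k * J) / k\<^sup>2"
      using A(1) N unfolding \<sigma>_def by (intro exI[of _ A]) auto
  qed
qed

text \<open>In \<open>f * radial g - g * radial f\<close> the terms \<open>i k f g\<close> cancel,
  so both radial derivatives may be replaced by the Sommerfeld expressions. In each product one
  factor is then bounded in mean square and the other tends to zero, while the Wronskian is
  constant.\<close>

lemma wronskian_sommerfeld:
  assumes f: "Ck_on 2 S f" and g: "Ck_on 2 S g" and k: "k > 0"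
    and lf: "\<And>x. norm x > \<rho> \<Longrightarrow> lap f x = - of_real (k\<^sup>2) * f x" and lg: "\<And>x. norm x > \<rho> \<Longrightarrow> lap g x = - of_real (k\<^sup>2) * g x"
    and som: "sommerfeld k f" "sommerfeld k g" and r: "r > \<rho>"
  shows "wronskian f g r = 0"
proof (rule ccontr)
  assume "wronskian f g r \<noteq> 0"
  define c where "c = norm (wronskian f g r)"
  have c: "c > 0" using \<open>wronskian f g r \<noteq> 0\<close> by (simp add: c_def)
  let ?\<sigma> = "\<lambda>f r t. radial f r t - \<i> * of_real k * f (polar r t)"
  obtain Bf where Bf: "\<And>e. e > 0 \<Longrightarrow> \<exists>A > \<rho>. \<forall>r \<ge> A.
     r * integral {0..2*pi} (\<lambda>t. (norm (?\<sigma> f r t))\<^sup>2) \<le> e \<and> r * integral {0..2*pi} (\<lambda>t. (norm (f (polar r t)))\<^sup>2) \<le> Bf"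
    using sommerfeld_energy_bound[OF f lf k som(1)] by blast
  obtain Bg where Bg: "\<And>e. e > 0 \<Longrightarrow> \<exists>A > \<rho>. \<forall>r \<ge> A.
     r * integral {0..2*pi} (\<lambda>t. (norm (?\<sigma> g r t))\<^sup>2) \<le> e \<and> r * integral {0..2*pi} (\<lambda>t. (norm (g (polar r t)))\<^sup>2) \<le> Bg"
    using sommerfeld_energy_bound[OF g lg k som(2)] by blast
  \<comment> \<open>The weight gives
    \<open>s * (\<bar>Bf\<bar> + \<bar>Bg\<bar> + 1) = c / 4\<close>, and
    \<open>e = s * c / 8\<close> makes \<open>2 * e / s = c / 4\<close>; together
    \<open>c / 2\<close>, less than \<open>c\<close>.\<close>
  define s where "s = c / (4 * (\<bar>Bf\<bar> + \<bar>Bg\<bar> + 1))"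
  have s: "s > 0" using c by (simp add: s_def)
  define e where "e = s * c / 8"
  have e: "e > 0" using s c by (simp add: e_def)
  obtain A1 A2 where A1: "A1 > \<rho>" "\<And>r. r \<ge> A1 \<Longrightarrow> r * integral {0..2*pi} (\<lambda>t. (norm (?\<sigma> f r t))\<^sup>2) \<le> e"
      "\<And>r. r \<ge> A1 \<Longrightarrow> r * integral {0..2*pi} (\<lambda>t. (norm (f (polar r t)))\<^sup>2) \<le> Bf"
    and A2: "\<And>r. r \<ge> A2 \<Longrightarrow> r * integral {0..2*pi} (\<lambda>t. (norm (?\<sigma> g r t))\<^sup>2) \<le> e"
      "\<And>r. r \<ge> A2 \<Longrightarrow> r * integral {0..2*pi} (\<lambda>t. (norm (g (polar r t)))\<^sup>2) \<le> Bg"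
  proof -
    obtain A1 where x1: "A1 > \<rho>" "\<forall>r \<ge> A1. r * integral {0..2*pi} (\<lambda>t. (norm (?\<sigma> f r t))\<^sup>2) \<le> e \<and>
        r * integral {0..2*pi} (\<lambda>t. (norm (f (polar r t)))\<^sup>2) \<le> Bf"
      using Bf[OF e] by blast
    obtain A2 where x2: "\<forall>r \<ge> A2. r * integral {0..2*pi} (\<lambda>t. (norm (?\<sigma> g r t))\<^sup>2) \<le> e \<and>
        r * integral {0..2*pi} (\<lambda>t. (norm (g (polar r t)))\<^sup>2) \<le> Bg"
      using Bg[OF e] by blast
    show thesis by (rule that[of A1 A2]) (use x1 x2 in auto)
  qed
  define u where "u = max A1 A2"
  have u: "u > \<rho>" "u \<ge> A1" "u \<ge> A2" using A1(1) by (auto simp: u_def)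
  note cont = pairing_integrand_continuous[OF f g u(1)] pairing_integrand_continuous[OF g f u(1)]
  have i: "(\<lambda>t. (norm (?\<sigma> f u t))\<^sup>2) integrable_on {0..2*pi}" "(\<lambda>t. (norm (f (polar u t)))\<^sup>2) integrable_on {0..2*pi}"
     "(\<lambda>t. (norm (?\<sigma> g u t))\<^sup>2) integrable_on {0..2*pi}" "(\<lambda>t. (norm (g (polar u t)))\<^sup>2) integrable_on {0..2*pi}"
    by (auto intro!: integrable_continuous_interval continuous_intros cont)
  define h where "h = (\<lambda>t. (s * (norm (f (polar u t)))\<^sup>2 + s * (norm (g (polar u t)))\<^sup>2)
     + ((norm (?\<sigma> g u t))\<^sup>2 / s + (norm (?\<sigma> f u t))\<^sup>2 / s))"
  have h: "(h has_integral ((s * integral {0..2*pi} (\<lambda>t. (norm (f (polar u t)))\<^sup>2) + s * integral {0..2*pi} (\<lambda>t. (norm (g (polar u t)))\<^sup>2))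
     + (integral {0..2*pi} (\<lambda>t. (norm (?\<sigma> g u t))\<^sup>2) / s + integral {0..2*pi} (\<lambda>t. (norm (?\<sigma> f u t))\<^sup>2) / s))) {0..2*pi}"
    unfolding h_def by (intro has_integral_add has_integral_mult_right has_integral_divide integrable_integral i)
  have "c = norm (wronskian f g u)"
    unfolding c_def using wronskian_const[OF f g lf lg r u(1)] by simp
  also have "\<dots> \<le> u * integral {0..2*pi} h"
  proof (rule wronskian_bound[OF f g u(1)])
    show "h integrable_on {0..2*pi}" using h by blast
    fix t
    have "f (polar u t) * radial g u t - g (polar u t) * radial f u t = f (polar u t) * ?\<sigma> g u t - g (polar u t) * ?\<sigma> f u t"
      by (simp add: algebra_simps)
    also have "norm \<dots> \<le> norm (f (polar u t)) * norm (?\<sigma> g u t) + norm (g (polar u t)) * norm (?\<sigma> f u t)"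
      using norm_triangle_ineq4[of "f (polar u t) * ?\<sigma> g u t" "g (polar u t) * ?\<sigma> f u t"] by (simp add: norm_mult)
    also have "\<dots> \<le> h t"
      using add_mono[OF mult_le_weighted_squares[OF s, of "norm (f (polar u t))" "norm (?\<sigma> g u t)"]
        mult_le_weighted_squares[OF s, of "norm (g (polar u t))" "norm (?\<sigma> f u t)"]]
      unfolding h_def by (simp add: algebra_simps)
    finally show "norm (f (polar u t) * radial g u t - g (polar u t) * radial f u t) \<le> h t" .
  qed
  also have "integral {0..2*pi} h = ((s * integral {0..2*pi} (\<lambda>t. (norm (f (polar u t)))\<^sup>2) + s * integral {0..2*pi} (\<lambda>t. (norm (g (polar u t)))\<^sup>2))
     + (integral {0..2*pi} (\<lambda>t. (norm (?\<sigma> g u t))\<^sup>2) / s + integral {0..2*pi} (\<lambda>t. (norm (?\<sigma> f u t))\<^sup>2) / s))"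
    using h by (rule integral_unique)
  also have "u * \<dots> = s * (u * integral {0..2*pi} (\<lambda>t. (norm (f (polar u t)))\<^sup>2)) + s * (u * integral {0..2*pi} (\<lambda>t. (norm (g (polar u t)))\<^sup>2))
     + ((u * integral {0..2*pi} (\<lambda>t. (norm (?\<sigma> g u t))\<^sup>2)) / s + (u * integral {0..2*pi} (\<lambda>t. (norm (?\<sigma> f u t))\<^sup>2)) / s)"
    by (simp add: algebra_simps)
  also have "\<dots> \<le> s * \<bar>Bf\<bar> + s * \<bar>Bg\<bar> + (e / s + e / s)"
  proof -
    have "u * integral {0..2*pi} (\<lambda>t. (norm (f (polar u t)))\<^sup>2) \<le> \<bar>Bf\<bar>" "u * integral {0..2*pi} (\<lambda>t. (norm (g (polar u t)))\<^sup>2) \<le> \<bar>Bg\<bar>"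
      using A1(3)[OF u(2)] A2(2)[OF u(3)] by auto
    then show ?thesis
      using A1(2)[OF u(2)] A2(1)[OF u(3)] s by (intro add_mono mult_left_mono divide_right_mono) auto
  qed
  also have "\<dots> = s * (\<bar>Bf\<bar> + \<bar>Bg\<bar>) + c / 4" using s by (simp add: e_def algebra_simps)
  also have "\<dots> \<le> s * (\<bar>Bf\<bar> + \<bar>Bg\<bar> + 1) + c / 4" using s by simp
  also have "s * (\<bar>Bf\<bar> + \<bar>Bg\<bar> + 1) = c / 4"
  proof -
    have "c / (4 * x) * x = c / 4" if "x > 0" for x :: real using that by simp
    then show ?thesis unfolding s_def by (smt (verit) abs_ge_zero)
  qed
  finally show False using c by simp
qed

lemma wronskian_add_left:
  assumes f: "Ck_on 2 S f" and h: "Ck_on 2 S h" and g: "Ck_on 2 S g" and r: "r > \<rho>"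
  shows "wronskian (\<lambda>x. f x + h x) g r = wronskian f g r + wronskian h g r"
proof -
  have rad: "radial (\<lambda>x. f x + h x) r t = radial f r t + radial h r t" for t
  proof -
    have "pd i (\<lambda>x. f x + h x) (polar r t) = pd i f (polar r t) + pd i h (polar r t)" for i
      using f h polar_mem[OF r] by (intro pd_add) (auto simp: numeral_2_eq_2)
    then show ?thesis by (simp add: radial_def algebra_simps)
  qed
  note c = pairing_integrand_continuous[OF f g r] pairing_integrand_continuous[OF g f r] pairing_integrand_continuous[OF h g r]
  have i: "(\<lambda>t. of_real r * (p (polar r t) * radial q r t)) integrable_on {0..2*pi}"
    if "p = f \<or> p = g \<or> p = h" "q = f \<or> q = g \<or> q = h" for p q
    using that c by (auto intro!: integrable_continuous_interval continuous_intros)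
  have "pairing (\<lambda>x. f x + h x) g r = pairing f g r + pairing h g r"
    unfolding pairing_def
    by (subst Henstock_Kurzweil_Integration.integral_add[symmetric]) (auto simp: distrib_left distrib_right intro!: i)
  moreover have "pairing g (\<lambda>x. f x + h x) r = pairing g f r + pairing g h r"
    unfolding pairing_def rad
    by (subst Henstock_Kurzweil_Integration.integral_add[symmetric]) (auto simp: distrib_left distrib_right intro!: i)
  ultimately show ?thesis by (simp add: wronskian_def)
qed

lemma wronskian_add_right:
  assumes f: "Ck_on 2 S f" and h: "Ck_on 2 S h" and g: "Ck_on 2 S g" and r: "r > \<rho>"
  shows "wronskian g (\<lambda>x. f x + h x) r = wronskian g f r + wronskian g h r"
  using wronskian_add_left[OF assms] by (simp add: wronskian_antisym[of g])

end

section \<open>Cutoffs of total fields\<close>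

lemma smooth_on_imp_Ck: "smooth_on S f \<Longrightarrow> Ck_on m S f"
  by (simp add: smooth_on_def)

lemma test_functionI:
  assumes "smooth_on UNIV \<phi>" "\<And>x. norm x > B \<Longrightarrow> \<phi> x = 0"
  shows "test_function UNIV \<phi>"
  unfolding test_function_def using assms by (intro conjI exI[of _ "cball 0 B"]) auto

lemma test_function_bounded_support:
  assumes "test_function UNIV \<phi>"
  shows "\<exists>B. smooth_on UNIV \<phi> \<and> (\<forall>x. norm x > B \<longrightarrow> \<phi> x = 0)"
proof -
  obtain K where K: "smooth_on UNIV \<phi>" "compact K" "\<And>x. x \<notin> K \<Longrightarrow> \<phi> x = 0"
    using assms unfolding test_function_def by blast
  obtain B where "\<And>x. x \<in> K \<Longrightarrow> norm x \<le> B"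
    using compact_imp_bounded[OF K(2)] by (auto simp: bounded_iff)
  then show ?thesis using K by (intro exI[of _ B]) force
qed

lemma lap_support_norm: "(\<And>x. norm x > B \<Longrightarrow> f x = 0) \<Longrightarrow> norm x > B \<Longrightarrow> lap f x = 0"
  using lap_support[of "cball 0 B" f x] by auto

lemma test_function_lap:
  assumes "test_function UNIV \<phi>"
  shows "test_function UNIV (lap \<phi>)"
proof -
  obtain B where "smooth_on UNIV \<phi>" "\<And>x. norm x > B \<Longrightarrow> \<phi> x = 0"
    using test_function_bounded_support[OF assms] by blast
  then show ?thesis
    using smooth_on_lap[OF open_UNIV] lap_support_norm[of B \<phi>] by (intro test_functionI[of _ B]) blast+
qed

lemma test_function_mult:
  assumes "smooth_on UNIV f" "test_function UNIV \<phi>"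
  shows "test_function UNIV (\<lambda>x. f x * \<phi> x)"
proof -
  obtain B where "smooth_on UNIV \<phi>" "\<And>x. norm x > B \<Longrightarrow> \<phi> x = 0"
    using test_function_bounded_support[OF assms(2)] by blast
  then show ?thesis
    using smooth_on_mult[OF open_UNIV assms(1)] by (intro test_functionI[of _ B]) auto
qed

lemma test_function_sq_integrable:
  assumes "test_function UNIV \<phi>"
  shows "sq_integrable \<phi>"
proof -
  obtain B where "smooth_on UNIV \<phi>" "\<And>x. norm x > B \<Longrightarrow> \<phi> x = 0"
    using test_function_bounded_support[OF assms] by blast
  then show ?thesis
    using Ck_on_imp_continuous_on[OF smooth_on_imp_Ck]
    by (intro sq_integrable_continuous_compact[of "cball 0 B"]) auto
qed

lemma lap_add_test:
  assumes "test_function UNIV f" "test_function UNIV g"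
  shows "lap (\<lambda>x. f x + g x) = (\<lambda>x. lap f x + lap g x)"
  using assms lap_add[OF open_UNIV UNIV_I] unfolding test_function_def smooth_on_def by blast

lemma sq_integrable_mult_bounded:
  fixes f N :: "'a::euclidean_space \<Rightarrow> complex"
  assumes "sq_integrable f" "N \<in> borel_measurable borel" "\<And>x. norm (N x) \<le> M"
  shows "sq_integrable (\<lambda>x. N x * f x)"
proof (rule sq_integrable_bound[OF assms(1)])
  show "(\<lambda>x. N x * f x) \<in> borel_measurable borel"
    using assms(1,2) by (auto simp: sq_integrable_def)
  show "norm (N x * f x) \<le> M * norm (f x)" for x
    using assms(3)[of x] by (simp add: norm_mult mult_right_mono)
qed

text \<open>Normalised bumps with shrinking supports. The third property is convergence of pairings,
  from \<open>conv_limit\<close>, whose radius serves all kernels at once.\<close>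

lemma mollifier_sequence:
  obtains \<eta> :: "nat \<Rightarrow> real^2 \<Rightarrow> complex" where
    "\<And>n. smooth_on UNIV (\<eta> n)" "\<And>n x. norm x \<ge> 1 / real (Suc n) \<Longrightarrow> \<eta> n x = 0"
    "\<And>f g. sq_integrable f \<Longrightarrow> sq_integrable g \<Longrightarrow>
       (\<lambda>n. LINT x|lborel. f x * conv g (\<eta> n) x) \<longlonglongrightarrow> (LINT x|lborel. f x * g x)"
proof -
  have "\<exists>b::real^2 \<Rightarrow> real. smooth_on UNIV (\<lambda>x. complex_of_real (b x)) \<and> (\<forall>x. b x \<ge> 0) \<and>
     (\<forall>x. norm x \<ge> 1 / real (Suc n) \<longrightarrow> b x = 0) \<and> continuous_on UNIV b \<and> (LINT x|lborel. b x) = 1" for n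
  proof -
    define e where "e = 1 / real (Suc n)"
    have e: "e > 0" by (simp add: e_def)
    obtain b :: "real^2 \<Rightarrow> real" where b: "smooth_on UNIV (\<lambda>x. complex_of_real (b x))"
      "\<And>x. b x \<ge> 0" "\<And>x. norm x < e \<Longrightarrow> b x > 0" "\<And>x. norm x \<ge> e \<Longrightarrow> b x = 0" "continuous_on UNIV b"
      using smooth_bump[OF e] by metis
    have ib: "integrable lborel b"
      by (rule integrable_continuous_compact[OF compact_cball[of 0 e] continuous_on_subset[OF b(5)]])
         (use b(4) in auto)
    define I where "I = (LINT x|lborel. b x)"
    have I: "I > 0"
    proof -
      \<comment> \<open>The bump is positive on a ball; a zero integral would make this ball a null
        set.\<close>
      have "I \<noteq> 0"
      proof
        assume "I = 0"
        then have "AE x in lborel. b x = 0"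
          using integral_nonneg_eq_0_iff_AE[OF ib] b(2) by (simp add: I_def)
        then have "AE x in lborel. x \<notin> ball (0::real^2) e"
          by eventually_elim (use b(3) in force)
        then have "ball (0::real^2) e \<in> null_sets lborel"
          by (simp add: AE_iff_null_sets)
        then show False using e emeasure_lborel_ball_finite content_ball_pos[of e "0::real^2"]
          by (metis measure_eq_0_null_sets order_less_irrefl)
      qed
      moreover have "I \<ge> 0" unfolding I_def using b(2) by simp
      ultimately show ?thesis by simp
    qed
    have "smooth_on UNIV (\<lambda>x. complex_of_real (1 / I) * complex_of_real (b x))"
      by (rule smooth_on_mult[OF open_UNIV smooth_on_const b(1)])
    then have "smooth_on UNIV (\<lambda>x. complex_of_real (b x / I))" by simp
    moreover have "(LINT x|lborel. b x / I) = 1" using I by (simp add: I_def)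
    moreover have "continuous_on UNIV (\<lambda>x. b x / I)" using b(5) I by (auto intro!: continuous_intros)
    ultimately show ?thesis using b(2,4) I unfolding e_def by (intro exI[of _ "\<lambda>x. b x / I"]) auto
  qed
  then obtain b :: "nat \<Rightarrow> real^2 \<Rightarrow> real" where b: "\<And>n. smooth_on UNIV (\<lambda>x. complex_of_real (b n x))"
     "\<And>n x. b n x \<ge> 0" "\<And>n x. norm x \<ge> 1 / real (Suc n) \<Longrightarrow> b n x = 0"
     "\<And>n. continuous_on UNIV (b n)" "\<And>n. (LINT x|lborel. b n x) = 1" by metis
  have "(\<lambda>n. LINT x|lborel. f x * conv g (\<lambda>x. complex_of_real (b n x)) x) \<longlonglongrightarrow> (LINT x|lborel. f x * g x)"
    if f: "sq_integrable f" and g: "sq_integrable g" for f g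
  proof (rule LIMSEQ_I)
    fix e :: real assume "e > 0"
    then have e2: "e / 2 > 0" by simp
    obtain d where d: "d > 0" "\<And>b. \<lbrakk>continuous_on UNIV b; \<And>x. b x \<ge> 0; \<And>x. norm x \<ge> d \<Longrightarrow> b x = 0;
      (LINT x|lborel. b x) = 1\<rbrakk> \<Longrightarrow>
     norm ((LINT x|lborel. f x * conv g (\<lambda>x. complex_of_real (b x)) x) - (LINT x|lborel. f x * g x)) \<le> e / 2"
      using conv_limit[OF f g e2] by blast
    obtain N where N: "1 / real (Suc N) < d" using d(1) nat_approx_posE by blast
    show "\<exists>N. \<forall>n\<ge>N. norm ((LINT x|lborel. f x * conv g (\<lambda>x. complex_of_real (b n x)) x) - (LINT x|lborel. f x * g x)) < e"
    proof (intro exI allI impI)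
      fix n assume n: "n \<ge> N"
      have "1 / real (Suc n) \<le> 1 / real (Suc N)" using n by (intro divide_left_mono) auto
      then have "norm ((LINT x|lborel. f x * conv g (\<lambda>x. complex_of_real (b n x)) x) - (LINT x|lborel. f x * g x)) \<le> e / 2"
        using N by (intro d(2) b) auto
      then show "norm ((LINT x|lborel. f x * conv g (\<lambda>x. complex_of_real (b n x)) x) - (LINT x|lborel. f x * g x)) < e"
        using \<open>e > 0\<close> by simp
    qed
  qed
  then show thesis using that[of "\<lambda>n x. complex_of_real (b n x)"] b by simp
qed

section \<open>Commutators with a cutoff and the equation of a cut total field\<close>

context exterior begin

lemma exterior_subset: "{x. norm x > \<rho>} \<subseteq> S" "open {x::real^2. norm x > \<rho>}"
  using ext by (auto intro!: open_Collect_less continuous_intros)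

text \<open>For \<open>\<Delta>a = - \<kappa> a\<close> this is the commutator \<open>[\<Delta>, w] a\<close>, supported where \<open>w\<close> is not constant.\<close>

definition defect :: "(real^2 \<Rightarrow> complex) \<Rightarrow> complex \<Rightarrow> (real^2 \<Rightarrow> complex) \<Rightarrow> real^2 \<Rightarrow> complex" where
  "defect w \<kappa> a x = (if norm x > \<rho> then lap (\<lambda>x. w x * a x) x + \<kappa> * (w x * a x) else 0)"

lemma cutoff_Ck:
  fixes w a :: "real^2 \<Rightarrow> complex"
  assumes "smooth_on UNIV w" "Ck_on 2 S a"
  shows "Ck_on 2 S (\<lambda>x. w x * a x)"
  using Ck_on_mult[OF openS Ck_on_subset[OF smooth_on_imp_Ck[OF assms(1)] subset_UNIV] assms(2)] by simp

lemma defect_inner: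
  assumes "\<And>x. norm x \<le> r1 \<Longrightarrow> w x = 1" "\<And>x. norm x > \<rho> \<Longrightarrow> lap a x = - \<kappa> * a x" "norm x < r1"
  shows "defect w \<kappa> a x = 0"
proof -
  have "lap (\<lambda>x. w x * a x) x = lap a x"
    by (rule lap_cong_open[OF open_ball[of 0 r1]]) (use assms in auto)
  then show ?thesis using assms by (simp add: defect_def)
qed

lemma defect_outer:
  assumes "\<And>x. norm x \<ge> r2 \<Longrightarrow> w x = 0" "norm x > r2"
  shows "defect w \<kappa> a x = 0"
proof -
  have "lap (\<lambda>x. w x * a x) x = 0"
    by (rule lap_support_norm[OF _ assms(2)]) (use assms(1) in auto)
  then show ?thesis using assms by (simp add: defect_def)
qed

text \<open>The case distinction at \<open>\<rho>\<close> creates no jump: \<open>w = 1\<close> up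
  to the larger radius \<open>r1\<close>, so coming from outside the commutator is zero before
  \<open>\<rho>\<close> is reached.\<close>

lemma defect_continuous:
  assumes w: "smooth_on UNIV w" "\<And>x. norm x \<le> r1 \<Longrightarrow> w x = 1" and r1: "\<rho> < r1"
    and a: "Ck_on 2 S a" "\<And>x. norm x > \<rho> \<Longrightarrow> lap a x = - \<kappa> * a x"
  shows "continuous_on UNIV (defect w \<kappa> a)"
proof -
  have C: "Ck_on 2 S (\<lambda>x. w x * a x)" by (rule cutoff_Ck[OF w(1) a(1)])
  then have "continuous_on S (lap (\<lambda>x. w x * a x))"
    using Ck_on_lap[OF openS, of 0 "\<lambda>x. w x * a x"] by (simp add: numeral_2_eq_2)
  then have "continuous_on S (\<lambda>x. lap (\<lambda>x. w x * a x) x + \<kappa> * (w x * a x))"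
    using Ck_on_imp_continuous_on[OF C] by (intro continuous_on_add continuous_on_mult_left)
  then have "continuous_on {x. norm x > \<rho>} (\<lambda>x. lap (\<lambda>x. w x * a x) x + \<kappa> * (w x * a x))"
    using exterior_subset(1) by (rule continuous_on_subset)
  then have 1: "continuous_on {x. norm x > \<rho>} (defect w \<kappa> a)"
    by (rule continuous_on_eq) (simp add: defect_def)
  have "continuous_on (ball 0 r1) (\<lambda>x::real^2. 0::complex)" by simp
  then have 2: "continuous_on (ball 0 r1) (defect w \<kappa> a)"
    by (rule continuous_on_eq) (use defect_inner[OF w(2) a(2)] in auto)
  have "{x. norm x > \<rho>} \<union> ball (0::real^2) r1 = UNIV" using r1 by auto
  then show ?thesis using continuous_on_open_Un[OF exterior_subset(2) open_ball 1 2] by simp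
qed

lemma defect_sq_integrable:
  assumes w: "smooth_on UNIV w" "\<And>x. norm x \<le> r1 \<Longrightarrow> w x = 1" "\<And>x. norm x \<ge> r2 \<Longrightarrow> w x = 0" and r1: "\<rho> < r1"
    and a: "Ck_on 2 S a" "\<And>x. norm x > \<rho> \<Longrightarrow> lap a x = - \<kappa> * a x"
  shows "sq_integrable (defect w \<kappa> a)"
  by (rule sq_integrable_continuous_compact[OF compact_cball[of 0 r2] defect_continuous[OF w(1,2) r1 a]])
     (use defect_outer[OF w(3)] in auto)

text \<open>The terms with \<open>\<kappa>\<close> cancel, so the integrand is that of Green's
  identity for \<open>f\<close> and \<open>w * a\<close>. On the inner circle \<open>w = 1\<close>;
  hence pairing the commutator with a solution of the same equation recovers the Wronskian of the
  uncut fields.\<close>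

lemma defect_area_integral:
  assumes w: "smooth_on UNIV w" "\<And>x. norm x \<le> r1 \<Longrightarrow> w x = 1" "\<And>x. norm x \<ge> r2 \<Longrightarrow> w x = 0"
    and r: "\<rho> < r0" "r0 < r1" "r1 \<le> r2"
    and a: "Ck_on 2 S a" "\<And>x. norm x > \<rho> \<Longrightarrow> lap a x = - \<kappa> * a x"
    and f: "Ck_on 2 S f" "\<And>x. norm x > \<rho> \<Longrightarrow> lap f x = - \<kappa> * f x"
  shows "(LINT x|lborel. f x * defect w \<kappa> a x) = - wronskian f a r0"
proof -
  have r1: "\<rho> < r1" using r by simp
  have C: "Ck_on 2 S (\<lambda>x. w x * a x)" by (rule cutoff_Ck[OF w(1) a(1)])
  have "continuous_on {x. norm x > \<rho>} f"
    using Ck_on_imp_continuous_on[OF f(1)] exterior_subset(1) by (rule continuous_on_subset)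
  then have 1: "continuous_on {x. norm x > \<rho>} (\<lambda>x. f x * defect w \<kappa> a x)"
    using continuous_on_subset[OF defect_continuous[OF w(1,2) r1 a] subset_UNIV] by (rule continuous_on_mult)
  have "continuous_on (ball 0 r1) (\<lambda>x::real^2. 0::complex)" by simp
  then have 2: "continuous_on (ball 0 r1) (\<lambda>x. f x * defect w \<kappa> a x)"
    by (rule continuous_on_eq) (use defect_inner[OF w(2) a(2)] in auto)
  have "{x. norm x > \<rho>} \<union> ball (0::real^2) r1 = UNIV" using r1 by auto
  then have cont: "continuous_on UNIV (\<lambda>x. f x * defect w \<kappa> a x)"
    using continuous_on_open_Un[OF exterior_subset(2) open_ball 1 2] by simp
  have "(LINT x|lborel. f x * defect w \<kappa> a x) = - wronskian f (\<lambda>x. w x * a x) r0"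
  \<comment> \<open>The outer radius is \<open>r2 + 1\<close> because \<open>defect_outer\<close>
    asks for \<open>norm x > r2\<close>, where \<open>w\<close> vanishes in a neighbourhood.\<close>
  proof (rule wronskian_eq_area_integral[OF f(1) C r(1) _ _ cont, of "r2 + 1"])
    show "r0 \<le> r2 + 1" using r by simp
    show "norm x \<ge> r2 + 1 \<Longrightarrow> w x * a x = 0" for x using w(3)[of x] by simp
    show "norm x \<le> r0 \<Longrightarrow> f x * defect w \<kappa> a x = 0" for x
      using defect_inner[of r1 w a \<kappa> x, OF w(2) a(2)] r by simp
    show "norm x \<ge> r2 + 1 \<Longrightarrow> f x * defect w \<kappa> a x = 0" for x
      using defect_outer[of r2 w x, OF w(3)] by simp
    show "f x * defect w \<kappa> a x = f x * lap (\<lambda>x. w x * a x) x - w x * a x * lap f x" if "r0 \<le> norm x" for x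
      using that r f(2)[of x] by (simp add: defect_def algebra_simps)
  qed
  also have "wronskian f (\<lambda>x. w x * a x) r0 = wronskian f a r0"
  proof -
    have n: "norm (polar r0 t) < r1" for t using r rho by simp
    have "pd i (\<lambda>x. w x * a x) (polar r0 t) = pd i a (polar r0 t)" for i t
      by (rule pd_cong_open[OF open_ball[of 0 r1]]) (use n w(2) in auto)
    then have "radial (\<lambda>x. w x * a x) r0 t = radial a r0 t" for t by (simp add: radial_def)
    moreover have "w (polar r0 t) = 1" for t using n[of t] w(2) by simp
    ultimately show ?thesis by (simp add: wronskian_def pairing_def)
  qed
  finally show ?thesis .
qed

text \<open>With \<open>A = w * a\<close> and its defect \<open>P\<close>,
  \<open>lap A = P - \<kappa> * A\<close> beyond \<open>\<rho>\<close>, and Green's identity applied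
  twice gives the formula with \<open>\<psi>\<close> throughout. \<open>\<psi>\<close> keeps away
  from the ball of radius \<open>\<rho>\<close>. As \<open>P\<close> vanishes below
  \<open>r1 > s\<close>, \<open>\<psi>\<close> may be replaced by \<open>\<phi>\<close> in the terms
  with \<open>P\<close>.\<close>

lemma defect_green:
  assumes w: "smooth_on UNIV w" "\<And>x. norm x \<le> r1 \<Longrightarrow> w x = 1" and r: "\<rho> < r0" "r0 < s" "s < r1"
    and a: "Ck_on 2 S a" "\<And>x. norm x > \<rho> \<Longrightarrow> lap a x = - \<kappa> * a x"
    and \<phi>: "test_function UNIV \<phi>" and \<psi>: "test_function UNIV \<psi>" "\<And>x. norm x \<le> r0 \<Longrightarrow> \<psi> x = 0"
      "\<And>x. norm x \<ge> s \<Longrightarrow> \<psi> x = \<phi> x"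
  shows "(LINT x|lborel. w x * a x * lap (lap \<psi>) x) =
    (LINT x|lborel. defect w \<kappa> a x * lap \<phi> x) - \<kappa> * (LINT x|lborel. defect w \<kappa> a x * \<phi> x)
     + \<kappa>\<^sup>2 * (LINT x|lborel. w x * a x * \<psi> x)"
proof -
  define E where "E = {x::real^2. norm x > \<rho>}"
  define A where "A = (\<lambda>x. w x * a x)"
  define P where "P = defect w \<kappa> a"
  have E: "open E" "E \<subseteq> S" using exterior_subset by (auto simp: E_def)
  have A2: "Ck_on 2 E A" unfolding A_def by (rule Ck_on_subset[OF cutoff_Ck[OF w(1) a(1)] E(2)])
  have cA: "continuous_on E A" by (rule Ck_on_imp_continuous_on[OF A2])
  have cP: "continuous_on UNIV P" unfolding P_def
    using defect_continuous[OF w _ a] r by simp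
  obtain B where B: "smooth_on UNIV \<psi>" "\<And>x. norm x > B \<Longrightarrow> \<psi> x = 0"
    using test_function_bounded_support[OF \<psi>(1)] by blast
  define K where "K = cball 0 B - ball (0::real^2) r0"
  have K: "compact K" "K \<subseteq> E" unfolding K_def E_def using r by (auto intro: compact_diff)
  have \<psi>0: "\<psi> x = 0" if "x \<notin> K" for x
    using that B(2)[of x] \<psi>(2)[of x] by (auto simp: K_def not_le)
  have l0: "lap \<psi> x = 0" if "x \<notin> K" for x
    using lap_support[OF compact_imp_closed[OF K(1)] \<psi>0 that] .
  have sl: "smooth_on UNIV (lap \<psi>)" by (rule smooth_on_lap[OF open_UNIV B(1)])
  note C = smooth_on_imp_Ck[OF B(1), of 2] smooth_on_imp_Ck[OF sl, of 2]
  note cc = C[THEN Ck_on_imp_continuous_on]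
  have lA: "lap A x = P x - \<kappa> * A x" if "x \<in> E" for x
    using that by (simp add: P_def defect_def A_def E_def)
  have iP: "integrable lborel (\<lambda>x. P x * lap \<psi> x)" "integrable lborel (\<lambda>x. P x * \<psi> x)"
    by (rule continuous_on_mult_support[OF cP _ K(1)]; use cc l0 \<psi>0 in simp)+
  have iA: "integrable lborel (\<lambda>x. A x * lap \<psi> x)" "integrable lborel (\<lambda>x. A x * \<psi> x)"
    by (rule continuous_on_mult_support[OF cA _ K]; use cc l0 \<psi>0 in simp)+
  have mult: "lap A x * \<xi> x = P x * \<xi> x - \<kappa> * (A x * \<xi> x)" if "\<And>x. x \<notin> K \<Longrightarrow> \<xi> x = 0" for \<xi> x
  proof (cases "x \<in> K")
    case True
    then have "lap A x * \<xi> x = (P x - \<kappa> * A x) * \<xi> x" using lA K(2) by auto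
    then show ?thesis by (simp add: algebra_simps)
  qed (use that in simp)
  have m1: "lap A x * lap \<psi> x = P x * lap \<psi> x - \<kappa> * (A x * lap \<psi> x)" for x
    using l0 by (rule mult)
  have m2: "lap A x * \<psi> x = P x * \<psi> x - \<kappa> * (A x * \<psi> x)" for x
    using \<psi>0 by (rule mult)
  have "(LINT x|lborel. A x * lap (lap \<psi>) x) = (LINT x|lborel. lap A x * lap \<psi> x)"
    by (rule integral_green[symmetric, OF E(1) A2 C(2) K l0])
  also have "\<dots> = (LINT x|lborel. P x * lap \<psi> x) - \<kappa> * (LINT x|lborel. A x * lap \<psi> x)"
    unfolding m1 m2 using iP iA by simp
  also have "(LINT x|lborel. A x * lap \<psi> x) = (LINT x|lborel. lap A x * \<psi> x)"
    by (rule integral_green[symmetric, OF E(1) A2 C(1) K \<psi>0])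
  also have "\<dots> = (LINT x|lborel. P x * \<psi> x) - \<kappa> * (LINT x|lborel. A x * \<psi> x)"
    unfolding m1 m2 using iP iA by simp
  finally have *: "(LINT x|lborel. A x * lap (lap \<psi>) x) = (LINT x|lborel. P x * lap \<psi> x) -
    \<kappa> * (LINT x|lborel. P x * \<psi> x) + \<kappa>\<^sup>2 * (LINT x|lborel. A x * \<psi> x)"
    by (simp add: algebra_simps power2_eq_square)
  have P0: "P x = 0" if "norm x < r1" for x
    unfolding P_def using defect_inner[of r1 w a \<kappa> x, OF w(2) a(2)] that by simp
  have Pe: "P x * lap \<psi> x = P x * lap \<phi> x" "P x * \<psi> x = P x * \<phi> x" for x
  proof -
    show "P x * \<psi> x = P x * \<phi> x" using P0[of x] \<psi>(3)[of x] r by (cases "norm x < r1") auto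
    have "lap \<psi> x = lap \<phi> x" if "norm x \<ge> r1"
    proof (rule lap_cong_open)
      show "open {x::real^2. norm x > s}" by (intro open_Collect_less continuous_intros)
    qed (use that r \<psi>(3) in auto)
    then show "P x * lap \<psi> x = P x * lap \<phi> x" using P0[of x] by (cases "norm x < r1") auto
  qed
  show ?thesis using *[unfolded Pe] unfolding A_def P_def .
qed

text \<open>Here \<open>\<kappa>\<close> stands for \<open>k\<^sup>2\<close> and \<open>N\<close> for \<open>k\<^sup>4 n\<close>; \<open>a\<close> is the incident plus the propagating field and
  \<open>b\<close> the evanescent field.\<close>

definition total_field ::
  "complex \<Rightarrow> (real^2 \<Rightarrow> complex) \<Rightarrow> (real^2 \<Rightarrow> complex) \<Rightarrow> (real^2 \<Rightarrow> complex) \<Rightarrow> (real^2 \<Rightarrow> complex) \<Rightarrow> bool" where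
  "total_field \<kappa> N u a b \<longleftrightarrow>
     (\<forall>R. sq_integrable (\<lambda>x. indicator (cball 0 R) x * u x)) \<and>
     Ck_on 2 S a \<and> Ck_on 2 S b \<and>
     (\<forall>x. norm x > \<rho> \<longrightarrow> u x = a x + b x \<and> lap a x = - \<kappa> * a x \<and> lap b x = \<kappa> * b x) \<and>
     (\<forall>\<phi>. test_function UNIV \<phi> \<longrightarrow>
        (LINT x|lborel. u x * lap (lap \<phi>) x) = (LINT x|lborel. N x * u x * \<phi> x))"

lemma sq_integrable_cutoff:
  assumes u: "\<And>R. sq_integrable (\<lambda>x. indicator (cball 0 R) x * u x)"
    and w: "continuous_on UNIV w" "\<And>x. norm x \<ge> r2 \<Longrightarrow> w x = 0"
  shows "sq_integrable (\<lambda>x. w x * u x)"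
proof -
  obtain M where "\<And>x. norm (w x) \<le> M"
    using bounded_continuous_compact[OF compact_cball[of 0 r2] continuous_on_subset[OF w(1)]] w(2)
    by (metis linear mem_cball_0 subset_UNIV)
  then have "sq_integrable (\<lambda>x. w x * (indicator (cball 0 r2) x * u x))"
    by (rule sq_integrable_mult_bounded[OF u borel_measurable_continuous_onI[OF w(1)]])
  moreover have "w x * (indicator (cball 0 r2) x * u x) = w x * u x" for x
    using w(2)[of x] by (auto simp: indicator_def)
  ultimately show ?thesis by simp
qed

text \<open>The weak form of \<open>lap (lap (w * u)) = N * w * u + \<kappa> * (Q - P) + lap (P +
  Q)\<close>, with the defects \<open>P\<close> of \<open>a\<close> and \<open>Q\<close> of
  \<open>b\<close>. Near the scatterer \<open>w = 1\<close> and the weak equation of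
  \<open>u\<close> applies; further out \<open>u = a + b\<close> is regular enough for
  \<open>defect_green\<close>. Splitting the test function joins the two regions.\<close>

lemma cutoff_equation:
  assumes u: "total_field \<kappa> N u a b" and N: "N \<in> borel_measurable borel" "\<And>x. norm (N x) \<le> M"
      "\<And>x. norm x > \<rho> \<Longrightarrow> N x = \<kappa>\<^sup>2"
    and w: "smooth_on UNIV w" "\<And>x. norm x \<le> r1 \<Longrightarrow> w x = 1" "\<And>x. norm x \<ge> r2 \<Longrightarrow> w x = 0" and r1: "\<rho> < r1"
    and \<phi>: "test_function UNIV \<phi>"
  shows "(LINT x|lborel. w x * u x * lap (lap \<phi>) x) = (LINT x|lborel. N x * (w x * u x) * \<phi> x)
    + \<kappa> * (LINT x|lborel. (defect w (- \<kappa>) b x - defect w \<kappa> a x) * \<phi> x)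
    + (LINT x|lborel. (defect w \<kappa> a x + defect w (- \<kappa>) b x) * lap \<phi> x)"
proof -
  have uloc: "\<And>R. sq_integrable (\<lambda>x. indicator (cball 0 R) x * u x)"
    and a: "Ck_on 2 S a" "\<And>x. norm x > \<rho> \<Longrightarrow> lap a x = - \<kappa> * a x"
    and b: "Ck_on 2 S b" "\<And>x. norm x > \<rho> \<Longrightarrow> lap b x = - (- \<kappa>) * b x"
    and uab: "\<And>x. norm x > \<rho> \<Longrightarrow> u x = a x + b x"
    and weak: "\<And>\<phi>. test_function UNIV \<phi> \<Longrightarrow>
        (LINT x|lborel. u x * lap (lap \<phi>) x) = (LINT x|lborel. N x * u x * \<phi> x)"
    using u by (auto simp: total_field_def)
  define P Q where "P = defect w \<kappa> a" and "Q = defect w (- \<kappa>) b"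
  \<comment> \<open>The points at one and two thirds of the way from \<open>\<rho>\<close> to
    \<open>r1\<close>: \<open>\<phi>1\<close> lives where \<open>w = 1\<close>, and
    \<open>\<phi>2\<close> vanishes on a neighbourhood of the ball of radius \<open>\<rho>\<close>,
    beyond which \<open>u = a + b\<close>.\<close>
  define r0 s where "r0 = \<rho> + (r1 - \<rho>) / 3" and "s = \<rho> + 2 * (r1 - \<rho>) / 3"
  have rs: "\<rho> < r0" "r0 < s" "s < r1" "0 < r0" using r1 rho by (auto simp: r0_def s_def field_simps)
  obtain v :: "real^2 \<Rightarrow> complex" where v: "smooth_on UNIV v" "\<And>x. norm x \<le> r0 \<Longrightarrow> v x = 1" "\<And>x. norm x \<ge> s \<Longrightarrow> v x = 0"
    using smooth_cutoff[OF rs(4,2)] by auto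
  define \<phi>1 where "\<phi>1 = (\<lambda>x. v x * \<phi> x)"
  define \<phi>2 where "\<phi>2 = (\<lambda>x. (1 - v x) * \<phi> x)"
  have t1: "test_function UNIV \<phi>1" unfolding \<phi>1_def by (rule test_function_mult[OF v(1) \<phi>])
  have t2: "test_function UNIV \<phi>2" unfolding \<phi>2_def
    by (rule test_function_mult[OF smooth_on_diff[OF open_UNIV smooth_on_const v(1)] \<phi>])
  have \<phi>12: "\<phi> x = \<phi>1 x + \<phi>2 x" for x by (simp add: \<phi>1_def \<phi>2_def algebra_simps)
  have lap12: "lap (lap \<phi>) x = lap (lap \<phi>1) x + lap (lap \<phi>2) x" for x
  proof -
    have "\<phi> = (\<lambda>x. \<phi>1 x + \<phi>2 x)" using \<phi>12 by blast
    then show ?thesis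
      using lap_add_test[OF t1 t2] lap_add_test[OF t1[THEN test_function_lap] t2[THEN test_function_lap]] by simp
  qed
  have wu: "sq_integrable (\<lambda>x. w x * u x)"
    by (rule sq_integrable_cutoff[OF uloc Ck_on_imp_continuous_on[OF smooth_on_imp_Ck[OF w(1)]] w(3)])
  have Nwu: "sq_integrable (\<lambda>x. N x * (w x * u x))" by (rule sq_integrable_mult_bounded[OF wu N(1,2)])
  have sP: "sq_integrable P" unfolding P_def by (rule defect_sq_integrable[OF w r1 a])
  have sQ: "sq_integrable Q" unfolding Q_def by (rule defect_sq_integrable[OF w r1 b])
  note tsq = test_function_sq_integrable
  have 1: "(LINT x|lborel. w x * u x * lap (lap \<phi>1) x) = (LINT x|lborel. N x * (w x * u x) * \<phi>1 x)"
  proof -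
    have z: "\<phi>1 x = 0" if "norm x > s" for x using v(3)[of x] that by (simp add: \<phi>1_def)
    have "lap (lap \<phi>1) x = 0" if "norm x > s" for x
      by (rule lap_support_norm[OF lap_support_norm[OF z] that])
    then have A1: "w x * u x * lap (lap \<phi>1) x = u x * lap (lap \<phi>1) x" for x
      using w(2)[of x] rs by (cases "norm x \<le> s") auto
    have A2: "N x * (w x * u x) * \<phi>1 x = N x * u x * \<phi>1 x" for x
      using w(2)[of x] rs z[of x] by (cases "norm x \<le> s") auto
    show ?thesis unfolding A1 A2 by (rule weak[OF t1])
  qed
  have z2: "\<phi>2 x = 0" if "norm x \<le> r0" for x using that v(2) by (simp add: \<phi>2_def)
  have e2: "\<phi>2 x = \<phi> x" if "norm x \<ge> s" for x using that v(3) by (simp add: \<phi>2_def)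
  have ll0: "lap (lap \<phi>2) x = 0" if "norm x < r0" for x
  proof (rule lap_zero_open[OF open_ball[of 0 r0]])
    show "lap \<phi>2 y = 0" if "y \<in> ball 0 r0" for y
      by (rule lap_zero_open[OF open_ball[of 0 r0] that]) (use z2 in auto)
  qed (use that in auto)
  obtain B2 where B2: "smooth_on UNIV \<phi>2" "\<And>x. norm x > B2 \<Longrightarrow> \<phi>2 x = 0"
    using test_function_bounded_support[OF t2] by blast
  have int: "integrable lborel (\<lambda>x. w x * c x * \<xi> x)"
    if "Ck_on 2 S c" "continuous_on UNIV \<xi>" "\<And>x. norm x > B2 \<Longrightarrow> \<xi> x = 0" "\<And>x. norm x < r0 \<Longrightarrow> \<xi> x = 0" for c \<xi>
  proof (rule continuous_on_mult_support[OF Ck_on_imp_continuous_on[OF cutoff_Ck[OF w(1) that(1)]] that(2)])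
    show "compact (cball 0 B2 - ball (0::real^2) r0)" by (intro compact_diff) auto
    show "cball 0 B2 - ball 0 r0 \<subseteq> S" using ext rs by auto
    show "x \<notin> cball 0 B2 - ball 0 r0 \<Longrightarrow> \<xi> x = 0" for x using that(3,4)[of x] by auto
  qed
  have cll: "continuous_on UNIV (lap (lap \<phi>2))" "continuous_on UNIV \<phi>2"
    using smooth_on_lap[OF open_UNIV smooth_on_lap[OF open_UNIV B2(1)]] B2(1)
    by (auto intro: Ck_on_imp_continuous_on smooth_on_imp_Ck)
  have llB: "norm x > B2 \<Longrightarrow> lap (lap \<phi>2) x = 0" for x
    by (rule lap_support_norm[OF lap_support_norm[OF B2(2)]])
  have i: "integrable lborel (\<lambda>x. w x * a x * lap (lap \<phi>2) x)" "integrable lborel (\<lambda>x. w x * b x * lap (lap \<phi>2) x)"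
    "integrable lborel (\<lambda>x. w x * a x * \<phi>2 x)" "integrable lborel (\<lambda>x. w x * b x * \<phi>2 x)"
    using cll llB ll0 B2(2) z2 by (auto intro!: int a(1) b(1))
  have "(LINT x|lborel. w x * u x * lap (lap \<phi>2) x) =
    (LINT x|lborel. w x * a x * lap (lap \<phi>2) x + w x * b x * lap (lap \<phi>2) x)"
  proof (rule Bochner_Integration.integral_cong[OF refl])
    show "w x * u x * lap (lap \<phi>2) x = w x * a x * lap (lap \<phi>2) x + w x * b x * lap (lap \<phi>2) x" for x
      using ll0[of x] uab[of x] rs by (cases "norm x < r0") (auto simp: algebra_simps)
  qed
  also have "\<dots> = (LINT x|lborel. w x * a x * lap (lap \<phi>2) x) + (LINT x|lborel. w x * b x * lap (lap \<phi>2) x)"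
    using i by simp
  \<comment> \<open>The evanescent part has \<open>- \<kappa>\<close> in place of
    \<open>\<kappa>\<close>: the middle term changes sign, while both squares are the value of
    \<open>N\<close> beyond \<open>\<rho>\<close>.\<close>
  also have "\<dots> = ((LINT x|lborel. P x * lap \<phi> x) - \<kappa> * (LINT x|lborel. P x * \<phi> x) + \<kappa>\<^sup>2 * (LINT x|lborel. w x * a x * \<phi>2 x))
     + ((LINT x|lborel. Q x * lap \<phi> x) - (- \<kappa>) * (LINT x|lborel. Q x * \<phi> x) + (- \<kappa>)\<^sup>2 * (LINT x|lborel. w x * b x * \<phi>2 x))"
    unfolding P_def Q_def
    by (subst defect_green[OF w(1,2) rs(1-3) a \<phi> t2 z2 e2], assumption+,
        subst defect_green[OF w(1,2) rs(1-3) b \<phi> t2 z2 e2], assumption+, rule refl)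
  also have "\<dots> = ((LINT x|lborel. P x * lap \<phi> x) + (LINT x|lborel. Q x * lap \<phi> x))
     + \<kappa> * ((LINT x|lborel. Q x * \<phi> x) - (LINT x|lborel. P x * \<phi> x))
     + \<kappa>\<^sup>2 * ((LINT x|lborel. w x * a x * \<phi>2 x) + (LINT x|lborel. w x * b x * \<phi>2 x))"
    by (simp add: algebra_simps)
  also have "(LINT x|lborel. P x * lap \<phi> x) + (LINT x|lborel. Q x * lap \<phi> x) = (LINT x|lborel. (P x + Q x) * lap \<phi> x)"
    using sq_integrable_mult[OF sP tsq[OF test_function_lap[OF \<phi>]]] sq_integrable_mult[OF sQ tsq[OF test_function_lap[OF \<phi>]]]
    by (simp add: distrib_right)
  also have "(LINT x|lborel. Q x * \<phi> x) - (LINT x|lborel. P x * \<phi> x) = (LINT x|lborel. (Q x - P x) * \<phi> x)"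
    using sq_integrable_mult[OF sP tsq[OF \<phi>]] sq_integrable_mult[OF sQ tsq[OF \<phi>]]
    by (simp add: left_diff_distrib)
  also have "\<kappa>\<^sup>2 * ((LINT x|lborel. w x * a x * \<phi>2 x) + (LINT x|lborel. w x * b x * \<phi>2 x)) =
     (LINT x|lborel. \<kappa>\<^sup>2 * (w x * a x * \<phi>2 x + w x * b x * \<phi>2 x))"
    using i by simp
  also have "\<dots> = (LINT x|lborel. N x * (w x * u x) * \<phi>2 x)"
  proof (rule Bochner_Integration.integral_cong[OF refl])
    show "\<kappa>\<^sup>2 * (w x * a x * \<phi>2 x + w x * b x * \<phi>2 x) = N x * (w x * u x) * \<phi>2 x" for x
      using z2[of x] uab[of x] N(3)[of x] rs by (cases "norm x < r0") (auto simp: algebra_simps)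
  qed
  finally have 2: "(LINT x|lborel. w x * u x * lap (lap \<phi>2) x) = (LINT x|lborel. (P x + Q x) * lap \<phi> x)
     + \<kappa> * (LINT x|lborel. (Q x - P x) * \<phi> x) + (LINT x|lborel. N x * (w x * u x) * \<phi>2 x)" .
  have "(LINT x|lborel. w x * u x * lap (lap \<phi>) x) =
     (LINT x|lborel. w x * u x * lap (lap \<phi>1) x) + (LINT x|lborel. w x * u x * lap (lap \<phi>2) x)"
    unfolding lap12 distrib_left
    using sq_integrable_mult[OF wu] t1 t2 by (intro Bochner_Integration.integral_add) (auto intro!: tsq test_function_lap)
  moreover have "(LINT x|lborel. N x * (w x * u x) * \<phi> x) =
     (LINT x|lborel. N x * (w x * u x) * \<phi>1 x) + (LINT x|lborel. N x * (w x * u x) * \<phi>2 x)"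
    unfolding \<phi>12 distrib_left
    using sq_integrable_mult[OF Nwu] t1 t2 by (intro Bochner_Integration.integral_add) (auto intro!: tsq)
  ultimately show ?thesis using 1 2 unfolding P_def Q_def by simp
qed

end

section \<open>Testing one total field with the mollified cutoff of the other\<close>

lemma sq_integrable_indicator:
  fixes f :: "'a::euclidean_space \<Rightarrow> complex"
  assumes "compact A" "continuous_on A f"
  shows "sq_integrable (\<lambda>x. indicator A x * f x)"
proof -
  have "(\<lambda>x. indicator A x *\<^sub>R f x) \<in> borel_measurable borel"
    using borel_closed[OF compact_imp_closed[OF assms(1)]] assms(2)
    by (intro borel_measurable_continuous_on_indicator) auto
  then have "(\<lambda>x. indicator A x * f x) \<in> borel_measurable borel"
    by (simp add: indicator_scaleR_eq_if indicator_times_eq_if)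
  moreover have "integrable lborel (\<lambda>x. indicator A x *\<^sub>R (norm (f x))\<^sup>2)"
    using assms by (intro borel_integrable_compact continuous_intros)
  then have "integrable lborel (\<lambda>x. (norm (indicator A x * f x))\<^sup>2)"
    by (rule back_subst[of "integrable lborel"]) (auto simp: indicator_def)
  ultimately show ?thesis by (simp add: sq_integrable_def)
qed

lemma sq_integrable_imp_integrable:
  fixes f :: "'a::euclidean_space \<Rightarrow> complex"
  assumes "sq_integrable f" "\<And>x. norm x > R \<Longrightarrow> f x = 0"
  shows "integrable lborel f"
proof -
  have "sq_integrable (\<lambda>x::'a. indicator (cball 0 R) x * (1::complex))"
    by (rule sq_integrable_indicator) auto
  from sq_integrable_mult[OF assms(1) this]
  show ?thesis by (rule back_subst[of "integrable lborel"]) (use assms(2) in \<open>force simp: indicator_def\<close>)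
qed

lemma conv_add:
  assumes "integrable lborel f" "integrable lborel g" "continuous_on UNIV \<eta>" "compact K" "\<And>x. x \<notin> K \<Longrightarrow> \<eta> x = 0"
  shows "conv (\<lambda>y. f y + g y) \<eta> x = conv f \<eta> x + conv g \<eta> x"
    and "conv (\<lambda>y. f y - g y) \<eta> x = conv f \<eta> x - conv g \<eta> x"
  using integrable_conv[OF assms(1,3-5), of x] integrable_conv[OF assms(2,3-5), of x]
  unfolding conv_def by (simp_all add: distrib_right left_diff_distrib)

context exterior begin

text \<open>Inserting the reflected kernel into \<open>cutoff_equation\<close> computes the squared
  Laplacian of \<open>conv (w * u1) \<eta>\<close> pointwise, and this convolution is a test
  function for \<open>u2\<close>. The condition \<open>e < r1 - r\<close> keeps the mollified
  defects out of \<open>ball 0 r\<close>, and \<open>e \<le> 1\<close> keeps all supports inside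
  \<open>cball 0 (r2 + 1)\<close>; so the defects live on the annulus \<open>V\<close>, where
  \<open>u2 = a2 + b2\<close>.\<close>

lemma mollified_equation:
  assumes u1: "total_field \<kappa> N u1 a1 b1" and u2: "total_field \<kappa> N u2 a2 b2"
    and N: "N \<in> borel_measurable borel" "\<And>x. norm (N x) \<le> M" "\<And>x. norm x > \<rho> \<Longrightarrow> N x = \<kappa>\<^sup>2"
    and w: "smooth_on UNIV w" "\<And>x. norm x \<le> r1 \<Longrightarrow> w x = 1" "\<And>x. norm x \<ge> r2 \<Longrightarrow> w x = 0"
    and r: "\<rho> < r" "r < r1" "r1 \<le> r2"
    and \<eta>: "smooth_on UNIV \<eta>" "\<And>x. norm x \<ge> e \<Longrightarrow> \<eta> x = 0" and e: "e > 0" "e \<le> 1" "e < r1 - r"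
    and P: "P = defect w \<kappa> a1" and Q: "Q = defect w (- \<kappa>) b1"
    and V: "V = cball 0 (r2 + 1) - ball (0::real^2) r"
  shows "(LINT x|lborel. (indicator (cball 0 (r2 + 1)) x * u2 x) * conv (\<lambda>x. N x * (w x * u1 x)) \<eta> x)
     + 2 * \<kappa> * ((LINT x|lborel. (indicator V x * b2 x) * conv Q \<eta> x)
       - (LINT x|lborel. (indicator V x * a2 x) * conv P \<eta> x))
     = (LINT x|lborel. (N x * (indicator (cball 0 (r2 + 1)) x * u2 x)) * conv (\<lambda>x. w x * u1 x) \<eta> x)"
proof -
  have u1loc: "\<And>R. sq_integrable (\<lambda>x. indicator (cball 0 R) x * u1 x)"
    and a1: "Ck_on 2 S a1" "\<And>x. norm x > \<rho> \<Longrightarrow> lap a1 x = - \<kappa> * a1 x"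
    and b1: "Ck_on 2 S b1" "\<And>x. norm x > \<rho> \<Longrightarrow> lap b1 x = - (- \<kappa>) * b1 x"
    using u1 by (auto simp: total_field_def)
  have u2loc: "\<And>R. sq_integrable (\<lambda>x. indicator (cball 0 R) x * u2 x)"
    and a2: "Ck_on 2 S a2" "\<And>x. norm x > \<rho> \<Longrightarrow> lap a2 x = - \<kappa> * a2 x"
    and b2: "Ck_on 2 S b2" "\<And>x. norm x > \<rho> \<Longrightarrow> lap b2 x = \<kappa> * b2 x"
    and uab: "\<And>x. norm x > \<rho> \<Longrightarrow> u2 x = a2 x + b2 x"
    and weak: "\<And>\<phi>. test_function UNIV \<phi> \<Longrightarrow>
        (LINT x|lborel. u2 x * lap (lap \<phi>) x) = (LINT x|lborel. N x * u2 x * \<phi> x)"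
    using u2 by (auto simp: total_field_def)
  have r1: "\<rho> < r1" using r by simp
  define T where "T = (\<lambda>x. w x * u1 x)"
  have T: "sq_integrable T" unfolding T_def
    by (rule sq_integrable_cutoff[OF u1loc Ck_on_imp_continuous_on[OF smooth_on_imp_Ck[OF w(1)]] w(3)])
  have NT: "sq_integrable (\<lambda>x. N x * T x)" by (rule sq_integrable_mult_bounded[OF T N(1,2)])
  have P2: "sq_integrable P" unfolding P by (rule defect_sq_integrable[OF w r1 a1])
  have Q2: "sq_integrable Q" unfolding Q by (rule defect_sq_integrable[OF w r1 b1])
  have T0: "T x = 0" "N x * T x = 0" if "norm x > r2" for x using w(3)[of x] that by (auto simp: T_def)
  have P0: "P x = 0" if "norm x > r2 \<or> norm x < r1" for x
    using that defect_outer[of r2 w x, OF w(3)] defect_inner[of r1 w a1 \<kappa> x, OF w(2) a1(2)] by (auto simp: P)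
  have Q0: "Q x = 0" if "norm x > r2 \<or> norm x < r1" for x
    using that defect_outer[of r2 w x, OF w(3)] defect_inner[of r1 w b1 "- \<kappa>" x, OF w(2) b1(2)] by (auto simp: Q)
  have iT: "integrable lborel T" by (rule sq_integrable_imp_integrable[OF T T0(1)])
  have iNT: "integrable lborel (\<lambda>x. N x * T x)" by (rule sq_integrable_imp_integrable[OF NT T0(2)])
  have iP: "integrable lborel P" by (rule sq_integrable_imp_integrable[OF P2, of r2]) (use P0 in simp)
  have iQ: "integrable lborel Q" by (rule sq_integrable_imp_integrable[OF Q2, of r2]) (use Q0 in simp)
  have cK: "compact (cball (0::real^2) e)" by simp
  have \<eta>K: "\<eta> x = 0" if "x \<notin> cball 0 e" for x using \<eta>(2)[of x] that by simp
  have \<eta>K': "\<forall>x. x \<notin> cball 0 e \<longrightarrow> \<eta> x = 0" using \<eta>K by blast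
  have l\<eta>: "smooth_on UNIV (lap \<eta>)" by (rule smooth_on_lap[OF open_UNIV \<eta>(1)])
  have l\<eta>K: "\<forall>x. x \<notin> cball 0 e \<longrightarrow> lap \<eta> x = 0"
  proof (intro allI impI)
    show "lap \<eta> x = 0" if "x \<notin> cball 0 e" for x by (rule lap_support[OF closed_cball \<eta>K that])
  qed
  have cont\<eta>: "continuous_on UNIV \<eta>" by (rule Ck_on_imp_continuous_on[OF smooth_on_imp_Ck[OF \<eta>(1)]])
  have conv_test: "test_function UNIV (conv g \<eta>)"
    if "integrable lborel g" "\<And>x. norm x > r2 \<Longrightarrow> g x = 0" for g
  proof (rule test_functionI[of _ "r2 + 1"])
    show "smooth_on UNIV (conv g \<eta>)" by (rule smooth_on_conv[OF that(1) \<eta>(1) cK \<eta>K])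
    show "conv g \<eta> x = 0" if "norm x > r2 + 1" for x
      by (rule conv_support[of r2 g e]) (use \<open>\<And>x. norm x > r2 \<Longrightarrow> g x = 0\<close> \<eta>(2) that e in auto)
  qed
  have tT: "test_function UNIV (conv T \<eta>)" by (rule conv_test[OF iT T0(1)])
  have tNT: "test_function UNIV (conv (\<lambda>x. N x * T x) \<eta>)" by (rule conv_test[OF iNT T0(2)])
  have tP: "test_function UNIV (conv P \<eta>)" by (rule conv_test[OF iP]) (use P0 in simp)
  have tQ: "test_function UNIV (conv Q \<eta>)" by (rule conv_test[OF iQ]) (use Q0 in simp)
  define U where "U = (\<lambda>x. conv P \<eta> x + conv Q \<eta> x)"
  have U: "U = conv (\<lambda>x. P x + Q x) \<eta>"
    unfolding U_def using conv_add(1)[OF iP iQ cont\<eta> cK \<eta>K] by auto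
  have tU: "test_function UNIV U" unfolding U
    by (rule conv_test) (use iP iQ P0 Q0 in auto)
  have eq: "lap (lap (conv T \<eta>)) x = conv (\<lambda>x. N x * T x) \<eta> x + \<kappa> * (conv Q \<eta> x - conv P \<eta> x) + lap U x" for x
  proof -
    define \<zeta> where "\<zeta> = (\<lambda>y. \<eta> (x - y))"
    have l1: "lap \<zeta> = (\<lambda>y. lap \<eta> (x - y))"
      unfolding \<zeta>_def using lap_reflect[OF smooth_on_imp_Ck[OF \<eta>(1)]] by blast
    have l2: "lap (lap \<zeta>) = (\<lambda>y. lap (lap \<eta>) (x - y))"
      unfolding l1 using lap_reflect[OF smooth_on_imp_Ck[OF l\<eta>]] by blast
    have t\<zeta>: "test_function UNIV \<zeta>"
    proof (rule test_functionI[of _ "norm x + e"])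
      show "smooth_on UNIV \<zeta>"
        unfolding \<zeta>_def smooth_on_def using Ck_on_reflect[OF smooth_on_imp_Ck[OF \<eta>(1)]] by blast
      show "\<zeta> y = 0" if "norm y > norm x + e" for y
        unfolding \<zeta>_def using that norm_triangle_ineq2[of y x] by (intro \<eta>(2)) (simp add: norm_minus_commute)
    qed
    have "lap (lap (conv T \<eta>)) x = conv T (lap (lap \<eta>)) x"
      using lap_conv[OF iT smooth_on_imp_Ck[OF \<eta>(1)] cK \<eta>K'] lap_conv[OF iT smooth_on_imp_Ck[OF l\<eta>] cK l\<eta>K] by simp
    also have "\<dots> = (LINT y|lborel. w y * u1 y * lap (lap \<zeta>) y)"
      unfolding conv_def l2 T_def ..
    also have "\<dots> = (LINT y|lborel. N y * (w y * u1 y) * \<zeta> y) + \<kappa> * (LINT y|lborel. (Q y - P y) * \<zeta> y)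
      + (LINT y|lborel. (P y + Q y) * lap \<zeta> y)"
      unfolding P Q by (rule cutoff_equation[OF u1 N w r1 t\<zeta>])
    also have "\<dots> = conv (\<lambda>x. N x * T x) \<eta> x + \<kappa> * conv (\<lambda>x. Q x - P x) \<eta> x + conv (\<lambda>x. P x + Q x) (lap \<eta>) x"
      unfolding conv_def l1 unfolding \<zeta>_def T_def ..
    also have "conv (\<lambda>x. Q x - P x) \<eta> x = conv Q \<eta> x - conv P \<eta> x"
      by (rule conv_add(2)[OF iQ iP cont\<eta> cK \<eta>K])
    also have "conv (\<lambda>x. P x + Q x) (lap \<eta>) x = lap U x"
      unfolding U using lap_conv[OF Bochner_Integration.integrable_add[OF iP iQ] smooth_on_imp_Ck[OF \<eta>(1)] cK \<eta>K'] by simp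
    finally show ?thesis .
  qed
  define u where "u = (\<lambda>x. indicator (cball 0 (r2 + 1)) x * u2 x)"
  have u: "sq_integrable u" unfolding u_def by (rule u2loc)
  have out: "conv T \<eta> x = 0" if "norm x > r2 + 1" for x
    by (rule conv_support[of r2 T e]) (use T0(1) \<eta>(2) that e in auto)
  have PQ0: "conv P \<eta> x = 0" "conv Q \<eta> x = 0" if xV: "x \<notin> V" for x
  proof -
    have "norm x > r2 + 1 \<or> norm x < r" using xV V by auto
    then consider "norm x \<ge> r2 + e" | "norm x \<le> r1 - e" using e by linarith
    then have "conv P \<eta> x = 0 \<and> conv Q \<eta> x = 0"
    proof cases
      case 1
      then show ?thesis
        using conv_support[of r2 P e \<eta> x] conv_support[of r2 Q e \<eta> x] P0 Q0 \<eta>(2) by auto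
    next
      case 2
      then show ?thesis
        using conv_support_inner[of r1 P e \<eta> x] conv_support_inner[of r1 Q e \<eta> x] P0 Q0 \<eta>(2) by auto
    qed
    then show "conv P \<eta> x = 0" "conv Q \<eta> x = 0" by auto
  qed
  have cV: "compact V" unfolding V by (intro compact_diff) auto
  have VS: "V \<subseteq> S" using V r ext by auto
  define \<alpha> \<beta> where "\<alpha> = (\<lambda>x. indicator V x * a2 x)" and "\<beta> = (\<lambda>x. indicator V x * b2 x)"
  have \<alpha>: "sq_integrable \<alpha>" and \<beta>: "sq_integrable \<beta>" unfolding \<alpha>_def \<beta>_def
    using sq_integrable_indicator[OF cV continuous_on_subset[OF Ck_on_imp_continuous_on VS]] a2(1) b2(1) by auto
  have uV: "u2 x = \<alpha> x + \<beta> x" if "x \<in> V" for x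
    using that uab[of x] V r by (auto simp: \<alpha>_def \<beta>_def)
  note tsq = test_function_sq_integrable
  \<comment> \<open>The weak equation of \<open>u2\<close> says nothing about a single Laplacian.
    But \<open>U\<close> lives in \<open>V\<close>, where Green's identity moves the Laplacian onto
    the regular field \<open>a2 + b2\<close>.\<close>
  have "(LINT x|lborel. u2 x * lap U x) = (LINT x|lborel. \<kappa> * ((\<beta> x - \<alpha> x) * U x))"
  proof -
    have U0: "U x = 0" if "x \<notin> V" for x using PQ0[OF that] by (simp add: U_def)
    have lU0: "lap U x = 0" if "x \<notin> V" for x
      by (rule lap_support[OF compact_imp_closed[OF cV] U0 that])
    have C: "Ck_on 2 S (\<lambda>x. a2 x + b2 x)" by (rule Ck_on_add[OF openS a2(1) b2(1)])
    have "(LINT x|lborel. u2 x * lap U x) = (LINT x|lborel. (a2 x + b2 x) * lap U x)"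
    proof (rule Bochner_Integration.integral_cong[OF refl])
      show "u2 x * lap U x = (a2 x + b2 x) * lap U x" for x
        using lU0[of x] uab[of x] V r by (cases "x \<in> V") auto
    qed
    also have "\<dots> = (LINT x|lborel. lap (\<lambda>x. a2 x + b2 x) x * U x)"
      using tU by (intro integral_green[symmetric, OF openS C _ cV VS U0]) (auto simp: test_function_def smooth_on_def)
    also have "\<dots> = (LINT x|lborel. \<kappa> * ((\<beta> x - \<alpha> x) * U x))"
    proof (rule Bochner_Integration.integral_cong[OF refl])
      fix x
      show "lap (\<lambda>x. a2 x + b2 x) x * U x = \<kappa> * ((\<beta> x - \<alpha> x) * U x)"
      proof (cases "x \<in> V")
        case True
        then have n: "norm x > \<rho>" using V r by auto
        have "lap (\<lambda>x. a2 x + b2 x) x = \<kappa> * (b2 x - a2 x)"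
          using lap_add[OF openS ext[OF n] a2(1) b2(1)] a2(2)[OF n] b2(2)[OF n] by (simp add: algebra_simps)
        then show ?thesis using True by (simp add: \<alpha>_def \<beta>_def)
      qed (simp add: U0)
    qed
    finally show ?thesis .
  qed
  note Green = this
  have i: "integrable lborel (\<lambda>x. u x * conv (\<lambda>x. N x * T x) \<eta> x)"
     "integrable lborel (\<lambda>x. u2 x * lap U x)"
     "integrable lborel (\<lambda>x. \<alpha> x * conv P \<eta> x)" "integrable lborel (\<lambda>x. \<beta> x * conv P \<eta> x)"
     "integrable lborel (\<lambda>x. \<alpha> x * conv Q \<eta> x)" "integrable lborel (\<lambda>x. \<beta> x * conv Q \<eta> x)"
  proof -
    have "integrable lborel (\<lambda>x. u x * lap U x)" by (rule sq_integrable_mult[OF u tsq[OF test_function_lap[OF tU]]])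
    moreover have "u x * lap U x = u2 x * lap U x" for x
    proof (cases "norm x > r2 + 1")
      case True
      have "lap U x = 0"
        by (rule lap_support_norm[OF _ True]) (use PQ0 V in \<open>auto simp: U_def\<close>)
      then show ?thesis by simp
    qed (simp add: u_def)
    ultimately show "integrable lborel (\<lambda>x. u2 x * lap U x)" by simp
  qed (intro sq_integrable_mult u \<alpha> \<beta> tsq tNT tP tQ)+
  have "(LINT x|lborel. u2 x * lap (lap (conv T \<eta>)) x) = (LINT x|lborel. u x * conv (\<lambda>x. N x * T x) \<eta> x
      + \<kappa> * ((\<alpha> x + \<beta> x) * (conv Q \<eta> x - conv P \<eta> x)) + u2 x * lap U x)"
  proof (rule Bochner_Integration.integral_cong[OF refl])
    fix x
    have 1: "u2 x * conv (\<lambda>x. N x * T x) \<eta> x = u x * conv (\<lambda>x. N x * T x) \<eta> x"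
      using conv_support[of r2 "\<lambda>x. N x * T x" e \<eta> x] T0(2) \<eta>(2) e
      by (cases "norm x \<le> r2 + 1") (auto simp: u_def)
    have 2: "u2 x * (conv Q \<eta> x - conv P \<eta> x) = (\<alpha> x + \<beta> x) * (conv Q \<eta> x - conv P \<eta> x)"
      using PQ0[of x] uV[of x] by (cases "x \<in> V") auto
    show "u2 x * lap (lap (conv T \<eta>)) x = u x * conv (\<lambda>x. N x * T x) \<eta> x
      + \<kappa> * ((\<alpha> x + \<beta> x) * (conv Q \<eta> x - conv P \<eta> x)) + u2 x * lap U x"
      unfolding eq 1[symmetric] 2[symmetric] by (simp add: algebra_simps)
  qed
  also have "\<dots> = (LINT x|lborel. u x * conv (\<lambda>x. N x * T x) \<eta> x)
     + (LINT x|lborel. \<kappa> * ((\<alpha> x + \<beta> x) * (conv Q \<eta> x - conv P \<eta> x))) + (LINT x|lborel. u2 x * lap U x)"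
    using i by (simp add: distrib_right right_diff_distrib)
  also have "\<dots> = (LINT x|lborel. u x * conv (\<lambda>x. N x * T x) \<eta> x)
     + ((LINT x|lborel. \<kappa> * ((\<alpha> x + \<beta> x) * (conv Q \<eta> x - conv P \<eta> x))) + (LINT x|lborel. \<kappa> * ((\<beta> x - \<alpha> x) * U x)))"
    unfolding Green by simp
  also have "(LINT x|lborel. \<kappa> * ((\<alpha> x + \<beta> x) * (conv Q \<eta> x - conv P \<eta> x))) + (LINT x|lborel. \<kappa> * ((\<beta> x - \<alpha> x) * U x))
     = (LINT x|lborel. \<kappa> * ((\<alpha> x + \<beta> x) * (conv Q \<eta> x - conv P \<eta> x)) + \<kappa> * ((\<beta> x - \<alpha> x) * U x))"
    using i unfolding U_def
    by (intro Bochner_Integration.integral_add[symmetric]) (simp_all add: distrib_right distrib_left right_diff_distrib left_diff_distrib)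
  \<comment> \<open>The products of \<open>\<alpha>\<close> with \<open>Q\<close> and of
    \<open>\<beta>\<close> with \<open>P\<close> cancel, and the others double: here the propagating
    and the evanescent parts separate.\<close>
  also have "\<dots> = (LINT x|lborel. 2 * \<kappa> * (\<beta> x * conv Q \<eta> x - \<alpha> x * conv P \<eta> x))"
    by (rule Bochner_Integration.integral_cong[OF refl]) (simp add: U_def algebra_simps)
  also have "\<dots> = 2 * \<kappa> * ((LINT x|lborel. \<beta> x * conv Q \<eta> x) - (LINT x|lborel. \<alpha> x * conv P \<eta> x))"
    using i by simp
  finally have "(LINT x|lborel. u x * conv (\<lambda>x. N x * T x) \<eta> x)
     + 2 * \<kappa> * ((LINT x|lborel. \<beta> x * conv Q \<eta> x) - (LINT x|lborel. \<alpha> x * conv P \<eta> x))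
     = (LINT x|lborel. N x * u2 x * conv T \<eta> x)"
    unfolding weak[OF tT] by simp
  also have "\<dots> = (LINT x|lborel. N x * u x * conv T \<eta> x)"
  proof (rule Bochner_Integration.integral_cong[OF refl])
    show "N x * u2 x * conv T \<eta> x = N x * u x * conv T \<eta> x" for x
      using out[of x] by (cases "norm x > r2 + 1") (auto simp: u_def)
  qed
  finally show ?thesis unfolding u_def \<alpha>_def \<beta>_def T_def .
qed

text \<open>As the kernels shrink, both sides of \<open>mollified_equation\<close> acquire the same
  integral of \<open>N * u * T\<close>, for which boundedness of \<open>N\<close> and local square
  integrability of the fields suffice. What remains are two defect integrals, that is,
  Wronskians.\<close>

lemma wronskian_total_fields:
  assumes u1: "total_field \<kappa> N u1 a1 b1" and u2: "total_field \<kappa> N u2 a2 b2"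
    and N: "N \<in> borel_measurable borel" "\<And>x. norm (N x) \<le> M" "\<And>x. norm x > \<rho> \<Longrightarrow> N x = \<kappa>\<^sup>2"
    and \<kappa>: "\<kappa> \<noteq> 0" and r: "\<rho> < r"
  shows "wronskian a1 a2 r = wronskian b1 b2 r"
proof -
  \<comment> \<open>\<open>r\<close> is the midpoint of \<open>\<rho>\<close> and \<open>r1\<close>,
    which leaves room for mollification between \<open>r\<close> and \<open>r1\<close>.\<close>
  define r1 r2 where "r1 = 2 * r - \<rho>" and "r2 = r1 + 1"
  have rr: "r < r1" "r1 \<le> r2" "\<rho> < r1" using r by (auto simp: r1_def r2_def)
  have r12: "0 < r1" "r1 < r2" using rr rho by (auto simp: r2_def)
  obtain w :: "real^2 \<Rightarrow> complex" where w: "smooth_on UNIV w" "\<And>x. norm x \<le> r1 \<Longrightarrow> w x = 1" "\<And>x. norm x \<ge> r2 \<Longrightarrow> w x = 0"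
    using smooth_cutoff[OF r12] by auto
  obtain \<eta> :: "nat \<Rightarrow> real^2 \<Rightarrow> complex" where \<eta>: "\<And>n. smooth_on UNIV (\<eta> n)"
    "\<And>n x. norm x \<ge> 1 / real (Suc n) \<Longrightarrow> \<eta> n x = 0"
    and lim: "\<And>f g. sq_integrable f \<Longrightarrow> sq_integrable g \<Longrightarrow>
       (\<lambda>n. LINT x|lborel. f x * conv g (\<eta> n) x) \<longlonglongrightarrow> (LINT x|lborel. f x * g x)"
    using mollifier_sequence by blast
  define P Q V where "P = defect w \<kappa> a1" and "Q = defect w (- \<kappa>) b1" and "V = cball 0 (r2 + 1) - ball (0::real^2) r"
  define u T \<alpha> \<beta> where "u = (\<lambda>x. indicator (cball 0 (r2 + 1)) x * u2 x)" and "T = (\<lambda>x. w x * u1 x)"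
    and "\<alpha> = (\<lambda>x. indicator V x * a2 x)" and "\<beta> = (\<lambda>x. indicator V x * b2 x)"
  have a1: "Ck_on 2 S a1" "\<And>x. norm x > \<rho> \<Longrightarrow> lap a1 x = - \<kappa> * a1 x"
    and b1: "Ck_on 2 S b1" "\<And>x. norm x > \<rho> \<Longrightarrow> lap b1 x = - (- \<kappa>) * b1 x"
    using u1 by (auto simp: total_field_def)
  have a2: "Ck_on 2 S a2" "\<And>x. norm x > \<rho> \<Longrightarrow> lap a2 x = - \<kappa> * a2 x"
    and b2: "Ck_on 2 S b2" "\<And>x. norm x > \<rho> \<Longrightarrow> lap b2 x = - (- \<kappa>) * b2 x"
    using u2 by (auto simp: total_field_def)
  have cV: "compact V" unfolding V_def by (intro compact_diff) auto
  have VS: "V \<subseteq> S" using V_def r ext by auto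
  have su: "sq_integrable u" and sT: "sq_integrable T"
    using u1 u2 sq_integrable_cutoff[OF _ Ck_on_imp_continuous_on[OF smooth_on_imp_Ck[OF w(1)]] w(3), of u1]
    unfolding u_def T_def total_field_def by auto
  have s\<alpha>: "sq_integrable \<alpha>" and s\<beta>: "sq_integrable \<beta>" unfolding \<alpha>_def \<beta>_def
    using sq_integrable_indicator[OF cV continuous_on_subset[OF Ck_on_imp_continuous_on VS]] a2(1) b2(1) by auto
  have sP: "sq_integrable P" unfolding P_def by (rule defect_sq_integrable[OF w rr(3) a1])
  have sQ: "sq_integrable Q" unfolding Q_def by (rule defect_sq_integrable[OF w rr(3) b1])
  have sNT: "sq_integrable (\<lambda>x. N x * T x)" "sq_integrable (\<lambda>x. N x * u x)"
    using sq_integrable_mult_bounded[OF _ N(1,2)] sT su by auto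
  have "r1 - r > 0" using rr by simp
  then obtain n0 where n0: "1 / real (Suc n0) < r1 - r" using nat_approx_posE by blast
  have "(LINT x|lborel. u x * conv (\<lambda>x. N x * T x) (\<eta> n) x) + 2 * \<kappa> * ((LINT x|lborel. \<beta> x * conv Q (\<eta> n) x)
       - (LINT x|lborel. \<alpha> x * conv P (\<eta> n) x)) = (LINT x|lborel. (N x * u x) * conv T (\<eta> n) x)" if n: "n \<ge> n0" for n
  proof -
    have "1 / real (Suc n) \<le> 1 / real (Suc n0)" using n by (intro divide_left_mono) auto
    then have "1 / real (Suc n) < r1 - r" using n0 by simp
    then show ?thesis
      unfolding u_def T_def \<alpha>_def \<beta>_def
      by (intro mollified_equation[OF u1 u2 N w r rr(1,2) \<eta>(1) \<eta>(2)[of n] _ _ _ P_def Q_def V_def]) auto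
  qed
  then have ev: "\<forall>\<^sub>F n in sequentially. (LINT x|lborel. u x * conv (\<lambda>x. N x * T x) (\<eta> n) x) + 2 * \<kappa> * ((LINT x|lborel. \<beta> x * conv Q (\<eta> n) x)
       - (LINT x|lborel. \<alpha> x * conv P (\<eta> n) x)) = (LINT x|lborel. (N x * u x) * conv T (\<eta> n) x)"
    unfolding eventually_sequentially by blast
  have "(\<lambda>n. (LINT x|lborel. u x * conv (\<lambda>x. N x * T x) (\<eta> n) x) + 2 * \<kappa> * ((LINT x|lborel. \<beta> x * conv Q (\<eta> n) x)
       - (LINT x|lborel. \<alpha> x * conv P (\<eta> n) x))) \<longlonglongrightarrow>
     (LINT x|lborel. u x * (N x * T x)) + 2 * \<kappa> * ((LINT x|lborel. \<beta> x * Q x) - (LINT x|lborel. \<alpha> x * P x))"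
    by (intro tendsto_intros lim su sNT s\<alpha> s\<beta> sP sQ)
  from Lim_transform_eventually[OF this ev]
  have "(LINT x|lborel. u x * (N x * T x)) + 2 * \<kappa> * ((LINT x|lborel. \<beta> x * Q x) - (LINT x|lborel. \<alpha> x * P x))
     = (LINT x|lborel. (N x * u x) * T x)"
    using lim[OF sNT(2) sT] by (rule LIMSEQ_unique)
  then have "(LINT x|lborel. \<beta> x * Q x) = (LINT x|lborel. \<alpha> x * P x)"
    using \<kappa> by (simp add: mult_ac)
  moreover have "\<alpha> x * P x = a2 x * defect w \<kappa> a1 x" "\<beta> x * Q x = b2 x * defect w (- \<kappa>) b1 x" for x
    using defect_outer[of r2 w x, OF w(3)] defect_inner[of r1 w a1 \<kappa> x, OF w(2) a1(2)]
      defect_inner[of r1 w b1 "- \<kappa>" x, OF w(2) b1(2)] rr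
    by (cases "x \<in> V"; auto simp: \<alpha>_def \<beta>_def P_def Q_def V_def)+
  ultimately have "(LINT x|lborel. b2 x * defect w (- \<kappa>) b1 x) = (LINT x|lborel. a2 x * defect w \<kappa> a1 x)" by simp
  moreover have "(LINT x|lborel. a2 x * defect w \<kappa> a1 x) = - wronskian a2 a1 r"
    by (rule defect_area_integral[OF w r rr(1,2) a1 a2])
  moreover have "(LINT x|lborel. b2 x * defect w (- \<kappa>) b1 x) = - wronskian b2 b1 r"
    by (rule defect_area_integral[OF w r rr(1,2) b1 b2])
  ultimately show ?thesis
    by (simp add: wronskian_antisym[of a1] wronskian_antisym[of b1])
qed

end

section \<open>Reciprocity\<close>

lemma norm_plane_wave [simp]: "norm (plane_wave k d x) = 1"
  by (simp add: plane_wave_def)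

lemma plane_wave_derivative:
  "(plane_wave k d has_derivative (\<lambda>h. \<i> * of_real (k * (h \<bullet> d)) * plane_wave k d x)) (at x)"
proof -
  have 1: "((\<lambda>x. \<i> * of_real (k * (x \<bullet> d))) has_derivative (\<lambda>h. \<i> * of_real (k * (h \<bullet> d)))) (at x)"
    by (auto intro!: derivative_eq_intros)
  have 2: "(exp has_derivative (\<lambda>h. exp (\<i> * of_real (k * (x \<bullet> d))) * h)) (at (\<i> * of_real (k * (x \<bullet> d))))"
    using DERIV_exp[of "\<i> * of_real (k * (x \<bullet> d))"] by (simp add: has_field_derivative_def)
  show ?thesis
    using has_derivative_compose[OF 1 2] unfolding plane_wave_def[abs_def] by (simp add: mult.commute)
qed

lemma pd_plane_wave: "pd i (plane_wave k d) = (\<lambda>x. \<i> * of_real (k * d $ i) * plane_wave k d x)"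
  by (rule ext) (simp add: pd_eqI[OF plane_wave_derivative] inner_axis')

lemma Ck_on_plane_wave: "Ck_on m UNIV (plane_wave k d)"
proof (induction m)
  case 0
  then show ?case
    using has_derivative_continuous[OF plane_wave_derivative] by (simp add: continuous_at_imp_continuous_on)
next
  case (Suc m)
  then show ?case
    unfolding Ck_on.simps pd_plane_wave
    using plane_wave_derivative differentiableI by (blast intro: Ck_on_cmult[OF open_UNIV])
qed

lemma lap_plane_wave:
  assumes "norm d = 1"
  shows "lap (plane_wave k d) x = - of_real (k\<^sup>2) * plane_wave k d x"
proof -
  have sq: "(\<i> * c) * ((\<i> * c) * w) = - (c * c) * w" for c w :: complex
    by (simp add: algebra_simps)
  have "pd i (pd i (plane_wave k d)) x = - of_real (k\<^sup>2 * (d $ i * d $ i)) * plane_wave k d x" for i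
    unfolding pd_plane_wave
    using pd_cmult[of "plane_wave k d" x i "\<i> * of_real (k * d $ i)"] Ck_on_plane_wave[of 1 k d]
      sq[of "of_real (k * d $ i)" "plane_wave k d x"]
    by (simp add: pd_plane_wave power2_eq_square mult_ac)
  then have "lap (plane_wave k d) x = - of_real (k\<^sup>2 * (d $ 1 * d $ 1 + d $ 2 * d $ 2)) * plane_wave k d x"
    by (simp add: lap_def sum_2 algebra_simps)
  moreover have "d $ 1 * d $ 1 + d $ 2 * d $ 2 = 1"
    using assms by (simp add: norm_eq_1 inner_vec_def sum_2)
  ultimately show ?thesis by simp
qed

text \<open>Plane waves solve the equation with index 1; adding one to the scattered field therefore
  absorbs the source term.\<close>

lemma integral_plane_wave_bilap:
  assumes "norm d = 1" "test_function UNIV \<phi>"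
  shows "(LINT x|lborel. plane_wave k d x * lap (lap \<phi>) x) = of_real (k ^ 4) * (LINT x|lborel. plane_wave k d x * \<phi> x)"
proof -
  have green: "(LINT x|lborel. plane_wave k d x * lap \<psi> x) = - of_real (k\<^sup>2) * (LINT x|lborel. plane_wave k d x * \<psi> x)"
    if t: "test_function UNIV \<psi>" for \<psi>
  proof -
    obtain B where B: "smooth_on UNIV \<psi>" "\<And>x. norm x > B \<Longrightarrow> \<psi> x = 0"
      using test_function_bounded_support[OF t] by blast
    have "(LINT x|lborel. lap (plane_wave k d) x * \<psi> x) = (LINT x|lborel. plane_wave k d x * lap \<psi> x)"
      by (rule integral_green[OF open_UNIV Ck_on_plane_wave smooth_on_imp_Ck[OF B(1)] compact_cball[of 0 B]])
         (use B(2) in auto)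
    then show ?thesis unfolding lap_plane_wave[OF assms(1)] by (simp add: mult.assoc)
  qed
  show ?thesis
    unfolding green[OF test_function_lap[OF assms(2)]] green[OF assms(2)]
    by (simp add: power4_eq_xxxx power2_eq_square)
qed

text \<open>Plane waves solve the Helmholtz equation in the whole plane, so their constant Wronskian
  may be computed on arbitrarily small circles, where it is of the order of the radius.\<close>

lemma wronskian_plane_waves:
  assumes "norm d1 = 1" "norm d2 = 1" "r > 0" and k: "k > 0"
  shows "wronskian (plane_wave k d1) (plane_wave k d2) r = 0"
proof (rule ccontr)
  interpret exterior 0 UNIV by unfold_locales auto
  assume "wronskian (plane_wave k d1) (plane_wave k d2) r \<noteq> 0"
  define c where "c = norm (wronskian (plane_wave k d1) (plane_wave k d2) r)"
  have c: "c > 0" using \<open>wronskian _ _ r \<noteq> 0\<close> by (simp add: c_def)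
  have rad: "norm (radial (plane_wave k d) s t) \<le> 2 * k" if "norm d = 1" for d s t
  proof -
    have n: "norm (complex_of_real a * (\<i> * of_real (k * d $ i) * plane_wave k d x)) \<le> k" if "\<bar>a\<bar> \<le> 1" for a i x
    proof -
      have "\<bar>a\<bar> * \<bar>d $ i\<bar> \<le> 1 * 1"
        using component_le_norm_cart[of d i] \<open>norm d = 1\<close> that by (intro mult_mono) auto
      then have "k * (\<bar>a\<bar> * \<bar>d $ i\<bar>) \<le> k * 1" using k by (intro mult_left_mono) auto
      then show ?thesis using k by (simp add: norm_mult abs_mult mult_ac)
    qed
    show ?thesis unfolding radial_def pd_plane_wave
      using n[of "cos t" 1 "polar s t"] n[of "sin t" 2 "polar s t"]
      by (intro order_trans[OF norm_triangle_ineq]) simp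
  qed
  have "c \<le> s * (8 * pi * k)" if s: "s > 0" for s
  proof -
    have "c = norm (wronskian (plane_wave k d1) (plane_wave k d2) s)"
      unfolding c_def
      using wronskian_const[OF Ck_on_plane_wave Ck_on_plane_wave lap_plane_wave[OF assms(1)] lap_plane_wave[OF assms(2)] assms(3) s]
      by simp
    also have "\<dots> \<le> s * integral {0..2*pi} (\<lambda>t. 4 * k)"
    proof (rule wronskian_bound[OF Ck_on_plane_wave Ck_on_plane_wave s])
      show "(\<lambda>t. 4 * k) integrable_on {0..2*pi}" by (rule integrable_const_ivl)
      show "norm (plane_wave k d1 (polar s t) * radial (plane_wave k d2) s t - plane_wave k d2 (polar s t) * radial (plane_wave k d1) s t) \<le> 4 * k" for t
        using rad[OF assms(1), of s t] rad[OF assms(2), of s t]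
        by (intro order_trans[OF norm_triangle_ineq4]) (simp add: norm_mult)
    qed
    finally show ?thesis by (simp add: mult_ac)
  qed
  \<comment> \<open>At this radius the bound reads \<open>c \<le> c / 2\<close>.\<close>
  from this[of "c / (16 * pi * k)"] show False using c k by simp
qed

text \<open>Brings the exponential bound of an evanescent field into the form of the decay
  hypothesis in \<open>wronskian_evanescent\<close>.\<close>

lemma exp_decay_tendsto_0:
  fixes C a :: real
  assumes "a > 0"
  shows "((\<lambda>s. s * (C * exp (- a * s))\<^sup>2) \<longlongrightarrow> 0) at_top"
proof -
  have "((\<lambda>u::real. u ^ 1 / exp u) \<longlongrightarrow> 0) at_top" by (rule tendsto_power_div_exp_0)
  moreover have "filterlim (\<lambda>s. (2 * a) * s) at_top at_top"
    using assms by (intro filterlim_tendsto_pos_mult_at_top[OF tendsto_const]) (auto intro: filterlim_ident)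
  ultimately have "((\<lambda>s. ((2 * a) * s) ^ 1 / exp ((2 * a) * s)) \<longlongrightarrow> 0) at_top"
    by (rule filterlim_compose)
  from tendsto_mult[OF tendsto_const[of "C\<^sup>2 / (2 * a)"] this]
  have "((\<lambda>s. C\<^sup>2 / (2 * a) * (((2 * a) * s) ^ 1 / exp ((2 * a) * s))) \<longlongrightarrow> 0) at_top" by simp
  moreover have "C\<^sup>2 / (2 * a) * (((2 * a) * s) ^ 1 / exp ((2 * a) * s)) = s * (C * exp (- a * s))\<^sup>2" for s
  proof -
    have "(exp (- a * s))\<^sup>2 = 1 / exp ((2 * a) * s)"
      by (simp add: power2_eq_square exp_minus inverse_eq_divide flip: exp_add)
    then show ?thesis using assms by (simp add: power_mult_distrib)
  qed
  ultimately show ?thesis by simp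
qed

section \<open>Borel representatives of the data\<close>

lemma lebesgue_measurable_borel_representative:
  fixes f :: "'a::euclidean_space \<Rightarrow> complex"
  assumes "f \<in> borel_measurable lebesgue"
  obtains g where "g \<in> borel_measurable borel" "AE x in lborel. f x = g x"
proof -
  have "(\<lambda>x. Re (f x)) \<in> borel_measurable lebesgue" "(\<lambda>x. Im (f x)) \<in> borel_measurable lebesgue"
    using assms by auto
  then obtain p q where pq: "p \<in> borel_measurable lborel" "AE x in lborel. Re (f x) = p x"
      "q \<in> borel_measurable lborel" "AE x in lborel. Im (f x) = q x"
    using completion_ex_borel_measurable_real by metis
  show thesis
  proof
    have "(\<lambda>x. complex_of_real (p x) + \<i> * complex_of_real (q x)) \<in> borel_measurable borel"
      using pq(1,3) by simp
    then show "(\<lambda>x. Complex (p x) (q x)) \<in> borel_measurable borel" by (simp add: Complex_eq)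
    show "AE x in lborel. f x = Complex (p x) (q x)"
      using pq(2,4) by eventually_elim (simp add: complex_eq_iff)
  qed
qed

lemma lebesgue_integral_eq_lborel:
  fixes f g :: "'a::euclidean_space \<Rightarrow> complex"
  assumes "f \<in> borel_measurable lebesgue" "g \<in> borel_measurable borel" "AE x in lborel. f x = g x"
  shows "(LINT x|lebesgue. f x) = (LINT x|lborel. g x)"
proof -
  have "g \<in> borel_measurable lebesgue" using assms(2) by (intro measurable_completion) simp
  then have "(LINT x|lebesgue. f x) = (LINT x|lebesgue. g x)"
    using assms by (intro integral_cong_AE) (auto simp: AE_completion_iff)
  also have "\<dots> = (LINT x|lborel. g x)" using assms(2) by (intro integral_completion) simp
  finally show ?thesis .
qed

lemma sq_integrable_cong_AE:
  fixes f g :: "'a::euclidean_space \<Rightarrow> complex"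
  assumes "sq_integrable f" "g \<in> borel_measurable borel" "AE x in lborel. f x = g x"
  shows "sq_integrable g"
proof -
  have "integrable lborel (\<lambda>x. (norm (g x))\<^sup>2)"
  proof (rule integrable_cong_AE_imp)
    show "integrable lborel (\<lambda>x. (norm (f x))\<^sup>2)" using assms(1) by (simp add: sq_integrable_def)
    show "(\<lambda>x. (norm (g x))\<^sup>2) \<in> borel_measurable lborel" using assms(2) by simp
    show "AE x in lborel. (norm (f x))\<^sup>2 = (norm (g x))\<^sup>2" using assms(3) by eventually_elim simp
  qed
  then show ?thesis using assms(2) by (simp add: sq_integrable_def)
qed

lemma L2_loc_sq_integrable:
  assumes f: "L2_loc f" and g: "g \<in> borel_measurable borel" "AE x in lborel. f x = g x"
  shows "sq_integrable (\<lambda>x. indicator (cball 0 R) x * g x)"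
proof -
  have 1: "integrable lebesgue (\<lambda>x. indicator (cball 0 R) x *\<^sub>R (norm (f x))\<^sup>2)"
    using f unfolding L2_loc_def set_integrable_def by simp
  have m2: "(\<lambda>x. indicator (cball 0 R) x * g x) \<in> borel_measurable borel"
    by (intro borel_measurable_times borel_measurable_indicator g(1)) simp
  have m: "(\<lambda>x. (norm (indicator (cball 0 R) x * g x))\<^sup>2) \<in> borel_measurable borel"
    by (rule measurable_compose[OF m2]) simp
  have "integrable lebesgue (\<lambda>x. (norm (indicator (cball 0 R) x * g x))\<^sup>2)"
  proof (rule integrable_cong_AE_imp[OF 1])
    show "(\<lambda>x. (norm (indicator (cball 0 R) x * g x))\<^sup>2) \<in> borel_measurable lebesgue"
      using m by (intro measurable_completion) simp
    have "AE x in lborel. indicator (cball 0 R) x *\<^sub>R (norm (f x))\<^sup>2 = (norm (indicator (cball 0 R) x * g x))\<^sup>2"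
      using g(2) by eventually_elim (auto simp: indicator_def)
    then show "AE x in lebesgue. indicator (cball 0 R) x *\<^sub>R (norm (f x))\<^sup>2 = (norm (indicator (cball 0 R) x * g x))\<^sup>2"
      by (rule AE_completion)
  qed
  then have "integrable lborel (\<lambda>x. (norm (indicator (cball 0 R) x * g x))\<^sup>2)"
    using integrable_completion[of "\<lambda>x. (norm (indicator (cball 0 R) x * g x))\<^sup>2" lborel] m by simp
  then show ?thesis using m2 by (simp add: sq_integrable_def)
qed

context exterior begin

text \<open>The kernel of the far-field pattern is itself a plane wave, of direction
  \<open>- xhat\<close>. This is the origin of the reversed directions in the reciprocity
  relation.\<close>

lemma far_field_integral_eq_wronskian:
  assumes f: "Ck_on 2 S f" and R: "R > \<rho>"
  shows "far_field_integral k R f xhat = wronskian f (plane_wave k (- xhat)) R"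
proof -
  let ?e = "plane_wave k (- xhat)"
  have R0: "R > 0" using R rho by simp
  have e: "(\<lambda>z. exp (- \<i> * of_real (k * (xhat \<bullet> z)))) = ?e"
    by (simp add: plane_wave_def fun_eq_iff inner_commute)
  have Ce: "Ck_on 2 S ?e" by (rule Ck_on_subset[OF Ck_on_plane_wave subset_UNIV])
  note c = pairing_integrand_continuous[OF f Ce R] pairing_integrand_continuous[OF Ce f R]
  have rad: "dir_deriv (polar R t /\<^sub>R R) h (polar R t) = radial h R t" if "Ck_on 2 S h" for h t
  proof -
    have "h differentiable (at (polar R t))"
      using that polar_mem[OF R] by (auto simp: numeral_2_eq_2)
    then show ?thesis
      using R0 by (simp add: dir_deriv_eq radial_def sum_2 scaleR_conv_of_real[where 'a = complex] field_simps)
  qed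
  have "far_field_integral k R f xhat = integral {0..2*pi} (\<lambda>t. of_real R *
      (f (polar R t) * radial ?e R t - radial f R t * ?e (polar R t)))"
    unfolding far_field_integral_def circle_integral_def Let_def e polar_def[symmetric] rad[OF f] rad[OF Ce] ..
  also have "\<dots> = integral {0..2*pi} (\<lambda>t. of_real R * (f (polar R t) * radial ?e R t) - of_real R * (?e (polar R t) * radial f R t))"
    by (rule integral_cong) (simp add: algebra_simps)
  also have "\<dots> = wronskian f ?e R"
    unfolding wronskian_def pairing_def
    by (rule Henstock_Kurzweil_Integration.integral_diff)
       (auto intro!: integrable_continuous_interval continuous_intros c)
  finally show ?thesis .
qed

text \<open>Adding the incident wave turns the inhomogeneous equation for the scattered field into
  the homogeneous one for the total field; Lebesgue integrals become Borel ones on the way.\<close>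

lemma scattering_total_field:
  assumes d: "norm d = 1" and us: "L2_loc us" and eq: "biharmonic_eq k n (plane_wave k d) us"
    and dec: "AE x in lebesgue. norm x > \<rho> \<longrightarrow> us x = p x + b x"
    and p: "Ck_on 2 S p" "\<And>x. x \<in> S \<Longrightarrow> lap p x + of_real (k\<^sup>2) * p x = 0"
    and b: "Ck_on 2 S b" "\<And>x. x \<in> S \<Longrightarrow> lap b x - of_real (k\<^sup>2) * b x = 0"
    and n: "n \<in> borel_measurable lebesgue"
    and N: "N \<in> borel_measurable borel" "AE x in lborel. N x = of_real (k ^ 4) * n x" "\<And>x. norm (N x) \<le> M"
  shows "\<exists>u. total_field (of_real (k\<^sup>2)) N u (\<lambda>x. plane_wave k d x + p x) b"
proof -
  let ?e = "plane_wave k d"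
  let ?E = "{x::real^2. norm x > \<rho>}"
  have usm: "us \<in> borel_measurable lebesgue" using us by (simp add: L2_loc_def)
  obtain u0 where u0: "u0 \<in> borel_measurable borel" "AE x in lborel. us x = u0 x"
    using lebesgue_measurable_borel_representative[OF usm] .
  have Ce: "Ck_on 2 S ?e" by (rule Ck_on_subset[OF Ck_on_plane_wave subset_UNIV])
  have ce: "continuous_on UNIV ?e" by (rule Ck_on_imp_continuous_on[OF Ck_on_plane_wave[of 0]])
  then have me: "?e \<in> borel_measurable borel" by (rule borel_measurable_continuous_onI)
  have Ca: "Ck_on 2 S (\<lambda>x. ?e x + p x)" by (rule Ck_on_add[OF openS Ce p(1)])
  \<comment> \<open>A representative for which the decomposition holds at every point beyond
    \<open>\<rho>\<close>, not just almost everywhere.\<close>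
  define u where "u = (\<lambda>x. if norm x > \<rho> then ?e x + p x + b x else u0 x + ?e x)"
  have mu: "u \<in> borel_measurable borel"
  proof -
    have "continuous_on ?E (\<lambda>x. ?e x + p x + b x)"
      using continuous_on_subset[OF Ck_on_imp_continuous_on exterior_subset(1)] Ca b(1)
      by (intro continuous_on_add[of _ "\<lambda>x. ?e x + p x" b]) auto
    then have "(\<lambda>x. indicator ?E x *\<^sub>R (?e x + p x + b x)) \<in> borel_measurable borel"
      using exterior_subset(2) by (intro borel_measurable_continuous_on_indicator) auto
    moreover have "(\<lambda>x. indicator (- ?E) x *\<^sub>R (u0 x + ?e x)) \<in> borel_measurable borel"
      using u0(1) me exterior_subset(2) by simp
    ultimately have "(\<lambda>x. indicator ?E x *\<^sub>R (?e x + p x + b x) + indicator (- ?E) x *\<^sub>R (u0 x + ?e x)) \<in> borel_measurable borel"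
      by simp
    moreover have "(\<lambda>x. indicator ?E x *\<^sub>R (?e x + p x + b x) + indicator (- ?E) x *\<^sub>R (u0 x + ?e x)) = u"
      by (auto simp: u_def indicator_def fun_eq_iff)
    ultimately show ?thesis by simp
  qed
  have "AE x in lborel. norm x > \<rho> \<longrightarrow> us x = p x + b x" using dec by (simp add: AE_completion_iff)
  with u0(2) have ue: "AE x in lborel. u0 x + ?e x = u x"
    by eventually_elim (auto simp: u_def)
  have u0sq: "sq_integrable (\<lambda>x. indicator (cball 0 R) x * u0 x)" for R
    by (rule L2_loc_sq_integrable[OF us u0])
  have esq: "sq_integrable (\<lambda>x. indicator (cball 0 R) x * ?e x)" for R
    by (rule sq_integrable_indicator[OF compact_cball continuous_on_subset[OF ce]]) simp
  have usq: "sq_integrable (\<lambda>x. indicator (cball 0 R) x * u x)" for R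
  proof (rule sq_integrable_cong_AE[OF sq_integrable_add[OF u0sq esq]])
    show "(\<lambda>x. indicator (cball 0 R) x * u x) \<in> borel_measurable borel"
      by (intro borel_measurable_times borel_measurable_indicator mu) simp
    show "AE x in lborel. indicator (cball 0 R) x * u0 x + indicator (cball 0 R) x * ?e x = indicator (cball 0 R) x * u x"
      using ue by eventually_elim (simp flip: distrib_left)
  qed
  have weak: "(LINT x|lborel. u x * lap (lap \<phi>) x) = (LINT x|lborel. N x * u x * \<phi> x)" if t: "test_function UNIV \<phi>" for \<phi>
  proof -
    obtain B where B: "smooth_on UNIV \<phi>" "\<And>x. norm x > B \<Longrightarrow> \<phi> x = 0"
      using test_function_bounded_support[OF t] by blast
    let ?L = "lap (lap \<phi>)"
    have tL: "test_function UNIV ?L" by (intro test_function_lap t)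
    have B': "norm x > B \<Longrightarrow> ?L x = 0" for x by (rule lap_support_norm[OF lap_support_norm[OF B(2)]])
    have sq: "sq_integrable \<phi>" "sq_integrable ?L" using test_function_sq_integrable t tL by auto
    have sqN: "sq_integrable (\<lambda>x. N x * \<phi> x)" by (rule sq_integrable_mult_bounded[OF sq(1) N(1,3)])
    have m: "\<phi> \<in> borel_measurable borel" "?L \<in> borel_measurable borel" using sq by (auto simp: sq_integrable_def)
    then have ml: "\<phi> \<in> borel_measurable lebesgue" "?L \<in> borel_measurable lebesgue" "?e \<in> borel_measurable lebesgue"
      using me by (auto intro!: measurable_completion)
    have loc: "integrable lborel (\<lambda>x. h x * \<psi> x)"
      if "\<And>R. sq_integrable (\<lambda>x. indicator (cball 0 R) x * h x)" "sq_integrable \<psi>" "\<And>x. norm x > B \<Longrightarrow> \<psi> x = 0" for h \<psi>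
    proof -
      have "integrable lborel (\<lambda>x. (indicator (cball 0 B) x * h x) * \<psi> x)"
        by (rule sq_integrable_mult[OF that(1,2)])
      then show ?thesis
        by (rule back_subst[of "integrable lborel"]) (use that(3) in \<open>force simp: indicator_def\<close>)
    qed
    have i: "integrable lborel (\<lambda>x. u0 x * ?L x)" "integrable lborel (\<lambda>x. u0 x * (N x * \<phi> x))"
      "integrable lborel (\<lambda>x. ?e x * ?L x)" "integrable lborel (\<lambda>x. ?e x * (N x * \<phi> x))"
      "integrable lborel (\<lambda>x. ?e x * \<phi> x)" "integrable lborel (\<lambda>x. u x * ?L x)" "integrable lborel (\<lambda>x. u x * (N x * \<phi> x))"
      by (intro loc u0sq esq usq sq sqN; use B(2) B' in simp)+
    have "(LINT x|lborel. u0 x * ?L x - u0 x * (N x * \<phi> x)) = (LINT x|lebesgue. us x * ?L x - of_real (k^4) * n x * us x * \<phi> x)"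
    proof (rule lebesgue_integral_eq_lborel[symmetric])
      show "(\<lambda>x. us x * ?L x - of_real (k^4) * n x * us x * \<phi> x) \<in> borel_measurable lebesgue"
        using usm n ml by auto
      show "(\<lambda>x. u0 x * ?L x - u0 x * (N x * \<phi> x)) \<in> borel_measurable borel"
        using u0(1) N(1) m by auto
      show "AE x in lborel. us x * ?L x - of_real (k^4) * n x * us x * \<phi> x = u0 x * ?L x - u0 x * (N x * \<phi> x)"
        using u0(2) N(2) by eventually_elim (simp add: mult_ac)
    qed
    also have "\<dots> = (LINT x|lebesgue. - of_real (k^4) * (1 - n x) * ?e x * \<phi> x)"
      using eq t unfolding biharmonic_eq_def by blast
    also have "\<dots> = (LINT x|lborel. ?e x * (N x * \<phi> x) - of_real (k^4) * (?e x * \<phi> x))"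
    proof (rule lebesgue_integral_eq_lborel)
      show "(\<lambda>x. - of_real (k^4) * (1 - n x) * ?e x * \<phi> x) \<in> borel_measurable lebesgue"
        using n ml by auto
      show "(\<lambda>x. ?e x * (N x * \<phi> x) - of_real (k^4) * (?e x * \<phi> x)) \<in> borel_measurable borel"
        using me N(1) m by auto
      show "AE x in lborel. - of_real (k^4) * (1 - n x) * ?e x * \<phi> x = ?e x * (N x * \<phi> x) - of_real (k^4) * (?e x * \<phi> x)"
        using N(2) by eventually_elim (simp add: algebra_simps)
    qed
    finally have A: "(LINT x|lborel. u0 x * ?L x) - (LINT x|lborel. u0 x * (N x * \<phi> x)) =
       (LINT x|lborel. ?e x * (N x * \<phi> x)) - of_real (k^4) * (LINT x|lborel. ?e x * \<phi> x)"
      using i by simp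
    have uL: "(LINT x|lborel. u x * \<psi> x) = (LINT x|lborel. u0 x * \<psi> x) + (LINT x|lborel. ?e x * \<psi> x)"
      if "integrable lborel (\<lambda>x. u0 x * \<psi> x)" "integrable lborel (\<lambda>x. ?e x * \<psi> x)" "\<psi> \<in> borel_measurable borel" for \<psi>
    proof -
      have "(LINT x|lborel. u x * \<psi> x) = (LINT x|lborel. u0 x * \<psi> x + ?e x * \<psi> x)"
        using ue mu u0(1) me that(3) by (intro integral_cong_AE) (auto simp flip: distrib_right elim!: eventually_mono)
      then show ?thesis using that by simp
    qed
    have "(LINT x|lborel. u x * ?L x) = (LINT x|lborel. u x * (N x * \<phi> x))"
      using A integral_plane_wave_bilap[OF d t, of k] uL[OF i(1,3) m(2)] uL[OF i(2,4)] N(1) m(1)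
      by (simp add: algebra_simps)
    then show ?thesis by (simp add: mult_ac)
  qed
  have "lap (\<lambda>x. ?e x + p x) x = - of_real (k\<^sup>2) * (?e x + p x)" "lap b x = of_real (k\<^sup>2) * b x" if "norm x > \<rho>" for x
  proof -
    have "lap (\<lambda>x. ?e x + p x) x = lap ?e x + lap p x" by (rule lap_add[OF openS ext[OF that] Ce p(1)])
    moreover have "lap p x = - of_real (k\<^sup>2) * p x" using p(2)[OF ext[OF that]] by (simp add: add_eq_0_iff)
    ultimately show "lap (\<lambda>x. ?e x + p x) x = - of_real (k\<^sup>2) * (?e x + p x)"
      using lap_plane_wave[OF d, of k x] by (simp add: algebra_simps)
    show "lap b x = of_real (k\<^sup>2) * b x" using b(2)[OF ext[OF that]] by simp
  qed
  then have "total_field (of_real (k\<^sup>2)) N u (\<lambda>x. ?e x + p x) b"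
    unfolding total_field_def using usq Ca b(1) weak by (auto simp: u_def)
  then show ?thesis by blast
qed

end

text \<open>Boundedness and the value 1 outside \<open>D\<close> are given almost everywhere. A
  change on a null set yields a bound at every point and the exact value beyond
  \<open>\<rho>\<close>, the form in which \<open>cutoff_equation\<close> uses them.\<close>

lemma index_representative:
  assumes D: "absorbing_index D n" "closure D \<subseteq> cball 0 \<rho>"
  obtains N M where "N \<in> borel_measurable borel" "AE x in lborel. N x = of_real (k ^ 4) * n x"
    "\<And>x. norm (N x) \<le> M" "\<And>x. norm x > \<rho> \<Longrightarrow> N x = (of_real (k\<^sup>2))\<^sup>2"
proof -
  have nm: "n \<in> borel_measurable lebesgue" and n1: "AE x in lborel. x \<notin> D \<longrightarrow> n x = 1"
    using D(1) by (auto simp: absorbing_index_def AE_completion_iff)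
  obtain B where B: "AE x in lborel. x \<in> D \<longrightarrow> norm (n x) \<le> B"
    using D(1) by (auto simp: absorbing_index_def AE_completion_iff)
  obtain n0 where n0: "n0 \<in> borel_measurable borel" "AE x in lborel. n x = n0 x"
    using lebesgue_measurable_borel_representative[OF nm] .
  \<comment> \<open>The threshold is at least 1, since within radius \<open>\<rho>\<close> there may
    be points outside \<open>D\<close>, where the index is 1.\<close>
  define N where "N = (\<lambda>x. complex_of_real (k ^ 4) * (if norm x > \<rho> then 1 else if norm (n0 x) \<le> max 1 B then n0 x else 0))"
  show thesis
  proof
    show "N \<in> borel_measurable borel" unfolding N_def using n0(1) by measurable
    show "AE x in lborel. N x = of_real (k ^ 4) * n x"
      using n0(2) n1 B
    proof eventually_elim
      case (elim x)
      have "x \<notin> D" if "norm x > \<rho>" using that D(2) closure_subset by fastforce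
      then show ?case using elim by (cases "x \<in> D") (auto simp: N_def)
    qed
    show "norm (N x) \<le> k ^ 4 * max 1 B" for x
    proof -
      have "norm (if norm x > \<rho> then 1 else if norm (n0 x) \<le> max 1 B then n0 x else 0) \<le> max 1 B" by auto
      from mult_left_mono[OF this, of "k ^ 4"] show ?thesis
        unfolding N_def norm_mult norm_of_real by simp
    qed
    show "N x = (of_real (k\<^sup>2))\<^sup>2" if "norm x > \<rho>" for x
      using that by (simp add: N_def flip: power_mult)
  qed
qed

theorem theorem5p2:
  fixes k :: real
    and D :: "(real^2) set"
    and n :: "real^2 \<Rightarrow> complex"
    and us uinf :: "real^2 \<Rightarrow> real^2 \<Rightarrow> complex"
  assumes "k > 0"
    and "open D" and "bounded D" and "C2_boundary D"
    and "absorbing_index D n"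
    and "\<And>d. d \<in> sphere 0 1 \<Longrightarrow> scattering_solution k D n d (\<lambda>x. us x d)"
    and "\<And>d. d \<in> sphere 0 1 \<Longrightarrow> far_field_pattern k D (\<lambda>x. us x d) (\<lambda>xhat. uinf xhat d)"
  shows "\<forall>xhat \<in> sphere 0 1. \<forall>d \<in> sphere 0 1. uinf xhat d = uinf (- d) (- xhat)"
proof (intro ballI)
  fix xhat d :: "real^2"
  assume xhat: "xhat \<in> sphere 0 1" and d: "d \<in> sphere 0 1"
  \<comment> \<open>The second experiment: incident direction \<open>- xhat\<close>, observed in
    direction \<open>- d\<close>.\<close>
  define d' where "d' = - xhat"
  have d': "d' \<in> sphere 0 1" using xhat by (simp add: d'_def)
  have nd: "norm d = 1" "norm d' = 1" using d d' by auto
  obtain p1 b1 R1 where D1: "decomposition k D (\<lambda>x. us x d) p1 b1" "R1 > 0" "closure D \<subseteq> ball 0 R1"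
      and F1: "\<And>x. x \<in> sphere 0 1 \<Longrightarrow> uinf x d = far_field_integral k R1 p1 x"
    using assms(7)[OF d] unfolding far_field_pattern_def by blast
  obtain p2 b2 R2 where D2: "decomposition k D (\<lambda>x. us x d') p2 b2" "R2 > 0" "closure D \<subseteq> ball 0 R2"
      and F2: "\<And>x. x \<in> sphere 0 1 \<Longrightarrow> uinf x d' = far_field_integral k R2 p2 x"
    using assms(7)[OF d'] unfolding far_field_pattern_def by blast
  \<comment> \<open>The two patterns may come with different circles. The largest norm on the
    compact closure lies strictly below both radii.\<close>
  obtain \<rho> where \<rho>: "\<rho> \<ge> 0" "\<rho> < R1" "\<rho> < R2" "closure D \<subseteq> cball 0 \<rho>"
  proof (cases "D = {}")
    case True
    then show thesis using that[of 0] D1(2) D2(2) by simp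
  next
    case False
    have "compact (closure D)" using assms(3) by (simp add: compact_closure)
    moreover have "continuous_on (closure D) norm" by (intro continuous_intros)
    ultimately obtain z where z: "z \<in> closure D" "\<forall>y\<in>closure D. norm y \<le> norm z"
      using continuous_attains_sup[of "closure D" norm] False by auto
    have "norm z < R1" "norm z < R2" using z(1) D1(3) D2(3) by auto
    moreover have "closure D \<subseteq> cball 0 (norm z)" using z(2) by (auto simp: dist_norm)
    ultimately show thesis using that[of "norm z"] by simp
  qed
  define S where "S = - closure D"
  interpret exterior \<rho> S
    by unfold_locales (use \<rho> in \<open>auto simp: S_def\<close>)
  let ?e1 = "plane_wave k d" and ?e2 = "plane_wave k d'"
  obtain N M where N: "N \<in> borel_measurable borel" "AE x in lborel. N x = of_real (k ^ 4) * n x"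
    "\<And>x. norm (N x) \<le> M" "\<And>x. norm x > \<rho> \<Longrightarrow> N x = (of_real (k\<^sup>2))\<^sup>2"
    using index_representative[OF assms(5) \<rho>(4)] by blast
  have nm: "n \<in> borel_measurable lebesgue" using assms(5) by (simp add: absorbing_index_def)
  have tot: "\<exists>u. total_field (of_real (k\<^sup>2)) N u (\<lambda>x. plane_wave k c x + p x) b"
    if "c \<in> sphere 0 1" "decomposition k D (\<lambda>x. us x c) p b" for c p b
  proof -
    have sol: "scattering_solution k D n c (\<lambda>x. us x c)" by (rule assms(6)[OF that(1)])
    have "AE x in lebesgue. x \<notin> closure D \<longrightarrow> us x c = p x + b x"
      using that(2) by (simp add: decomposition_def)
    then have ae: "AE x in lebesgue. norm x > \<rho> \<longrightarrow> us x c = p x + b x"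
      by eventually_elim (use ext S_def in auto)
    show ?thesis
      by (rule scattering_total_field[OF _ _ _ ae _ _ _ _ nm N(1-3)])
         (use that sol in \<open>auto simp: scattering_solution_def H2_loc_def decomposition_def S_def\<close>)
  qed
  obtain u1 u2 where u1: "total_field (of_real (k\<^sup>2)) N u1 (\<lambda>x. ?e1 x + p1 x) b1"
    and u2: "total_field (of_real (k\<^sup>2)) N u2 (\<lambda>x. ?e2 x + p2 x) b2"
    using tot[OF d D1(1)] tot[OF d' D2(1)] by blast
  define r where "r = R1"
  have r: "r > \<rho>" using \<rho> by (simp add: r_def)
  have C: "Ck_on 2 S p1" "Ck_on 2 S p2" "Ck_on 2 S b1" "Ck_on 2 S b2" "Ck_on 2 S ?e1" "Ck_on 2 S ?e2"
    using D1(1) D2(1) Ck_on_subset[OF Ck_on_plane_wave subset_UNIV] by (auto simp: decomposition_def S_def)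
  have lp: "lap p1 x = - of_real (k\<^sup>2) * p1 x" "lap p2 x = - of_real (k\<^sup>2) * p2 x" if "norm x > \<rho>" for x
    using D1(1) D2(1) ext[OF that] by (auto simp: decomposition_def S_def add_eq_0_iff)
  have lb: "lap b1 x = of_real (k\<^sup>2) * b1 x" "lap b2 x = of_real (k\<^sup>2) * b2 x" if "norm x > \<rho>" for x
    using D1(1) D2(1) ext[OF that] by (auto simp: decomposition_def S_def)
  have le: "lap ?e1 x = - of_real (k\<^sup>2) * ?e1 x" "lap ?e2 x = - of_real (k\<^sup>2) * ?e2 x" for x
    using lap_plane_wave nd by auto
  have "wronskian b1 b2 r = 0"
  proof -
    obtain C1 c1 A1 where e1: "c1 > 0" "\<And>x. norm x \<ge> A1 \<Longrightarrow> norm (b1 x) \<le> C1 * exp (- c1 * norm x)"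
      using D1(1) unfolding decomposition_def by blast
    obtain C2 c2 A2 where e2: "c2 > 0" "\<And>x. norm x \<ge> A2 \<Longrightarrow> norm (b2 x) \<le> C2 * exp (- c2 * norm x)"
      using D2(1) unfolding decomposition_def by blast
    define \<epsilon> where "\<epsilon> = (\<lambda>s. s * (C1 * exp (- c1 * s))\<^sup>2 + s * (C2 * exp (- c2 * s))\<^sup>2)"
    have \<epsilon>: "(\<epsilon> \<longlongrightarrow> 0) at_top"
      unfolding \<epsilon>_def using tendsto_add[OF exp_decay_tendsto_0[OF e1(1)] exp_decay_tendsto_0[OF e2(1)]] by simp
    show ?thesis
    proof (rule wronskian_evanescent[OF C(3,4) _ lb _ \<epsilon> r])
      fix x :: "real^2" assume x: "norm x \<ge> max A1 A2"
      have "(norm (b1 x))\<^sup>2 \<le> (C1 * exp (- c1 * norm x))\<^sup>2" "(norm (b2 x))\<^sup>2 \<le> (C2 * exp (- c2 * norm x))\<^sup>2"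
        using e1(2)[of x] e2(2)[of x] x by (auto intro!: power_mono)
      then have "norm x * ((norm (b1 x))\<^sup>2 + (norm (b2 x))\<^sup>2) \<le> norm x * ((C1 * exp (- c1 * norm x))\<^sup>2 + (C2 * exp (- c2 * norm x))\<^sup>2)"
        by (intro mult_left_mono add_mono) auto
      then show "norm x * ((norm (b1 x))\<^sup>2 + (norm (b2 x))\<^sup>2) \<le> \<epsilon> (norm x)"
        by (simp add: \<epsilon>_def distrib_left)
    qed simp
  qed
  then have "0 = wronskian (\<lambda>x. ?e1 x + p1 x) (\<lambda>x. ?e2 x + p2 x) r"
    using wronskian_total_fields[OF u1 u2 N(1,3,4) _ r] assms(1) by simp
  also have "\<dots> = wronskian ?e1 ?e2 r + wronskian ?e1 p2 r + (wronskian p1 ?e2 r + wronskian p1 p2 r)"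
    by (simp add: wronskian_add_left wronskian_add_right C r Ck_on_add[OF openS])
  also have "wronskian ?e1 ?e2 r = 0"
    using wronskian_plane_waves[OF nd _ assms(1)] r rho by simp
  also have "wronskian p1 p2 r = 0"
    by (rule wronskian_sommerfeld[OF C(1,2) assms(1) lp _ _ r])
       (use D1(1) D2(1) in \<open>auto simp: decomposition_def\<close>)
  \<comment> \<open>The two mixed Wronskians sum to zero; antisymmetry turns this into an
    equality.\<close>
  finally have "wronskian p1 ?e2 r = wronskian p2 ?e1 r"
    by (simp add: wronskian_antisym[of ?e1] add_eq_0_iff)
  moreover have "uinf xhat d = wronskian p1 ?e2 r"
    using F1[OF xhat] far_field_integral_eq_wronskian[OF C(1) \<rho>(2)] by (simp add: d'_def r_def)
  moreover have "uinf (- d) d' = wronskian p2 ?e1 r"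
  proof -
    have "uinf (- d) d' = wronskian p2 ?e1 R2"
      using F2[of "- d"] far_field_integral_eq_wronskian[OF C(2) \<rho>(3), of k "- d"] d by simp
    \<comment> \<open>The second pattern is computed on the circle of radius \<open>R2\<close>, the
      first at \<open>r = R1\<close>; for two solutions of the same Helmholtz equation the Wronskian
      agrees on both.\<close>
    also have "\<dots> = wronskian p2 ?e1 r"
      by (rule wronskian_const[OF C(2,5) lp(2) le(1) \<rho>(3) r])
    finally show ?thesis .
  qed
  ultimately show "uinf xhat d = uinf (- d) (- xhat)" by (simp add: d'_def)
qed

end
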